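(* Let $P$ be a finite graded poset (all maximal saturated chains have the same number of edges) and let $G$ be a subgroup of $\mathrm{Aut}(P)$. Then ${\mathfrak{h}^*}^G_P(t)$ is $\gamma$-effective: writing $s=|P|-r_P-1$, where $r_P$ is the common number of edges of the maximal saturated chains of $P$, and \[{\mathfrak{h}^*}^G_{P}(t) = \sum_{i=0}^{\lfloor s/2\rfloor}\boldsymbol\gamma_i\,t^i(1+t)^{s-2i}\] with $\boldsymbol\gamma_i\in\mathrm{R}_G$, every $\boldsymbol\gamma_i$ is the character of an actual (non-virtual) representation of $G$.
   Context: $\mathrm{R}_G$ is the ring of virtual complex characters of the finite group $G$; an element is effective if it is a nonnegative integer combination of irreducible characters. The order polytope of a finite poset $P$ is $\mathscr{O}(P)=\{f\colon P\to[0,1]\mid p\le_P q\Rightarrow f(p)\ge f(q)\}\subset\mathbb{R}^P$. $G\le\mathrm{Aut}(P)$ acts on $\mathbb{Z}^P$ by $g\cdot f=f\circ g^{-1}$, preserving each dilate $m\mathscr{O}(P)$ ($m\ge0$; $0\mathscr{O}(P)=\{0\}$); let $\chi_m$ be the character of the permutation representation on $m\mathscr{O}(P)\cap\mathbb{Z}^P$ and $\eta_G$ the representation on $\mathbb{C}^P$. The equivariant $h^*$-series is ${\mathfrak{h}^*}^G_P(t)=\big(\sum_{m\ge0}\chi_mt^m\big)(1-t)\sum_{i=0}^{|P|}(-1)^i\chi_{\wedge^i\eta_G}t^i\in\mathrm{R}_G[[t]]$; for graded $P$ it is a palindromic polynomial of degree $s=|P|-r_P-1$, so the $\boldsymbol\gamma_i$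 above are uniquely defined. *)

theory Defs
  imports
    "HOL-Library.Function_Algebras"
    "HOL-Library.FuncSet"
    "HOL-Library.Countable_Set"
    "HOL-Computational_Algebra.Formal_Power_Series"
    "HOL-Algebra.Bij"
    "Jordan_Normal_Form.Determinant"
    "Jordan_Normal_Form.DL_Submatrix"
    "Jordan_Normal_Form.VS_Connect"
begin

section \<open>Complex representations and characters\<close>

text \<open>A representation of \<open>\<Gamma>\<close> of degree \<open>n\<close> is a homomorphism into \<open>GL n\<close> over the complex
  numbers. Degree \<open>0\<close> is allowed, so the zero function is a character.\<close>

definition representation :: "('g, 'm) monoid_scheme \<Rightarrow> nat \<Rightarrow> ('g \<Rightarrow> complex mat) \<Rightarrow> bool" where
  "representation \<Gamma> n \<rho> \<longleftrightarrow> \<rho> \<in> hom \<Gamma> (units_of (ring_mat TYPE(complex) n ()))"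

definition irreducible_rep :: "('g, 'm) monoid_scheme \<Rightarrow> nat \<Rightarrow> ('g \<Rightarrow> complex mat) \<Rightarrow> bool" where
  "irreducible_rep \<Gamma> n \<rho> \<longleftrightarrow> representation \<Gamma> n \<rho> \<and> n > 0 \<and>
     (\<forall>W. VectorSpace.subspace class_ring W (module_vec TYPE(complex) n) \<and>
          (\<forall>g\<in>carrier \<Gamma>. \<forall>w\<in>W. \<rho> g *\<^sub>v w \<in> W) \<longrightarrow>
        W = {0\<^sub>v n} \<or> W = carrier_vec n)"

definition mat_trace :: "'a::comm_monoid_add mat \<Rightarrow> 'a" where
  "mat_trace A = (\<Sum>i<dim_row A. A $$ (i, i))"

text \<open>Class functions on \<open>\<Gamma>\<close> are extended by \<open>0\<close> outside the carrier, so that equality of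
  characters is equality of functions. They are added and multiplied pointwise.\<close>

definition character_of :: "('g, 'm) monoid_scheme \<Rightarrow> ('g \<Rightarrow> complex mat) \<Rightarrow> 'g \<Rightarrow> complex" where
  "character_of \<Gamma> \<rho> = (\<lambda>g. if g \<in> carrier \<Gamma> then mat_trace (\<rho> g) else 0)"

definition characters :: "('g, 'm) monoid_scheme \<Rightarrow> ('g \<Rightarrow> complex) set" where
  "characters \<Gamma> = {character_of \<Gamma> \<rho> |n \<rho>. representation \<Gamma> n \<rho>}"

definition irreducible_characters :: "('g, 'm) monoid_scheme \<Rightarrow> ('g \<Rightarrow> complex) set" where
  "irreducible_characters \<Gamma> = {character_of \<Gamma> \<rho> |n \<rho>. irreducible_rep \<Gamma> n \<rho>}"

definition virtual_characters :: "('g, 'm) monoid_scheme \<Rightarrow> ('g \<Rightarrow> complex) set" where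
  "virtual_characters \<Gamma> =
     {(\<Sum>\<chi>\<in>X. of_int (a \<chi>) * \<chi>) |X a. finite X \<and> X \<subseteq> irreducible_characters \<Gamma>}"

definition effective :: "('g, 'm) monoid_scheme \<Rightarrow> ('g \<Rightarrow> complex) \<Rightarrow> bool" where
  "effective \<Gamma> \<phi> \<longleftrightarrow>
     (\<exists>X a. finite X \<and> X \<subseteq> irreducible_characters \<Gamma> \<and> \<phi> = (\<Sum>\<chi>\<in>X. of_nat (a \<chi>) * \<chi>))"

text \<open>The permutation representation on the space with basis a finite set \<open>X\<close>, on which the
  group acts by \<open>act\<close>; the basis is ordered by \<^const>\<open>from_nat_into\<close>, which enumerates
  \<open>X\<close> along \<open>{..<card X}\<close>. Column \<open>j\<close> is the image of the \<open>j\<close>-th basis vector.\<close>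

definition perm_rep :: "'x set \<Rightarrow> ('g \<Rightarrow> 'x \<Rightarrow> 'x) \<Rightarrow> 'g \<Rightarrow> complex mat" where
  "perm_rep X act g = mat (card X) (card X)
     (\<lambda>(i, j). if from_nat_into X i = act g (from_nat_into X j) then 1 else 0)"

text \<open>The matrix of the \<open>k\<close>-th exterior power of \<open>A\<close> (square of size \<open>n\<close>) in the basis of the
  wedge products of the \<open>k\<close>-subsets of the standard basis, taken in increasing order: the
  coefficient of \<open>e\<^sub>S\<close> in the image of \<open>e\<^sub>T\<close> is the minor of \<open>A\<close> with rows \<open>S\<close> and columns \<open>T\<close>.\<close>

definition exterior_power_mat :: "nat \<Rightarrow> complex mat \<Rightarrow> complex mat" where
  "exterior_power_mat k A =
     (let B = {S. S \<subseteq> {..<dim_row A} \<and> card S = k}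
      in mat (card B) (card B)
           (\<lambda>(i, j). det (submatrix A (from_nat_into B i) (from_nat_into B j))))"

section \<open>Finite posets\<close>

definition covers :: "'a set \<Rightarrow> 'a rel \<Rightarrow> 'a \<Rightarrow> 'a \<Rightarrow> bool" where
  "covers P r p q \<longleftrightarrow> p \<in> P \<and> q \<in> P \<and> p \<noteq> q \<and> (p, q) \<in> r \<and>
     \<not> (\<exists>z\<in>P. z \<noteq> p \<and> z \<noteq> q \<and> (p, z) \<in> r \<and> (z, q) \<in> r)"

definition saturated_chain :: "'a set \<Rightarrow> 'a rel \<Rightarrow> 'a list \<Rightarrow> bool" where
  "saturated_chain P r c \<longleftrightarrow> c \<noteq> [] \<and> set c \<subseteq> P \<and> successively (covers P r) c"

definition maximal_saturated_chain :: "'a set \<Rightarrow> 'a rel \<Rightarrow> 'a list \<Rightarrow> bool" where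
  "maximal_saturated_chain P r c \<longleftrightarrow> saturated_chain P r c \<and>
     \<not> (\<exists>d. saturated_chain P r d \<and> set c \<subset> set d)"

text \<open>A chain with \<open>k\<close> edges is a list of length \<open>Suc k\<close>. The empty poset has no (nonempty)
  chain, hence is graded, and its \<open>poset_rank\<close> is left unspecified.\<close>

definition graded :: "'a set \<Rightarrow> 'a rel \<Rightarrow> bool" where
  "graded P r \<longleftrightarrow>
     (\<exists>k. \<forall>c. maximal_saturated_chain P r c \<longrightarrow> length c = Suc k)"

definition poset_rank :: "'a set \<Rightarrow> 'a rel \<Rightarrow> nat" where
  "poset_rank P r = (THE k. \<exists>c. maximal_saturated_chain P r c \<and> length c = Suc k)"

definition poset_aut :: "'a set \<Rightarrow> 'a rel \<Rightarrow> ('a \<Rightarrow> 'a) monoid" where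
  "poset_aut P r = BijGroup P
     \<lparr>carrier := {f \<in> Bij P. \<forall>x\<in>P. \<forall>y\<in>P. (f x, f y) \<in> r \<longleftrightarrow> (x, y) \<in> r}\<rparr>"

section \<open>The order polytope and the equivariant $h^*$-series\<close>

definition order_polytope :: "'a set \<Rightarrow> 'a rel \<Rightarrow> ('a \<Rightarrow> real) set" where
  "order_polytope P r =
     {f \<in> P \<rightarrow>\<^sub>E {0..1}. \<forall>p\<in>P. \<forall>q\<in>P. (p, q) \<in> r \<longrightarrow> f p \<ge> f q}"

definition lattice_points :: "'a set \<Rightarrow> 'a rel \<Rightarrow> nat \<Rightarrow> ('a \<Rightarrow> real) set" where
  "lattice_points P r m =
     (\<lambda>f. \<lambda>p\<in>P. real m * f p) ` order_polytope P r \<inter> (P \<rightarrow>\<^sub>E \<int>)"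

definition translate :: "'a set \<Rightarrow> ('a \<Rightarrow> 'a) \<Rightarrow> ('a \<Rightarrow> 'b) \<Rightarrow> 'a \<Rightarrow> 'b" where
  "translate P g f = (\<lambda>p\<in>P. f (inv_into P g p))"

abbreviation group_on :: "'a set \<Rightarrow> 'a rel \<Rightarrow> ('a \<Rightarrow> 'a) set \<Rightarrow> ('a \<Rightarrow> 'a) monoid" where
  "group_on P r G \<equiv> poset_aut P r \<lparr>carrier := G\<rparr>"

definition lattice_character ::
  "'a set \<Rightarrow> 'a rel \<Rightarrow> ('a \<Rightarrow> 'a) set \<Rightarrow> nat \<Rightarrow> ('a \<Rightarrow> 'a) \<Rightarrow> complex" where
  "lattice_character P r G m =
     character_of (group_on P r G) (perm_rep (lattice_points P r m) (translate P))"

text \<open>The representation on complex-valued functions on \<open>P\<close>: the indicator function of \<open>p\<close> is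
  sent by \<open>g\<close> to that of \<open>g p\<close>, so the action on the standard basis is that of \<open>g\<close> on \<open>P\<close>.\<close>

definition eta :: "'a set \<Rightarrow> ('a \<Rightarrow> 'a) \<Rightarrow> complex mat" where
  "eta P = perm_rep P (\<lambda>g p. g p)"

definition exterior_character ::
  "'a set \<Rightarrow> 'a rel \<Rightarrow> ('a \<Rightarrow> 'a) set \<Rightarrow> nat \<Rightarrow> ('a \<Rightarrow> 'a) \<Rightarrow> complex" where
  "exterior_character P r G i =
     character_of (group_on P r G) (\<lambda>g. exterior_power_mat i (eta P g))"

definition equivariant_h_star ::
  "'a set \<Rightarrow> 'a rel \<Rightarrow> ('a \<Rightarrow> 'a) set \<Rightarrow> (('a \<Rightarrow> 'a) \<Rightarrow> complex) fps" where
  "equivariant_h_star P r G =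
     Abs_fps (lattice_character P r G) * (1 - fps_X) *
     (\<Sum>i\<le>card P. fps_const ((-1) ^ i * exterior_character P r G i) * fps_X ^ i)"

definition gamma_expansion ::
  "('g, 'm) monoid_scheme \<Rightarrow> nat \<Rightarrow> ('g \<Rightarrow> complex) fps \<Rightarrow> (nat \<Rightarrow> 'g \<Rightarrow> complex) \<Rightarrow> bool" where
  "gamma_expansion \<Gamma> s h \<gamma> \<longleftrightarrow> (\<forall>i\<le>s div 2. \<gamma> i \<in> virtual_characters \<Gamma>) \<and>
     h = (\<Sum>i\<le>s div 2. fps_const (\<gamma> i) * fps_X ^ i * (1 + fps_X) ^ (s - 2 * i))"

end

theory Submission
  imports Defs "HOL-Combinatorics.Cycles"
begin

text \<open>Let \<open>\<rho>\<close> be the rank function of \<open>P\<close> and \<open>R\<close> its maximal value. Replacing a lattice point \<open>f\<close> of the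
  \<open>m\<close>-th dilate by \<open>F = 2 (m - f) + \<rho>\<close> identifies the lattice points with the strictly increasing
  maps \<open>F\<close> whose parity is that of \<open>\<rho>\<close>. Elements of different rank parity then never have the
  same value, so \<open>F\<close> sorts \<open>P\<close> into consecutive runs of constant rank parity, and each run is an
  antichain. This expresses the \<open>h\<^sup>*\<close>-series as a sum over such sorted partitions of products
  of the equivariant Eulerian polynomials of the runs. The equivariant Eulerian polynomial of an
  antichain is \<open>\<gamma>\<close>-effective because its \<open>\<gamma>\<close>-coefficients are sums of ribbon characters: those
  whose descent set has no two consecutive elements and avoids the last position. A ribbon
  character is an alternating sum of permutation characters on chains of subsets. All this is done
  for all runs at once. The ribbon characters of \<open>P\<close> are indexed by words that
  record the switches of parity and the descents, and the identity of series is checked for one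
  group element at a time by a transfer recursion on its invariant down-sets.\<close>

section \<open>Characters of representations on finite index sets\<close>

text \<open>Effectiveness and the identity of series are proved separately because the ribbon
  characters have no sign pointwise: each is the character of a quotient representation, yet takes
  negative values at some group elements. Descent sets of labelled chains cannot serve as the
  definition, since G need not respect a labelling of \<open>P\<close>; the alternating sum is
  G-stable by construction, and a labelling enters only to pick a basis. The exterior powers
  contribute det(1 - X g). Within a run, the terms of its expansion over g-invariant subsets are the
  entries of the inverse of the incidence matrix of down-sets graded by size; this is the link
  between words and counts of level functions. The degree comes from the switches: a chain from
  bottom to top forces at least R of them, so R + 2e occur, of which R div 2 + e carry the weight X.
  The common factor X^(R div 2) is matched by using 2 (m + R div 2) + 2 levels for the m-th dilate,
  and cancels. What remains is symmetric about s / 2 with s = |P| - R - 1.\<close>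

definition on_carrier :: "('g, 'm) monoid_scheme \<Rightarrow> ('g \<Rightarrow> complex) \<Rightarrow> 'g \<Rightarrow> complex" where
  "on_carrier \<Gamma> f = (\<lambda>g. if g \<in> carrier \<Gamma> then f g else 0)"

text \<open>Rows and columns are labelled by an arbitrary finite set, so that bases made of
  functions or chains can be used without an enumeration. Invertibility comes from the
  multiplication law, as the unit of the group goes to the identity matrix.\<close>

definition index_rep ::
  "('g, 'm) monoid_scheme \<Rightarrow> 'i set \<Rightarrow> ('g \<Rightarrow> 'i \<Rightarrow> 'i \<Rightarrow> complex) \<Rightarrow> bool" where
  "index_rep \<Gamma> Y N \<longleftrightarrow> finite Y \<and>
     (\<forall>g\<in>carrier \<Gamma>. \<forall>h\<in>carrier \<Gamma>. \<forall>i\<in>Y. \<forall>k\<in>Y.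
        N (g \<otimes>\<^bsub>\<Gamma>\<^esub> h) i k = (\<Sum>j\<in>Y. N g i j * N h j k)) \<and>
     (\<forall>i\<in>Y. \<forall>k\<in>Y. N \<one>\<^bsub>\<Gamma>\<^esub> i k = (if i = k then 1 else 0))"

lemma on_carrier_cong: "(\<And>g. g \<in> carrier \<Gamma> \<Longrightarrow> f g = f' g) \<Longrightarrow> on_carrier \<Gamma> f = on_carrier \<Gamma> f'"
  by (auto simp: on_carrier_def)

lemma on_carrier_add: "on_carrier \<Gamma> (\<lambda>g. f g + f' g) = on_carrier \<Gamma> f + on_carrier \<Gamma> f'"
  by (auto simp: on_carrier_def plus_fun_def)

lemma representation_iff:
  assumes "group \<Gamma>"
  shows "representation \<Gamma> n \<rho> \<longleftrightarrow>
    (\<forall>g\<in>carrier \<Gamma>. \<rho> g \<in> carrier_mat n n) \<and>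
    (\<forall>g\<in>carrier \<Gamma>. \<forall>h\<in>carrier \<Gamma>. \<rho> (g \<otimes>\<^bsub>\<Gamma>\<^esub> h) = \<rho> g * \<rho> h) \<and> \<rho> \<one>\<^bsub>\<Gamma>\<^esub> = 1\<^sub>m n"
    (is "?l \<longleftrightarrow> ?r")
proof -
  interpret group \<Gamma> by fact
  let ?R = "ring_mat TYPE(complex) n ()"
  have rg: "Group.monoid ?R" by (rule ring.is_monoid[OF ring_mat])
  show ?thesis
  proof
    assume l: ?l
    then have h: "\<rho> \<in> hom \<Gamma> (units_of ?R)" by (simp add: representation_def)
    have u: "\<rho> g \<in> Units ?R" if "g \<in> carrier \<Gamma>" for g
      using h that by (auto simp: hom_def units_of_def)
    have c: "\<rho> g \<in> carrier_mat n n" if "g \<in> carrier \<Gamma>" for g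
      using u[OF that] by (simp add: Units_def ring_mat_simps)
    have m: "\<rho> (g \<otimes>\<^bsub>\<Gamma>\<^esub> k) = \<rho> g * \<rho> k" if "g \<in> carrier \<Gamma>" "k \<in> carrier \<Gamma>" for g k
      using h that by (auto simp: hom_def units_of_def ring_mat_simps)
    have "group (units_of ?R)" using rg by (rule monoid.units_group)
    then have "\<rho> \<one>\<^bsub>\<Gamma>\<^esub> = \<one>\<^bsub>units_of ?R\<^esub>"
      using h is_group hom_one by blast
    then have "\<rho> \<one>\<^bsub>\<Gamma>\<^esub> = 1\<^sub>m n" by (simp add: units_of_def ring_mat_simps)
    with c m show ?r by blast
  next
    assume r: ?r
    have "\<rho> g \<in> Units ?R" if g: "g \<in> carrier \<Gamma>" for g
    proof -
      have "\<rho> g * \<rho> (inv\<^bsub>\<Gamma>\<^esub> g) = 1\<^sub>m n" "\<rho> (inv\<^bsub>\<Gamma>\<^esub> g) * \<rho> g = 1\<^sub>m n"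
        using r g by (metis inv_closed r_inv, metis inv_closed l_inv)
      then show ?thesis using r g inv_closed[OF g]
        by (auto simp: Units_def ring_mat_simps)
    qed
    then show ?l using r
      by (auto simp: representation_def hom_def units_of_def ring_mat_simps)
  qed
qed

lemma index_rep_representation:
  assumes G: "group \<Gamma>" and N: "index_rep \<Gamma> Y N"
  shows "\<exists>\<rho>. representation \<Gamma> (card Y) \<rho> \<and> character_of \<Gamma> \<rho> = on_carrier \<Gamma> (\<lambda>g. \<Sum>i\<in>Y. N g i i)"
proof -
  let ?k = "card Y" and ?e = "from_nat_into Y"
  define \<rho> where "\<rho> g = mat ?k ?k (\<lambda>(i, j). N g (?e i) (?e j))" for g
  have fin: "finite Y" using N by (simp add: index_rep_def)
  have b: "bij_betw ?e {..<?k} Y" using fin by (rule bij_betw_from_nat_into_finite)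
  have eY: "?e i \<in> Y" if "i < ?k" for i using b that by (auto simp: bij_betw_def)
  have einj: "?e i = ?e j \<longleftrightarrow> i = j" if "i < ?k" "j < ?k" for i j
    using b that by (auto simp: bij_betw_def inj_on_def)
  have s: "(\<Sum>i<?k. f (?e i)) = (\<Sum>i\<in>Y. f i)" for f :: "_ \<Rightarrow> complex"
    by (rule sum.reindex_bij_betw[OF b])
  have "representation \<Gamma> ?k \<rho>"
    unfolding representation_iff[OF G]
  proof (intro conjI ballI)
    show "\<rho> g \<in> carrier_mat ?k ?k" for g by (simp add: \<rho>_def)
    fix g h assume g: "g \<in> carrier \<Gamma>" and h: "h \<in> carrier \<Gamma>"
    show "\<rho> (g \<otimes>\<^bsub>\<Gamma>\<^esub> h) = \<rho> g * \<rho> h"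
    proof (rule eq_matI)
      fix i j assume ij: "i < dim_row (\<rho> g * \<rho> h)" "j < dim_col (\<rho> g * \<rho> h)"
      then have ij: "i < ?k" "j < ?k" by (auto simp: \<rho>_def)
      have "(\<rho> g * \<rho> h) $$ (i, j) = (\<Sum>l<?k. N g (?e i) (?e l) * N h (?e l) (?e j))"
        using ij by (simp add: \<rho>_def scalar_prod_def atLeast0LessThan)
      also have "\<dots> = (\<Sum>l\<in>Y. N g (?e i) l * N h l (?e j))" by (rule s)
      also have "\<dots> = N (g \<otimes>\<^bsub>\<Gamma>\<^esub> h) (?e i) (?e j)"
        using N g h ij eY by (simp add: index_rep_def)
      finally show "\<rho> (g \<otimes>\<^bsub>\<Gamma>\<^esub> h) $$ (i, j) = (\<rho> g * \<rho> h) $$ (i, j)"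
        using ij by (simp add: \<rho>_def)
    qed (auto simp: \<rho>_def)
  next
    show "\<rho> \<one>\<^bsub>\<Gamma>\<^esub> = 1\<^sub>m ?k"
      using N eY einj by (intro eq_matI) (auto simp: \<rho>_def index_rep_def)
  qed
  moreover have "character_of \<Gamma> \<rho> = on_carrier \<Gamma> (\<lambda>g. \<Sum>i\<in>Y. N g i i)"
    unfolding character_of_def on_carrier_def mat_trace_def
    by (auto simp: fun_eq_iff \<rho>_def s[of "\<lambda>i. N _ i i"])
  ultimately show ?thesis by blast
qed

lemma representation_index_rep:
  assumes G: "group \<Gamma>" and R: "representation \<Gamma> n \<rho>"
  shows "index_rep \<Gamma> {..<n} (\<lambda>g i j. \<rho> g $$ (i, j))"
    and "character_of \<Gamma> \<rho> = on_carrier \<Gamma> (\<lambda>g. \<Sum>i<n. \<rho> g $$ (i, i))"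
proof -
  have c: "\<rho> g \<in> carrier_mat n n" if "g \<in> carrier \<Gamma>" for g
    using R that by (simp add: representation_iff[OF G])
  then have d: "dim_row (\<rho> g) = n" "dim_col (\<rho> g) = n" if "g \<in> carrier \<Gamma>" for g
    using that by auto
  show "index_rep \<Gamma> {..<n} (\<lambda>g i j. \<rho> g $$ (i, j))"
    using R d unfolding index_rep_def representation_iff[OF G]
    by (auto simp: scalar_prod_def atLeast0LessThan)
  show "character_of \<Gamma> \<rho> = on_carrier \<Gamma> (\<lambda>g. \<Sum>i<n. \<rho> g $$ (i, i))"
    using d by (auto simp: character_of_def on_carrier_def mat_trace_def)
qed

text \<open>Block triangularity in either direction: if the entries \<open>N h j k\<close> vanish,
  \<open>Z\<close> spans a subrepresentation; if the entries \<open>N g i j\<close> vanish, the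
  complement of \<open>Z\<close> spans one and \<open>Z\<close> indexes the quotient. In both cases
  the indices outside \<open>Z\<close> drop out of the matrix product.\<close>

lemma index_rep_subset:
  assumes N: "index_rep \<Gamma> Y N" and Z: "Z \<subseteq> Y"
    and z: "\<And>g i j k. g \<in> carrier \<Gamma> \<Longrightarrow> i \<in> Z \<Longrightarrow> k \<in> Z \<Longrightarrow> j \<in> Y - Z \<Longrightarrow> N g i j = 0 \<or> (\<forall>h\<in>carrier \<Gamma>. N h j k = 0)"
  shows "index_rep \<Gamma> Z N"
  unfolding index_rep_def
proof (intro conjI ballI)
  have fin: "finite Y" using N by (simp add: index_rep_def)
  then show "finite Z" using Z finite_subset by blast
  fix g h i k assume g: "g \<in> carrier \<Gamma>" "h \<in> carrier \<Gamma>" and i: "i \<in> Z" "k \<in> Z"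
  have "N (g \<otimes>\<^bsub>\<Gamma>\<^esub> h) i k = (\<Sum>j\<in>Y. N g i j * N h j k)"
    using N g i Z unfolding index_rep_def by blast
  also have "\<dots> = (\<Sum>j\<in>Z. N g i j * N h j k)"
    using z[OF g(1) i] g by (intro sum.mono_neutral_right) (use fin Z in auto)
  finally show "N (g \<otimes>\<^bsub>\<Gamma>\<^esub> h) i k = (\<Sum>j\<in>Z. N g i j * N h j k)" .
next
  fix i k assume "i \<in> Z" "k \<in> Z"
  then show "N \<one>\<^bsub>\<Gamma>\<^esub> i k = (if i = k then 1 else 0)"
    using N Z unfolding index_rep_def by blast
qed

lemma index_rep_character:
  assumes "group \<Gamma>" "index_rep \<Gamma> Y N"
  shows "on_carrier \<Gamma> (\<lambda>g. \<Sum>i\<in>Y. N g i i) \<in> characters \<Gamma>"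
  using index_rep_representation[OF assms] unfolding characters_def by force

lemma characters_add:
  assumes G: "group \<Gamma>" and "\<phi> \<in> characters \<Gamma>" "\<psi> \<in> characters \<Gamma>"
  shows "\<phi> + \<psi> \<in> characters \<Gamma>"
proof -
  obtain n \<rho> m \<sigma> where n: "representation \<Gamma> n \<rho>" "\<phi> = character_of \<Gamma> \<rho>"
    and m: "representation \<Gamma> m \<sigma>" "\<psi> = character_of \<Gamma> \<sigma>"
    using assms unfolding characters_def by blast
  define N where "N g = case_sum (\<lambda>i. case_sum (\<lambda>j. \<rho> g $$ (i, j)) (\<lambda>j. 0))
    (\<lambda>i. case_sum (\<lambda>j. 0) (\<lambda>j. \<sigma> g $$ (i, j)))" for g
  note r1 = representation_index_rep[OF G n(1)] and r2 = representation_index_rep[OF G m(1)]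
  have s: "(\<Sum>i\<in>{..<n} <+> {..<m}. f i) = (\<Sum>i<n. f (Inl i)) + (\<Sum>i<m. f (Inr i))"
    for f :: "nat + nat \<Rightarrow> complex"
    unfolding sum.Plus[OF finite_lessThan finite_lessThan] by simp
  have "index_rep \<Gamma> ({..<n} <+> {..<m}) N"
    unfolding index_rep_def s
  proof (intro conjI ballI)
    show "finite ({..<n} <+> {..<m})" by simp
    fix g h i k
    assume "g \<in> carrier \<Gamma>" "h \<in> carrier \<Gamma>" "i \<in> {..<n} <+> {..<m}" "k \<in> {..<n} <+> {..<m}"
    then show "N (g \<otimes>\<^bsub>\<Gamma>\<^esub> h) i k =
        (\<Sum>j<n. N g i (Inl j) * N h (Inl j) k) + (\<Sum>j<m. N g i (Inr j) * N h (Inr j) k)"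
      using r1(1) r2(1) unfolding index_rep_def by (auto simp: N_def)
  next
    fix i k assume "i \<in> {..<n} <+> {..<m}" "k \<in> {..<n} <+> {..<m}"
    moreover have "\<rho> \<one>\<^bsub>\<Gamma>\<^esub> $$ (i, k) = (if i = k then 1 else 0)" if "i < n" "k < n" for i k
      using r1(1) that unfolding index_rep_def by blast
    moreover have "\<sigma> \<one>\<^bsub>\<Gamma>\<^esub> $$ (i, k) = (if i = k then 1 else 0)" if "i < m" "k < m" for i k
      using r2(1) that unfolding index_rep_def by blast
    ultimately show "N \<one>\<^bsub>\<Gamma>\<^esub> i k = (if i = k then 1 else 0)"
      by (auto simp: N_def split: if_splits)
  qed
  from index_rep_character[OF G this] show ?thesis
    unfolding s n(2) m(2) r1(2) r2(2) on_carrier_add[symmetric] by (simp add: N_def)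
qed

lemma zero_character: "group \<Gamma> \<Longrightarrow> 0 \<in> characters \<Gamma>"
  using index_rep_character[of \<Gamma> "{} :: nat set" "\<lambda>_ _ _. 0"]
  by (simp add: index_rep_def on_carrier_def zero_fun_def)

lemma sum_characters:
  assumes "group \<Gamma>" "\<And>x. x \<in> A \<Longrightarrow> f x \<in> characters \<Gamma>"
  shows "(\<Sum>x\<in>A. f x) \<in> characters \<Gamma>"
  using assms(2)
  by (induction A rule: infinite_finite_induct) (auto intro: zero_character characters_add assms(1))

lemma irreducible_characters_subset: "irreducible_characters \<Gamma> \<subseteq> characters \<Gamma>"
  unfolding irreducible_characters_def characters_def irreducible_rep_def by blast

lemma effective_imp_character:
  assumes "group \<Gamma>" "effective \<Gamma> \<phi>"
  shows "\<phi> \<in> characters \<Gamma>"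
proof -
  have "of_nat k * \<chi> \<in> characters \<Gamma>" if "\<chi> \<in> characters \<Gamma>" for k \<chi>
  proof (induction k)
    case 0
    show ?case using zero_character[OF assms(1)] by (simp only: of_nat_0 mult_zero_left)
  next
    case (Suc k)
    then show ?case using characters_add[OF assms(1) that Suc]
      by (simp only: of_nat_Suc distrib_right mult_1_left)
  qed
  then show ?thesis using assms irreducible_characters_subset[of \<Gamma>]
    unfolding effective_def by (auto intro!: sum_characters)
qed

lemma effective_imp_virtual:
  assumes "effective \<Gamma> \<phi>" shows "\<phi> \<in> virtual_characters \<Gamma>"
proof -
  obtain X a where "finite X" "X \<subseteq> irreducible_characters \<Gamma>" "\<phi> = (\<Sum>\<chi>\<in>X. of_nat (a \<chi>) * \<chi>)"
    using assms unfolding effective_def by blast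
  then show ?thesis unfolding virtual_characters_def
    by (intro CollectI exI[of _ X] exI[of _ "\<lambda>\<chi>. int (a \<chi>)"]) simp
qed

lemma effective_zero: "effective \<Gamma> 0"
  unfolding effective_def by (intro exI[of _ "{}"]) auto

lemma effective_irreducible: "\<chi> \<in> irreducible_characters \<Gamma> \<Longrightarrow> effective \<Gamma> \<chi>"
  unfolding effective_def by (intro exI[of _ "{\<chi>}"] exI[of _ "\<lambda>_. 1"]) auto

lemma effective_add:
  assumes "effective \<Gamma> \<phi>" "effective \<Gamma> \<psi>"
  shows "effective \<Gamma> (\<phi> + \<psi>)"
proof -
  obtain X a Y b where X: "finite X" "X \<subseteq> irreducible_characters \<Gamma>" "\<phi> = (\<Sum>\<chi>\<in>X. of_nat (a \<chi>) * \<chi>)"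
    and Y: "finite Y" "Y \<subseteq> irreducible_characters \<Gamma>" "\<psi> = (\<Sum>\<chi>\<in>Y. of_nat (b \<chi>) * \<chi>)"
    using assms unfolding effective_def by blast
  let ?a = "\<lambda>\<chi>. if \<chi> \<in> X then a \<chi> else 0" and ?b = "\<lambda>\<chi>. if \<chi> \<in> Y then b \<chi> else 0"
  have "\<phi> = (\<Sum>\<chi>\<in>X \<union> Y. of_nat (?a \<chi>) * \<chi>)"
    unfolding X by (rule sum.mono_neutral_cong_left) (use X Y in auto)
  moreover have "\<psi> = (\<Sum>\<chi>\<in>X \<union> Y. of_nat (?b \<chi>) * \<chi>)"
    unfolding Y by (rule sum.mono_neutral_cong_left) (use X Y in auto)
  ultimately have "\<phi> + \<psi> = (\<Sum>\<chi>\<in>X \<union> Y. of_nat (?a \<chi> + ?b \<chi>) * \<chi>)"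
    by (simp add: sum.distrib distrib_right)
  then show ?thesis using X Y unfolding effective_def
    by (intro exI[of _ "X \<union> Y"] exI[of _ "\<lambda>\<chi>. ?a \<chi> + ?b \<chi>"]) auto
qed

text \<open>Invariance of the trace under a change of basis: \<open>A\<close> and \<open>B\<close>
  translate between coordinates indexed by \<open>X\<close> and by \<open>Z\<close>, and the trace
  of \<open>B M A\<close> is that of \<open>M A B\<close>, where \<open>A B\<close> is the identity
  on \<open>Z\<close>.\<close>

lemma index_rep_trace_change:
  fixes A :: "'z \<Rightarrow> 'x \<Rightarrow> complex" and B :: "'x \<Rightarrow> 'z \<Rightarrow> complex"
  assumes "finite X" "finite Z"
    and "\<And>z z'. z \<in> Z \<Longrightarrow> z' \<in> Z \<Longrightarrow> (\<Sum>x\<in>X. A z x * B x z') = (if z = z' then 1 else 0)"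
  shows "(\<Sum>x\<in>X. \<Sum>z\<in>Z. \<Sum>z'\<in>Z. B x z * M z z' * A z' x) = (\<Sum>z\<in>Z. M z z)"
proof -
  have "(\<Sum>x\<in>X. \<Sum>z\<in>Z. \<Sum>z'\<in>Z. B x z * M z z' * A z' x) =
      (\<Sum>z\<in>Z. \<Sum>x\<in>X. \<Sum>z'\<in>Z. B x z * M z z' * A z' x)"
    by (rule sum.swap)
  also have "\<dots> = (\<Sum>z\<in>Z. \<Sum>z'\<in>Z. \<Sum>x\<in>X. B x z * M z z' * A z' x)"
    by (intro sum.cong refl sum.swap)
  also have "\<dots> = (\<Sum>z\<in>Z. \<Sum>z'\<in>Z. M z z' * (\<Sum>x\<in>X. A z' x * B x z))"
    by (simp add: sum_distrib_left mult_ac)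
  also have "\<dots> = (\<Sum>z\<in>Z. \<Sum>z'\<in>Z. if z' = z then M z z' else 0)"
    by (intro sum.cong refl) (simp add: assms)
  also have "\<dots> = (\<Sum>z\<in>Z. M z z)"
    using assms by (simp add: sum.delta)
  finally show ?thesis .
qed

section \<open>Every character is effective\<close>

lemma sum_fun_apply: "(\<Sum>a\<in>A. f a) x = (\<Sum>a\<in>A. f a x)"
  for f :: "'a \<Rightarrow> 'b \<Rightarrow> 'c::comm_monoid_add"
  by (induction A rule: infinite_finite_induct) auto

lemma subspace_module_vecD:
  assumes "VectorSpace.subspace class_ring W (module_vec TYPE(complex) n)"
  shows "W \<subseteq> carrier_vec n" "0\<^sub>v n \<in> W"
    "\<And>v w. v \<in> W \<Longrightarrow> w \<in> W \<Longrightarrow> v + w \<in> W" "\<And>c w. w \<in> W \<Longrightarrow> c \<cdot>\<^sub>v w \<in> W"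
proof -
  have s: "LinearCombinations.submodule class_ring W (module_vec TYPE(complex) n)"
    using assms unfolding VectorSpace.subspace_def by blast
  show "W \<subseteq> carrier_vec n" "0\<^sub>v n \<in> W"
    "\<And>v w. v \<in> W \<Longrightarrow> w \<in> W \<Longrightarrow> v + w \<in> W" "\<And>c w. w \<in> W \<Longrightarrow> c \<cdot>\<^sub>v w \<in> W"
    using s unfolding LinearCombinations.submodule_def by (auto simp: module_vec_simps class_ring_simps)
qed

text \<open>Induction on the degree, with no invariant complement: a basis of an invariant subspace
  extended to a basis of the whole space makes all matrices block triangular. The diagonal blocks
  represent the group on the subspace and on the quotient, both of smaller degree, and the traces of
  the blocks add up.\<close>

lemma representation_effective:
  assumes G: "group \<Gamma>"
  shows "representation \<Gamma> n \<rho> \<Longrightarrow> effective \<Gamma> (character_of \<Gamma> \<rho>)"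
proof (induction n arbitrary: \<rho> rule: less_induct)
  case (less n)
  note R = less.prems[unfolded representation_iff[OF G]]
  note ri = representation_index_rep[OF G less.prems]
  consider "n = 0" | "irreducible_rep \<Gamma> n \<rho>" | "n > 0" "\<not> irreducible_rep \<Gamma> n \<rho>" by blast
  then show ?case
  proof cases
    case 1
    then have "character_of \<Gamma> \<rho> = 0" using ri(2) by (auto simp: on_carrier_def)
    then show ?thesis by (simp only: effective_zero)
  next
    case 2
    then show ?thesis
      by (intro effective_irreducible) (auto simp: irreducible_characters_def)
  next
    case 3
    then obtain W where W0: "VectorSpace.subspace class_ring W (module_vec TYPE(complex) n)"
      and Winv: "\<And>g w. g \<in> carrier \<Gamma> \<Longrightarrow> w \<in> W \<Longrightarrow> \<rho> g *\<^sub>v w \<in> W"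
      and Wne: "W \<noteq> {0\<^sub>v n}" "W \<noteq> carrier_vec n"
      using less.prems unfolding irreducible_rep_def by blast
    note W = subspace_module_vecD[OF W0]
    \<comment> \<open>Vectors of length \<open>n\<close> become functions on all natural numbers
      that vanish from \<open>n\<close> on; they form the subspace \<open>U\<close> of a vector
      space on a whole type, where independent sets can be extended to bases.\<close>
    interpret V: vector_space "\<lambda>(c::complex) (f::nat \<Rightarrow> complex) i. c * f i"
      by unfold_locales (auto simp: fun_eq_iff algebra_simps)
    define fn where "fn w = (\<lambda>i. if i < n then w $ i else 0)" for w :: "complex vec"
    define U where "U = {f :: nat \<Rightarrow> complex. \<forall>i\<ge>n. f i = 0}"
    define op where "op g f = (\<lambda>i. if i < n then \<Sum>j<n. \<rho> g $$ (i, j) * f j else 0)"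
      for g and f :: "nat \<Rightarrow> complex"
    define e where "e i = (\<lambda>j. if j = i then 1 else 0 :: complex)" for i :: nat
    have car: "\<rho> g \<in> carrier_mat n n" "dim_row (\<rho> g) = n" "dim_col (\<rho> g) = n" if "g \<in> carrier \<Gamma>" for g
      using R that by auto
    have dimW: "dim_vec w = n" if "w \<in> W" for w using W(1) that by auto
    have op_fn: "op g (fn w) = fn (\<rho> g *\<^sub>v w)" if "g \<in> carrier \<Gamma>" "w \<in> W" for g w
      using car[OF that(1)] dimW[OF that(2)]
      by (auto simp: op_def fn_def fun_eq_iff scalar_prod_def atLeast0LessThan intro!: sum.cong)
    have opU: "op g f \<in> U" for g f by (simp add: op_def U_def)
    have op_mult: "op (g \<otimes>\<^bsub>\<Gamma>\<^esub> h) f = op g (op h f)" if "g \<in> carrier \<Gamma>" "h \<in> carrier \<Gamma>" for g h f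
    proof
      fix i
      have "(\<Sum>j<n. (\<Sum>l<n. \<rho> g $$ (i, l) * \<rho> h $$ (l, j)) * f j) =
          (\<Sum>l<n. \<rho> g $$ (i, l) * (\<Sum>j<n. \<rho> h $$ (l, j) * f j))"
        unfolding sum_distrib_left sum_distrib_right by (subst sum.swap) (simp add: mult_ac)
      moreover have "\<rho> (g \<otimes>\<^bsub>\<Gamma>\<^esub> h) $$ (i, j) = (\<Sum>l<n. \<rho> g $$ (i, l) * \<rho> h $$ (l, j))" if "i < n" "j < n" for j
        using ri(1) that \<open>g \<in> _\<close> \<open>h \<in> _\<close> unfolding index_rep_def by blast
      ultimately show "op (g \<otimes>\<^bsub>\<Gamma>\<^esub> h) f i = op g (op h f) i"
        by (auto simp: op_def)
    qed
    have op_one: "op \<one>\<^bsub>\<Gamma>\<^esub> f = f" if "f \<in> U" for f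
      using R that by (auto simp: op_def U_def fun_eq_iff if_distrib[of "\<lambda>x. x * _"] sum.delta' cong: if_cong)
    have op_sum: "op g (\<Sum>b\<in>B. (\<lambda>i. a b * b i)) = (\<Sum>b\<in>B. (\<lambda>i. a b * op g b i))" for g a B
      by (rule ext) (auto simp: op_def sum_fun_apply sum_distrib_left mult_ac intro: sum.swap)
    define W' where "W' = fn ` W"
    have W'U: "W' \<subseteq> U" by (auto simp: W'_def U_def fn_def)
    have W'sub: "V.subspace W'"
    proof (rule V.subspaceI)
      have "fn (0\<^sub>v n) = 0" by (auto simp: fn_def)
      then show "0 \<in> W'" using W(2) unfolding W'_def by force
      fix x assume x: "x \<in> W'"
      then obtain v where v: "v \<in> W" "x = fn v" unfolding W'_def by blast
      { fix y assume "y \<in> W'"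
        then obtain w where w: "w \<in> W" "y = fn w" unfolding W'_def by blast
        have "x + y = fn (v + w)" using dimW[OF v(1)] dimW[OF w(1)] by (auto simp: v w fn_def fun_eq_iff)
        then show "x + y \<in> W'" using W(3)[OF v(1) w(1)] unfolding W'_def by blast }
      fix c
      have "(\<lambda>i. c * x i) = fn (c \<cdot>\<^sub>v v)" using dimW[OF v(1)] by (auto simp: v fn_def fun_eq_iff)
      then show "(\<lambda>i. c * x i) \<in> W'" using W(4)[OF v(1)] unfolding W'_def by blast
    qed
    have opW': "op g f \<in> W'" if "g \<in> carrier \<Gamma>" "f \<in> W'" for g f
      using that op_fn Winv unfolding W'_def by force
    obtain B1 where B1: "B1 \<subseteq> W'" "V.independent B1" "W' \<subseteq> V.span B1"
      using V.maximal_independent_subset by blast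
    have spB1: "V.span B1 = W'"
      using V.span_minimal[OF B1(1) W'sub] B1(3) by blast
    obtain B2 where B2: "B1 \<subseteq> B2" "B2 \<subseteq> U" "V.independent B2" "U \<subseteq> V.span B2"
      using V.maximal_independent_subset_extend[of B1 U] B1 W'U by blast
    have Uexp: "f = (\<Sum>i<n. (\<lambda>j. f i * e i j))" if "f \<in> U" for f
    proof
      fix j
      have "(\<Sum>i<n. f i * e i j) = (\<Sum>i<n. if i = j then f i else 0)"
        by (intro sum.cong) (auto simp: e_def)
      then show "f j = (\<Sum>i<n. (\<lambda>j. f i * e i j)) j" using that by (auto simp: sum_fun_apply U_def)
    qed
    have "U \<subseteq> V.span (e ` {..<n})"
    proof
      fix f assume "f \<in> U"
      have "(\<Sum>i<n. (\<lambda>j. f i * e i j)) \<in> V.span (e ` {..<n})"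
        by (intro V.span_sum V.span_scale V.span_base) auto
      then show "f \<in> V.span (e ` {..<n})" using Uexp[OF \<open>f \<in> U\<close>] by simp
    qed
    then have "finite B2 \<and> card B2 \<le> card (e ` {..<n})"
      using B2 by (intro V.independent_span_bound) auto
    then have finB2: "finite B2" and cardB2: "card B2 \<le> n"
      using card_image_le[of "{..<n}" e] by auto
    define c where "c = V.representation B2"
    have crep: "(\<Sum>b\<in>B2. (\<lambda>i. c f b * b i)) = f" if "f \<in> U" for f
      unfolding c_def using B2 that finB2 by (intro V.sum_representation_eq) auto
    have csum: "c (\<Sum>i\<in>I. (\<lambda>j. a i * v i j)) b = (\<Sum>i\<in>I. a i * c (v i) b)" if "\<And>i. i \<in> I \<Longrightarrow> v i \<in> U"
      for I :: "(nat \<Rightarrow> complex) set" and a v b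
    proof -
      have vs: "v i \<in> V.span B2" if "i \<in> I" for i using \<open>\<And>i. i \<in> I \<Longrightarrow> v i \<in> U\<close> that B2(4) by blast
      show ?thesis unfolding c_def
        using B2(3) vs by (subst V.representation_sum) (auto intro!: V.span_scale sum.cong simp: V.representation_scale)
    qed
    define N where "N g b b' = c (op g b') b" for g b b'
    have N: "index_rep \<Gamma> B2 N"
      unfolding index_rep_def
    proof (intro conjI ballI)
      fix g h a b assume gh: "g \<in> carrier \<Gamma>" "h \<in> carrier \<Gamma>" and ab: "a \<in> B2" "b \<in> B2"
      have "op (g \<otimes>\<^bsub>\<Gamma>\<^esub> h) b = op g (\<Sum>b'\<in>B2. (\<lambda>i. c (op h b) b' * b' i))"
        using gh by (simp add: op_mult crep opU)
      also have "\<dots> = (\<Sum>b'\<in>B2. (\<lambda>i. c (op h b) b' * op g b' i))" by (rule op_sum)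
      finally show "N (g \<otimes>\<^bsub>\<Gamma>\<^esub> h) a b = (\<Sum>j\<in>B2. N g a j * N h j b)"
        unfolding N_def by (simp only: csum opU) (simp add: mult.commute)
    next
      fix a b assume "a \<in> B2" "b \<in> B2"
      then show "N \<one>\<^bsub>\<Gamma>\<^esub> a b = (if a = b then 1 else 0)"
        using B2 op_one V.representation_basis[of B2 b] by (auto simp: N_def c_def)
    qed (fact finB2)
    have tr: "(\<Sum>b\<in>B2. N g b b) = (\<Sum>i<n. \<rho> g $$ (i, i))" for g
    proof -
      have eU: "e z \<in> U" if "z < n" for z using that by (auto simp: e_def U_def)
      have "N g b b = (\<Sum>z<n. \<Sum>z'<n. c (e z) b * \<rho> g $$ (z, z') * b z')" for b
      proof -
        have "op g b = (\<Sum>z<n. (\<lambda>i. op g b z * e z i))" by (rule Uexp) (rule opU)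
        then have "c (op g b) b = c (\<Sum>z<n. (\<lambda>i. op g b z * e z i)) b" by (rule arg_cong[of _ _ "\<lambda>f. c f b"])
        also have "\<dots> = (\<Sum>z<n. op g b z * c (e z) b)"
        proof -
          have es: "e z \<in> V.span B2" if "z < n" for z using eU that B2(4) by blast
          show ?thesis unfolding c_def
            using B2(3) es by (subst V.representation_sum) (auto intro!: V.span_scale sum.cong simp: V.representation_scale)
        qed
        finally show ?thesis
          by (simp add: N_def op_def sum_distrib_left sum_distrib_right mult_ac)
      qed
      then have "(\<Sum>b\<in>B2. N g b b) = (\<Sum>b\<in>B2. \<Sum>z<n. \<Sum>z'<n. c (e z) b * \<rho> g $$ (z, z') * b z')"
        by simp
      also have "\<dots> = (\<Sum>z<n. \<rho> g $$ (z, z))"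
      proof (rule index_rep_trace_change[OF finB2])
        fix z z' assume "z \<in> {..<n}" "z' \<in> {..<n}"
        then show "(\<Sum>x\<in>B2. x z * c (e z') x) = (if z = z' then 1 else 0)"
          using fun_cong[OF crep[OF eU], of z' z] by (auto simp: sum_fun_apply mult.commute e_def)
      qed simp
      finally show ?thesis .
    qed
    \<comment> \<open>The image of a vector of \<open>B1\<close> stays in the span of
      \<open>B1\<close>, where its coordinates with respect to \<open>B2\<close> are those with
      respect to \<open>B1\<close>. This zero block yields the subrepresentation \<open>N1\<close>
      and the quotient \<open>N2\<close> at once.\<close>
    have inv0: "N h j k = 0" if "h \<in> carrier \<Gamma>" "k \<in> B1" "j \<in> B2 - B1" for h j k
    proof -
      have "op h k \<in> V.span B1" using that opW' B1(1) spB1 by blast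
      then have "c (op h k) = V.representation B1 (op h k)"
        unfolding c_def by (rule V.representation_extend[OF B2(3) _ B2(1)])
      then show ?thesis using that V.representation_ne_zero[of B1 "op h k" j] by (auto simp: N_def)
    qed
    have N1: "index_rep \<Gamma> B1 N"
      by (rule index_rep_subset[OF N B2(1)]) (use inv0 in blast)
    have N2: "index_rep \<Gamma> (B2 - B1) N"
      by (rule index_rep_subset[OF N]) (use inv0 in blast)+
    have "B1 \<noteq> B2"
    proof
      assume "B1 = B2"
      then have UW: "U \<subseteq> W'" using B2(4) spB1 by simp
      have "carrier_vec n \<subseteq> W"
      proof
        fix v :: "complex vec" assume v: "v \<in> carrier_vec n"
        have "fn v \<in> U" by (auto simp: fn_def U_def)
        then obtain w where w: "w \<in> W" "fn v = fn w" using UW unfolding W'_def by blast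
        have "v = w"
        proof (rule eq_vecI)
          fix i assume "i < dim_vec w"
          then have "i < n" using dimW[OF w(1)] by simp
          then show "v $ i = w $ i" using fun_cong[OF w(2), of i] by (simp add: fn_def)
        qed (use v dimW[OF w(1)] in auto)
        then show "v \<in> W" using w by simp
      qed
      then show False using Wne W(1) by blast
    qed
    then have l1: "card B1 < n"
      using psubset_card_mono[OF finB2 psubsetI[OF B2(1)]] cardB2 by simp
    have "B1 \<noteq> {}"
    proof
      assume "B1 = {}"
      then have W0: "W' = {0}" using spB1 by simp
      have "w = 0\<^sub>v n" if "w \<in> W" for w
      proof (rule eq_vecI)
        have z: "fn w = 0" using W0 that unfolding W'_def by blast
        then show "w $ i = 0\<^sub>v n $ i" if "i < dim_vec (0\<^sub>v n :: complex vec)" for i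
        proof -
          have "fn w i = 0" by (simp add: z)
          then show ?thesis using that by (simp add: fn_def)
        qed
      qed (simp add: dimW that)
      then show False using Wne(1) W(2) by blast
    qed
    then have l2: "card (B2 - B1) < n"
      using B2(1) finB2 cardB2 psubset_card_mono[OF finB2, of "B2 - B1"] by fastforce
    obtain \<rho>1 where r1: "representation \<Gamma> (card B1) \<rho>1"
      "character_of \<Gamma> \<rho>1 = on_carrier \<Gamma> (\<lambda>g. \<Sum>i\<in>B1. N g i i)"
      using index_rep_representation[OF G N1] by blast
    obtain \<rho>2 where r2: "representation \<Gamma> (card (B2 - B1)) \<rho>2"
      "character_of \<Gamma> \<rho>2 = on_carrier \<Gamma> (\<lambda>g. \<Sum>i\<in>B2 - B1. N g i i)"
      using index_rep_representation[OF G N2] by blast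
    have "effective \<Gamma> (character_of \<Gamma> \<rho>2 + character_of \<Gamma> \<rho>1)"
      by (intro effective_add less.IH[OF l1 r1(1)] less.IH[OF l2 r2(1)])
    also have "character_of \<Gamma> \<rho>2 + character_of \<Gamma> \<rho>1 = character_of \<Gamma> \<rho>"
      unfolding r1 r2 ri(2) on_carrier_add[symmetric] tr[symmetric] sum.subset_diff[OF B2(1) finB2] ..
    finally show ?thesis .
  qed
qed

lemma effective_iff_character: "group \<Gamma> \<Longrightarrow> effective \<Gamma> \<phi> \<longleftrightarrow> \<phi> \<in> characters \<Gamma>"
  using representation_effective effective_imp_character unfolding characters_def by blast

section \<open>Alternating sums of permutation characters\<close>

text \<open>Moebius inversion on the Boolean lattice: the sum is the expanded product of factors 1 -
  1, one for each element of \<open>S - D\<close>.\<close>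

lemma sum_alternating_supersets:
  fixes S D :: "'s set"
  assumes "finite S" "D \<subseteq> S"
  shows "(\<Sum>T\<in>{T. D \<subseteq> T \<and> T \<subseteq> S}. (-1) ^ card (S - T)) = (if D = S then 1 else 0 :: 'a::comm_ring_1)"
proof -
  have "(\<Sum>T\<in>{T. D \<subseteq> T \<and> T \<subseteq> S}. (-1) ^ card (S - T)) =
      (\<Sum>X\<in>Pow (S - D). (-1) ^ card (S - D - X) :: 'a)"
  proof (rule sum.reindex_bij_witness[of _ "\<lambda>X. D \<union> X" "\<lambda>T. T - D"])
    fix T assume "T \<in> {T. D \<subseteq> T \<and> T \<subseteq> S}"
    then have "S - D - (T - D) = S - T" by blast
    then show "(- 1 :: 'a) ^ card (S - D - (T - D)) = (- 1) ^ card (S - T)" by simp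
  qed (use assms in auto)
  also have "\<dots> = (\<Prod>x\<in>S - D. 1 + - 1)"
    using assms by (subst prod_add) (auto simp: prod_constant)
  also have "\<dots> = (if D = S then 1 else 0)"
  proof (cases "D = S")
    case False
    then have "card (S - D) \<noteq> 0" using assms by auto
    then show ?thesis using False by (simp add: zero_power)
  qed simp
  finally show ?thesis .
qed

text \<open>The functions on \<open>X\<close> that are constant on the classes of \<open>res T\<close> form a subrepresentation
  \<open>V\<^sub>T\<close> of the permutation representation on \<open>X\<close>. The indicator functions of the
  classes \<open>[x]\<close> with respect to \<open>res (D x)\<close>, for \<open>D x \<subseteq> T\<close>, are a basis of \<open>V\<^sub>T\<close> simultaneously for all
  \<open>T\<close>, by triangularity with respect to \<open>rk\<close>; hence the alternating sum is the character of
  the quotient of \<open>V\<^sub>S\<close> by the sum of all smaller \<open>V\<^sub>T\<close>.\<close>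

lemma alternating_sum_character:
  fixes \<Gamma> :: "('g, 'm) monoid_scheme" and X :: "'x set" and S :: "'s set"
    and res :: "'s set \<Rightarrow> 'x \<Rightarrow> 'y" and act :: "'g \<Rightarrow> 'x \<Rightarrow> 'x" and D :: "'x \<Rightarrow> 's set"
    and rk :: "'x \<Rightarrow> nat"
  assumes G: "group \<Gamma>" and S: "finite S" and X: "finite X"
    and act_in: "\<And>g x. g \<in> carrier \<Gamma> \<Longrightarrow> x \<in> X \<Longrightarrow> act g x \<in> X"
    and act_mult: "\<And>g h x. g \<in> carrier \<Gamma> \<Longrightarrow> h \<in> carrier \<Gamma> \<Longrightarrow> x \<in> X \<Longrightarrow>
        act (g \<otimes>\<^bsub>\<Gamma>\<^esub> h) x = act g (act h x)"
    and act_one: "\<And>x. x \<in> X \<Longrightarrow> act \<one>\<^bsub>\<Gamma>\<^esub> x = x"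
    and act_res: "\<And>g T x y. g \<in> carrier \<Gamma> \<Longrightarrow> T \<subseteq> S \<Longrightarrow> x \<in> X \<Longrightarrow> y \<in> X \<Longrightarrow> res T x = res T y \<Longrightarrow>
        res T (act g x) = res T (act g y)"
    and res_mono: "\<And>T T' x y. T' \<subseteq> T \<Longrightarrow> T \<subseteq> S \<Longrightarrow> x \<in> X \<Longrightarrow> y \<in> X \<Longrightarrow> res T x = res T y \<Longrightarrow>
        res T' x = res T' y"
    and D_sub: "\<And>x. x \<in> X \<Longrightarrow> D x \<subseteq> S"
    and D_rk: "\<And>x y. x \<in> X \<Longrightarrow> y \<in> X \<Longrightarrow> res (D x) y = res (D x) x \<Longrightarrow> y \<noteq> x \<Longrightarrow> rk x < rk y"
    and D_ex: "\<And>T x. T \<subseteq> S \<Longrightarrow> x \<in> X \<Longrightarrow> \<exists>y\<in>X. D y \<subseteq> T \<and> res T y = res T x"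
  shows "on_carrier \<Gamma> (\<lambda>g. \<Sum>T\<in>Pow S. (-1) ^ card (S - T) *
      of_nat (card (res T ` {x \<in> X. res T (act g x) = res T x}))) \<in> characters \<Gamma>"
proof -
  interpret group \<Gamma> by fact
  define ind where "ind T c y = (if res T y = res T c then 1 else 0 :: complex)" for T c y
  define \<phi> where "\<phi> x = ind (D x) x" for x
  define W where "W T = {x \<in> X. D x \<subseteq> T}" for T
  have finW: "finite (W T)" and WX: "W T \<subseteq> X" for T using X by (auto simp: W_def)
  \<comment> \<open>Two distinct representatives of one class would each have smaller
    \<open>rk\<close> than the other. With \<open>rep_ex\<close>, \<open>W T\<close> is a system of
    representatives for the classes of \<open>res T\<close>.\<close>
  have rep_unique: "x = y" if "x \<in> W T" "y \<in> W T" "T \<subseteq> S" "res T x = res T y" for x y T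
  proof (rule ccontr)
    assume "x \<noteq> y"
    have xy: "x \<in> X" "y \<in> X" "D x \<subseteq> T" "D y \<subseteq> T" using that by (auto simp: W_def)
    have "res (D x) y = res (D x) x" "res (D y) x = res (D y) y"
      using res_mono[of _ T x y] xy that by auto
    then have "rk x < rk y" "rk y < rk x" using D_rk xy \<open>x \<noteq> y\<close> by metis+
    then show False by simp
  qed
  have rep_ex: "\<exists>z\<in>W T. res T z = res T x" if "T \<subseteq> S" "x \<in> X" for T x
    using D_ex[OF that] by (auto simp: W_def)
  have rep_sum: "(\<Sum>z\<in>W T. f z * ind T z y) = f z0"
    if "T \<subseteq> S" "z0 \<in> W T" "res T z0 = res T y" for f T y z0
  proof -
    have "(\<Sum>z\<in>W T. f z * ind T z y) = (\<Sum>z\<in>W T. if z = z0 then f z else 0)"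
    proof (intro sum.cong refl)
      fix z assume "z \<in> W T"
      then have "res T y = res T z \<longleftrightarrow> z = z0"
        using rep_unique[of z T z0] that by metis
      then show "f z * ind T z y = (if z = z0 then f z else 0)" by (simp add: ind_def)
    qed
    then show ?thesis using that finW by simp
  qed
  \<comment> \<open>At the point of smallest \<open>rk\<close> among those with nonzero coefficient
    only its own term survives, because \<open>\<phi> y x \<noteq> 0\<close> with
    \<open>y \<noteq> x\<close> forces \<open>rk y < rk x\<close>.\<close>
  have indep: "\<forall>x\<in>X. a x = 0" if "\<And>y. y \<in> X \<Longrightarrow> (\<Sum>x\<in>X. a x * \<phi> x y) = 0" for a
  proof (rule ccontr)
    assume "\<not> (\<forall>x\<in>X. a x = 0)"
    then have ne: "{x \<in> X. a x \<noteq> 0} \<noteq> {}" by blast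
    define x where "x = arg_min_on rk {x \<in> X. a x \<noteq> 0}"
    have x: "x \<in> X" "a x \<noteq> 0" and xmin: "\<And>y. y \<in> X \<Longrightarrow> a y \<noteq> 0 \<Longrightarrow> rk x \<le> rk y"
      using arg_min_if_finite[OF _ ne, of rk] X unfolding x_def by (auto simp: not_less)
    have "(\<Sum>y\<in>X. a y * \<phi> y x) = (\<Sum>y\<in>X. if y = x then a y else 0)"
    proof (rule sum.cong)
      fix y assume y: "y \<in> X"
      show "a y * \<phi> y x = (if y = x then a y else 0)"
      proof (cases "y = x \<or> a y = 0")
        case False
        then have "\<not> rk y < rk x" using xmin[OF y] by simp
        then have "res (D y) x \<noteq> res (D y) y" using D_rk[OF y x(1)] False by auto
        then show ?thesis using False by (simp add: \<phi>_def ind_def)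
      qed (auto simp: \<phi>_def ind_def)
    qed simp
    then show False using that[OF x(1)] x X by simp
  qed
  have uniq: "a x = b x" if "\<And>y. y \<in> X \<Longrightarrow> (\<Sum>x\<in>X. a x * \<phi> x y) = (\<Sum>x\<in>X. b x * \<phi> x y)" "x \<in> X" for a b x
    using indep[of "\<lambda>x. a x - b x"] that by (auto simp: left_diff_distrib sum_subtractf)
  have expand_rep: "\<exists>b. \<forall>y\<in>X. ind T c y = (\<Sum>x\<in>W T. b x * \<phi> x y)" if T: "T \<subseteq> S" and "c \<in> W T" for T c
    using that(2)
  proof (induction "Max (rk ` X) - rk c" arbitrary: c rule: less_induct)
    case less
    have cX: "c \<in> X" "D c \<subseteq> T" using less.prems by (auto simp: W_def)
    \<comment> \<open>The class of \<open>c\<close> under the coarser \<open>res (D c)\<close> is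
      the disjoint union of classes under \<open>res T\<close>: that of \<open>c\<close> and those
      represented by \<open>Z\<close>. By \<open>D_rk\<close> the latter have larger
      \<open>rk\<close>, which is why the induction descends from the maximal value.\<close>
    define Z where "Z = {z \<in> W T. z \<noteq> c \<and> res (D c) z = res (D c) c}"
    have finZ: "finite Z" and ZW: "Z \<subseteq> W T" using finW by (auto simp: Z_def)
    have "\<exists>b. \<forall>y\<in>X. ind T z y = (\<Sum>x\<in>W T. b x * \<phi> x y)" if z: "z \<in> Z" for z
    proof (rule less.hyps)
      show "z \<in> W T" using z ZW by blast
      then have zX: "z \<in> X" using WX by blast
      then have "rk z \<le> Max (rk ` X)" using X by simp
      moreover have "rk c < rk z" using z zX cX D_rk by (auto simp: Z_def)
      ultimately show "Max (rk ` X) - rk z < Max (rk ` X) - rk c" by simp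
    qed
    then obtain b where b: "\<And>z y. z \<in> Z \<Longrightarrow> y \<in> X \<Longrightarrow> ind T z y = (\<Sum>x\<in>W T. b z x * \<phi> x y)"
      by metis
    have key: "ind T c y = \<phi> c y - (\<Sum>z\<in>Z. ind T z y)" if y: "y \<in> X" for y
    proof -
      obtain z0 where z0: "z0 \<in> W T" "res T z0 = res T y" using rep_ex[OF T y] by blast
      then have z0X: "z0 \<in> X" using WX by blast
      have "res (D c) z0 = res (D c) y" using res_mono[OF cX(2) T z0X y z0(2)] .
      then have p: "\<phi> c y = (if res (D c) z0 = res (D c) c then 1 else 0)"
        by (simp add: \<phi>_def ind_def)
      have q: "ind T c y = (if z0 = c then 1 else 0)"
        using rep_unique[OF z0(1) less.prems T] z0(2) by (auto simp: ind_def)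
      have "(\<Sum>z\<in>Z. ind T z y) = (\<Sum>z\<in>W T. (if z \<in> Z then 1 else 0) * ind T z y)"
        by (rule sum.mono_neutral_cong_left) (use finW ZW in auto)
      also have "\<dots> = (if z0 \<in> Z then 1 else 0)" by (rule rep_sum[OF T z0])
      finally show ?thesis using p q z0 by (auto simp: Z_def)
    qed
    have "ind T c y = (\<Sum>x\<in>W T. ((if x = c then 1 else 0) - (\<Sum>z\<in>Z. b z x)) * \<phi> x y)" if y: "y \<in> X" for y
    proof -
      have "(\<Sum>x\<in>W T. (if x = c then 1 else 0) * \<phi> x y) = (\<Sum>x\<in>W T. if x = c then \<phi> x y else 0)"
        by (intro sum.cong) auto
      then have "(\<Sum>x\<in>W T. (if x = c then 1 else 0) * \<phi> x y) = \<phi> c y"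
        using finW less.prems by simp
      moreover have "(\<Sum>z\<in>Z. ind T z y) = (\<Sum>x\<in>W T. (\<Sum>z\<in>Z. b z x) * \<phi> x y)"
        using b y by (simp add: sum_distrib_right sum.swap[of _ Z "W T"])
      ultimately show ?thesis using key[OF y] by (simp add: left_diff_distrib sum_subtractf)
    qed
    then show ?case by (intro exI ballI)
  qed
  have "\<exists>b. (\<forall>y\<in>X. ind T c y = (\<Sum>x\<in>X. b x * \<phi> x y)) \<and> (\<forall>x. x \<notin> W T \<longrightarrow> b x = 0)"
    if T: "T \<subseteq> S" and c: "c \<in> X" for T c
  proof -
    obtain z where z: "z \<in> W T" "res T z = res T c" using rep_ex[OF T c] by blast
    obtain b where b: "\<And>y. y \<in> X \<Longrightarrow> ind T z y = (\<Sum>x\<in>W T. b x * \<phi> x y)"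
      using expand_rep[OF T z(1)] by blast
    have "(\<Sum>x\<in>W T. b x * \<phi> x y) = (\<Sum>x\<in>X. (if x \<in> W T then b x else 0) * \<phi> x y)" for y
      by (rule sum.mono_neutral_cong_left) (use X WX in auto)
    moreover have "ind T c y = ind T z y" for y using z(2) by (simp add: ind_def)
    ultimately show ?thesis using b
      by (intro exI[of _ "\<lambda>x. if x \<in> W T then b x else 0"]) auto
  qed
  then obtain B where B: "\<And>T c y. T \<subseteq> S \<Longrightarrow> c \<in> X \<Longrightarrow> y \<in> X \<Longrightarrow> ind T c y = (\<Sum>x\<in>X. B T c x * \<phi> x y)"
    and B0: "\<And>T c x. T \<subseteq> S \<Longrightarrow> c \<in> X \<Longrightarrow> x \<notin> W T \<Longrightarrow> B T c x = 0"
    by metis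
  \<comment> \<open>A group element carries \<open>\<phi> x\<close> to the indicator of the class of
    \<open>act g x\<close> under the same \<open>res (D x)\<close>; column \<open>x\<close> of
    \<open>N g\<close> holds the coordinates of this function in the basis
    \<open>\<phi>\<close>.\<close>
  define N where "N g x' x = B (D x) (act g x) x'" for g x' x
  have inv_act: "act (inv\<^bsub>\<Gamma>\<^esub> g) (act g x) = x" "act g (act (inv\<^bsub>\<Gamma>\<^esub> g) x) = x"
    if "g \<in> carrier \<Gamma>" "x \<in> X" for g x
    using that act_mult[of "inv\<^bsub>\<Gamma>\<^esub> g" g x] act_mult[of g "inv\<^bsub>\<Gamma>\<^esub> g" x] act_one by auto
  have shift: "ind T (act g c) y = ind T c (act (inv\<^bsub>\<Gamma>\<^esub> g) y)"
    if "g \<in> carrier \<Gamma>" "T \<subseteq> S" "c \<in> X" "y \<in> X" for g T c y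
  proof -
    have "res T y = res T (act g c) \<longleftrightarrow> res T (act (inv\<^bsub>\<Gamma>\<^esub> g) y) = res T c"
      using act_res[of "inv\<^bsub>\<Gamma>\<^esub> g" T y "act g c"] act_res[of g T "act (inv\<^bsub>\<Gamma>\<^esub> g) y" c]
        inv_act that act_in by auto
    then show ?thesis by (simp add: ind_def)
  qed
  have Nsum: "(\<Sum>x'\<in>X. N g x' x * \<phi> x' y) = ind (D x) (act g x) y" if "g \<in> carrier \<Gamma>" "x \<in> X" "y \<in> X" for g x y
    unfolding N_def using that D_sub act_in by (intro B[symmetric]) auto
  have N: "index_rep \<Gamma> X N"
    unfolding index_rep_def
  proof (intro conjI ballI)
    fix g h i k assume gh: "g \<in> carrier \<Gamma>" "h \<in> carrier \<Gamma>" and ik: "i \<in> X" "k \<in> X"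
    show "N (g \<otimes>\<^bsub>\<Gamma>\<^esub> h) i k = (\<Sum>j\<in>X. N g i j * N h j k)"
    proof (rule uniq[of "\<lambda>i. N (g \<otimes>\<^bsub>\<Gamma>\<^esub> h) i k" "\<lambda>i. \<Sum>j\<in>X. N g i j * N h j k" i])
      fix y assume y: "y \<in> X"
      let ?y = "act (inv\<^bsub>\<Gamma>\<^esub> g) y"
      have y': "?y \<in> X" using act_in gh y by auto
      have "(\<Sum>i\<in>X. N (g \<otimes>\<^bsub>\<Gamma>\<^esub> h) i k * \<phi> i y) = ind (D k) (act g (act h k)) y"
        using Nsum[of "g \<otimes>\<^bsub>\<Gamma>\<^esub> h" k y] gh ik y act_mult by simp
      also have "\<dots> = ind (D k) (act h k) ?y"
        using gh ik y act_in D_sub by (intro shift) auto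
      also have "\<dots> = (\<Sum>j\<in>X. N h j k * \<phi> j ?y)" using Nsum[OF gh(2) ik(2) y'] by simp
      also have "\<dots> = (\<Sum>j\<in>X. N h j k * (\<Sum>i\<in>X. N g i j * \<phi> i y))"
        by (intro sum.cong refl arg_cong2[where f = "(*)"])
          (use Nsum gh y shift D_sub in \<open>auto simp: \<phi>_def\<close>)
      also have "\<dots> = (\<Sum>i\<in>X. (\<Sum>j\<in>X. N g i j * N h j k) * \<phi> i y)"
        unfolding sum_distrib_left sum_distrib_right by (subst sum.swap) (simp add: mult_ac)
      finally show "(\<Sum>i\<in>X. N (g \<otimes>\<^bsub>\<Gamma>\<^esub> h) i k * \<phi> i y) = (\<Sum>i\<in>X. (\<Sum>j\<in>X. N g i j * N h j k) * \<phi> i y)" .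
    qed (fact ik)
  next
    fix i k assume ik: "i \<in> X" "k \<in> X"
    show "N \<one>\<^bsub>\<Gamma>\<^esub> i k = (if i = k then 1 else 0)"
    proof (rule uniq[of "\<lambda>i. N \<one>\<^bsub>\<Gamma>\<^esub> i k" "\<lambda>i. if i = k then 1 else 0" i])
      fix y assume y: "y \<in> X"
      have "(\<Sum>x\<in>X. (if x = k then 1 else 0) * \<phi> x y) = (\<Sum>x\<in>X. if x = k then \<phi> x y else 0)"
        by (intro sum.cong) auto
      then show "(\<Sum>x\<in>X. N \<one>\<^bsub>\<Gamma>\<^esub> x k * \<phi> x y) = (\<Sum>x\<in>X. (if x = k then 1 else 0) * \<phi> x y)"
        using Nsum[of "\<one>\<^bsub>\<Gamma>\<^esub>" k y] ik y X act_one by (simp add: \<phi>_def)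
    qed (fact ik)
  qed (fact X)
  have N0: "D i \<subseteq> D j" if "N g i j \<noteq> 0" "g \<in> carrier \<Gamma>" "i \<in> X" "j \<in> X" for g i j
    using B0[of "D j" "act g j" i] that D_sub act_in by (auto simp: N_def W_def)
  \<comment> \<open>By \<open>N0\<close> the basis functions with \<open>D x \<noteq> S\<close> span
    a subrepresentation, so \<open>K\<close> indexes the quotient by it.\<close>
  define K where "K = {x \<in> X. D x = S}"
  have NK: "index_rep \<Gamma> K N"
  proof (rule index_rep_subset[OF N])
    fix g i j k assume "g \<in> carrier \<Gamma>" "i \<in> K" "k \<in> K" "j \<in> X - K"
    then show "N g i j = 0 \<or> (\<forall>h\<in>carrier \<Gamma>. N h j k = 0)"
      using N0[of g i j] D_sub[of j] by (auto simp: K_def)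
  qed (auto simp: K_def)
  have trace: "of_nat (card (res T ` {x \<in> X. res T (act g x) = res T x})) = (\<Sum>x\<in>W T. N g x x)"
    if T: "T \<subseteq> S" and g: "g \<in> carrier \<Gamma>" for T g
  proof -
    \<comment> \<open>On the functions constant on classes of \<open>res T\<close> the class
      indicators are a second basis, in which \<open>g\<close> acts by the permutation matrix
      \<open>M\<close>. Its trace counts the fixed classes, and \<open>\<phi>\<close> and
      \<open>B T\<close> are the two base changes.\<close>
    define M where "M z z' = ind T z (act g z')" for z z'
    have \<phi>W: "\<phi> x y = (\<Sum>z\<in>W T. \<phi> x z * ind T z y)" if x: "x \<in> W T" and y: "y \<in> X" for x y
    proof -
      obtain z0 where z0: "z0 \<in> W T" "res T z0 = res T y" using rep_ex[OF T y] by blast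
      have "res (D x) z0 = res (D x) y"
        using res_mono[of "D x" T z0 y] x z0 T y WX by (auto simp: W_def)
      then show ?thesis using rep_sum[OF T z0, of "\<phi> x"] by (simp add: \<phi>_def ind_def)
    qed
    have "N g x x = (\<Sum>z\<in>W T. \<Sum>z'\<in>W T. B T z x * M z z' * \<phi> x z')" if x: "x \<in> W T" for x
    proof -
      have xX: "x \<in> X" using x WX by blast
      show ?thesis
      proof (rule uniq[of "\<lambda>i. N g i x" "\<lambda>i. \<Sum>z\<in>W T. \<Sum>z'\<in>W T. B T z i * M z z' * \<phi> x z'" x])
        fix y assume y: "y \<in> X"
        let ?y = "act (inv\<^bsub>\<Gamma>\<^esub> g) y"
        have y': "?y \<in> X" using act_in g y by auto
        have "(\<Sum>i\<in>X. N g i x * \<phi> i y) = ind (D x) (act g x) y" by (rule Nsum[OF g xX y])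
        also have "\<dots> = \<phi> x ?y" unfolding \<phi>_def using g xX y D_sub by (intro shift) auto
        also have "\<dots> = (\<Sum>z'\<in>W T. \<phi> x z' * ind T z' ?y)" by (rule \<phi>W[OF x y'])
        also have "\<dots> = (\<Sum>z'\<in>W T. \<phi> x z' * (\<Sum>z\<in>W T. M z z' * ind T z y))"
        proof (intro sum.cong refl arg_cong2[where f = "(*)"])
          fix z' assume z': "z' \<in> W T"
          then have z'X: "z' \<in> X" "act g z' \<in> X" using WX act_in g by auto
          obtain z0 where z0: "z0 \<in> W T" "res T z0 = res T y" using rep_ex[OF T y] by blast
          have "(\<Sum>z\<in>W T. M z z' * ind T z y) = M z0 z'" by (rule rep_sum[OF T z0])
          also have "\<dots> = ind T (act g z') y" using z0(2) by (auto simp: M_def ind_def)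
          also have "\<dots> = ind T z' ?y" by (rule shift[OF g T z'X(1) y])
          finally show "ind T z' ?y = (\<Sum>z\<in>W T. M z z' * ind T z y)" by simp
        qed
        also have "\<dots> = (\<Sum>z'\<in>W T. \<phi> x z' * (\<Sum>z\<in>W T. M z z' * (\<Sum>i\<in>X. B T z i * \<phi> i y)))"
          by (intro sum.cong refl arg_cong2[where f = "(*)"] B[OF T _ y]) (use WX in auto)
        also have "\<dots> = (\<Sum>z'\<in>W T. \<Sum>i\<in>X. \<Sum>z\<in>W T. B T z i * M z z' * \<phi> x z' * \<phi> i y)"
          unfolding sum_distrib_left by (subst (2) sum.swap) (simp add: mult_ac)
        also have "\<dots> = (\<Sum>i\<in>X. \<Sum>z\<in>W T. \<Sum>z'\<in>W T. B T z i * M z z' * \<phi> x z' * \<phi> i y)"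
          by (subst sum.swap, rule sum.cong[OF refl], rule sum.swap)
        finally show "(\<Sum>i\<in>X. N g i x * \<phi> i y) =
            (\<Sum>i\<in>X. (\<Sum>z\<in>W T. \<Sum>z'\<in>W T. B T z i * M z z' * \<phi> x z') * \<phi> i y)"
          by (simp add: sum_distrib_right)
      qed (fact xX)
    qed
    then have "(\<Sum>x\<in>W T. N g x x) = (\<Sum>x\<in>W T. \<Sum>z\<in>W T. \<Sum>z'\<in>W T. B T z x * M z z' * \<phi> x z')"
      by simp
    also have "\<dots> = (\<Sum>z\<in>W T. M z z)"
    proof (rule index_rep_trace_change[OF finW finW])
      fix z z' assume z: "z \<in> W T" "z' \<in> W T"
      have "(\<Sum>x\<in>W T. \<phi> x z * B T z' x) = (\<Sum>x\<in>X. B T z' x * \<phi> x z)"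
        by (rule sum.mono_neutral_cong_left) (use X WX B0[OF T] z in \<open>auto simp: subset_iff\<close>)
      also have "\<dots> = ind T z' z" using B[OF T] z WX by (metis subset_iff)
      finally show "(\<Sum>x\<in>W T. \<phi> x z * B T z' x) = (if z = z' then 1 else 0)"
        using rep_unique[OF z T] by (auto simp: ind_def)
    qed
    also have "\<dots> = of_nat (card {z \<in> W T. res T (act g z) = res T z})"
      using finW by (simp add: M_def ind_def sum.If_cases Int_def)
    also have "card {z \<in> W T. res T (act g z) = res T z} = card (res T ` {x \<in> X. res T (act g x) = res T x})"
    proof (rule bij_betw_same_card[of "res T"], rule bij_betw_imageI)
      show "inj_on (res T) {z \<in> W T. res T (act g z) = res T z}"
        using rep_unique[OF _ _ T] by (auto simp: inj_on_def)
      show "res T ` {z \<in> W T. res T (act g z) = res T z} = res T ` {x \<in> X. res T (act g x) = res T x}"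
      proof
        show "res T ` {x \<in> X. res T (act g x) = res T x} \<subseteq> res T ` {z \<in> W T. res T (act g z) = res T z}"
        proof safe
          fix x assume x: "x \<in> X" "res T (act g x) = res T x"
          obtain z where z: "z \<in> W T" "res T z = res T x" using rep_ex[OF T x(1)] by blast
          have "res T (act g z) = res T (act g x)" using z WX x by (intro act_res[OF g T]) auto
          then show "res T x \<in> res T ` {z \<in> W T. res T (act g z) = res T z}"
            using z x by (intro image_eqI[of _ _ z]) auto
        qed
      qed (use WX in auto)
    qed
    finally show ?thesis by simp
  qed
  have "on_carrier \<Gamma> (\<lambda>g. \<Sum>T\<in>Pow S. (-1) ^ card (S - T) *
      of_nat (card (res T ` {x \<in> X. res T (act g x) = res T x}))) = on_carrier \<Gamma> (\<lambda>g. \<Sum>x\<in>K. N g x x)"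
  proof (rule on_carrier_cong)
    fix g assume g: "g \<in> carrier \<Gamma>"
    have "(\<Sum>T\<in>Pow S. (-1) ^ card (S - T) * of_nat (card (res T ` {x \<in> X. res T (act g x) = res T x})))
        = (\<Sum>T\<in>Pow S. \<Sum>x | x \<in> X \<and> D x \<subseteq> T. (-1) ^ card (S - T) * N g x x)"
      using trace[OF _ g] by (intro sum.cong refl) (simp add: sum_distrib_left W_def)
    also have "\<dots> = (\<Sum>x\<in>X. \<Sum>T | T \<in> Pow S \<and> D x \<subseteq> T. (-1) ^ card (S - T) * N g x x)"
      using S X by (intro sum.swap_restrict) auto
    also have "\<dots> = (\<Sum>x\<in>X. (\<Sum>T\<in>{T. D x \<subseteq> T \<and> T \<subseteq> S}. (-1) ^ card (S - T)) * N g x x)"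
      unfolding sum_distrib_right by (intro sum.cong refl) auto
    also have "\<dots> = (\<Sum>x\<in>X. if D x = S then N g x x else 0)"
      by (intro sum.cong refl) (simp add: sum_alternating_supersets[OF S D_sub])
    also have "\<dots> = (\<Sum>x\<in>K. N g x x)"
      unfolding K_def by (rule sum.inter_filter[symmetric]) (fact X)
    finally show "(\<Sum>T\<in>Pow S. (-1) ^ card (S - T) * of_nat (card (res T ` {x \<in> X. res T (act g x) = res T x})))
        = (\<Sum>x\<in>K. N g x x)" .
  qed
  then show ?thesis using index_rep_character[OF G NK] by simp
qed

section \<open>Chains of subsets with alternating rank parity\<close>

lemma sum_less_of_all_less:
  fixes lab :: "'a \<Rightarrow> nat"
  assumes "finite A" "finite B" "card A = card B" "A \<noteq> {}"
    and less: "\<And>a b. a \<in> A \<Longrightarrow> b \<in> B \<Longrightarrow> lab a < lab b"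
  shows "sum lab A < sum lab B"
proof -
  define M where "M = Max (lab ` A)"
  have "sum lab A \<le> card A * M"
    using assms sum_bounded_above[of A lab M] by (simp add: M_def)
  also have "\<dots> < card B * Suc M"
    using assms(1,3,4) by (metis card_0_eq lessI mult_less_mono2 neq0_conv)
  also have "\<dots> \<le> sum lab B"
  proof -
    have "M \<in> lab ` A" unfolding M_def using assms by (intro Max_in) auto
    then have "Suc M \<le> lab b" if "b \<in> B" for b using less that by fastforce
    then show ?thesis using sum_bounded_below[of B "Suc M" lab] by simp
  qed
  finally show ?thesis .
qed

text \<open>The common elements contribute equally, and the two differences have the same nonzero
  size. This is how a chain whose blocks are sorted by label is recognised as the one of least label
  sum.\<close>

lemma exchange_sum_less:
  fixes lab :: "'a \<Rightarrow> nat"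
  assumes "finite A" "finite B" "card A = card B" "A \<noteq> B"
    and less: "\<And>a b. a \<in> A - B \<Longrightarrow> b \<in> B - A \<Longrightarrow> lab a < lab b"
  shows "sum lab A < sum lab B"
proof -
  have "card (A - B) = card (B - A)"
    using assms by (metis Int_commute card_Diff_subset_Int finite_Int)
  moreover have "A - B \<noteq> {}"
    using assms by (metis Diff_eq_empty_iff card_subset_eq)
  ultimately have "sum lab (A - B) < sum lab (B - A)"
    using assms by (intro sum_less_of_all_less) auto
  moreover have "sum lab A = sum lab (A - B) + sum lab (A \<inter> B)"
    using assms(1) by (metis Int_Diff_disjoint Int_Diff_Un Int_commute add.commute finite_Diff finite_Int sum.union_disjoint)
  moreover have "sum lab B = sum lab (B - A) + sum lab (A \<inter> B)"
    using assms(2) by (metis Int_Diff_disjoint Int_Diff_Un Int_commute add.commute finite_Diff finite_Int sum.union_disjoint)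
  ultimately show ?thesis by simp
qed

locale finite_poset =
  fixes P :: "'a set" and r :: "'a rel"
  assumes finite_P: "finite P" and po: "partial_order_on P r"
begin

lemma r_in_P: "(x, y) \<in> r \<Longrightarrow> x \<in> P \<and> y \<in> P"
  using partial_order_onD(4)[OF po] by blast

lemma r_refl: "x \<in> P \<Longrightarrow> (x, x) \<in> r"
  using partial_order_onD(1)[OF po] by (simp add: refl_on_def)

lemma r_trans: "(x, y) \<in> r \<Longrightarrow> (y, z) \<in> r \<Longrightarrow> (x, z) \<in> r"
  using partial_order_onD(2)[OF po] by (rule transD)

lemma r_antisym: "(x, y) \<in> r \<Longrightarrow> (y, x) \<in> r \<Longrightarrow> x = y"
  using partial_order_onD(3)[OF po] by (rule antisymD)

lemma cover_below:
  assumes "(y, x) \<in> r" "y \<noteq> x"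
  obtains z where "covers P r y z" "(z, x) \<in> r"
proof -
  let ?A = "{z. (y, z) \<in> r \<and> (z, x) \<in> r \<and> z \<noteq> y}"
  define h where "h z = card {w. (w, z) \<in> r}" for z
  have fin: "finite {w. (w, z) \<in> r}" for z
    by (rule finite_subset[OF _ finite_P]) (use r_in_P in auto)
  have "x \<in> ?A" using assms r_refl r_in_P by auto
  then obtain z where z: "z \<in> ?A" and zmin: "\<And>w. w \<in> ?A \<Longrightarrow> h z \<le> h w"
    using arg_min_nat_lemma[of "\<lambda>z. z \<in> ?A" x h] by blast
  have "\<not> (\<exists>w\<in>P. w \<noteq> y \<and> w \<noteq> z \<and> (y, w) \<in> r \<and> (w, z) \<in> r)"
  proof
    assume "\<exists>w\<in>P. w \<noteq> y \<and> w \<noteq> z \<and> (y, w) \<in> r \<and> (w, z) \<in> r"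
    then obtain w where w: "w \<in> P" "w \<noteq> y" "w \<noteq> z" "(y, w) \<in> r" "(w, z) \<in> r" by blast
    have "w \<in> ?A" using w z r_trans by blast
    moreover have "{u. (u, w) \<in> r} \<subset> {u. (u, z) \<in> r}"
      using w r_trans[OF _ w(5)] r_antisym[of w z] r_refl r_in_P by blast
    then have "h w < h z" unfolding h_def by (rule psubset_card_mono[OF fin])
    ultimately show False using zmin by fastforce
  qed
  then have "covers P r y z" using z r_in_P unfolding covers_def by auto
  then show ?thesis using z that by blast
qed

end

text \<open>Only the growth of the rank along covers is fixed here, which is all that the parity
  arguments use; the values at minimal and maximal elements enter with
  \<open>ranked_poset\<close>.\<close>

locale parity_poset = finite_poset +
  fixes \<rho> :: "'a \<Rightarrow> nat"
  assumes rank_covers: "\<And>x y. covers P r x y \<Longrightarrow> \<rho> y = Suc (\<rho> x)"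
begin

definition col :: "'a \<Rightarrow> bool" where "col x = odd (\<rho> x)"

definition downset :: "'a set \<Rightarrow> bool" where
  "downset I \<longleftrightarrow> I \<subseteq> P \<and> (\<forall>x\<in>I. \<forall>y. (y, x) \<in> r \<longrightarrow> y \<in> I)"

text \<open>A member of \<open>chains C T \<epsilon> I\<close> is a chain of subsets of \<open>P\<close> above \<open>I\<close>, indexed by their
  cardinalities in \<open>T \<union> C\<close>: crossing an index in \<open>C\<close> switches the rank parity of the added
  elements, which starts with \<open>\<epsilon>\<close>, and crossing an index in \<open>T\<close> does not.\<close>

definition chains :: "nat set \<Rightarrow> nat set \<Rightarrow> bool \<Rightarrow> 'a set \<Rightarrow> (nat \<Rightarrow> 'a set) set" where
  "chains C T \<epsilon> I = {J \<in> (T \<union> C) \<rightarrow>\<^sub>E Pow P.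
     (\<forall>d\<in>T \<union> C. I \<subseteq> J d \<and> card (J d) = d) \<and>
     (\<forall>d\<in>T \<union> C. \<forall>e\<in>T \<union> C. d < e \<longrightarrow> J d \<subseteq> J e) \<and>
     (\<forall>c\<in>C. downset (J c)) \<and>
     (\<forall>v\<in>P - I. col v = (\<epsilon> \<noteq> odd (card {c \<in> C. v \<notin> J c})))}"

definition fixed_chains ::
  "('a \<Rightarrow> 'a) \<Rightarrow> nat set \<Rightarrow> nat set \<Rightarrow> bool \<Rightarrow> 'a set \<Rightarrow> (nat \<Rightarrow> 'a set) set" where
  "fixed_chains g C T \<epsilon> I = {J \<in> chains C T \<epsilon> I. \<forall>d\<in>T \<union> C. g ` J d = J d}"

lemma chainsD:
  assumes "J \<in> chains C T \<epsilon> I"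
  shows "J \<in> (T \<union> C) \<rightarrow>\<^sub>E Pow P" "\<And>d. d \<in> T \<union> C \<Longrightarrow> J d \<subseteq> P" "\<And>d. d \<in> T \<union> C \<Longrightarrow> I \<subseteq> J d"
    "\<And>d. d \<in> T \<union> C \<Longrightarrow> card (J d) = d" "\<And>d. d \<in> T \<union> C \<Longrightarrow> finite (J d)"
    "\<And>d e. d \<in> T \<union> C \<Longrightarrow> e \<in> T \<union> C \<Longrightarrow> d \<le> e \<Longrightarrow> J d \<subseteq> J e"
    "\<And>c. c \<in> C \<Longrightarrow> downset (J c)"
    "\<And>v. v \<in> P \<Longrightarrow> v \<notin> I \<Longrightarrow> col v = (\<epsilon> \<noteq> odd (card {c \<in> C. v \<notin> J c}))"
proof -
  show "J \<in> (T \<union> C) \<rightarrow>\<^sub>E Pow P" and sub: "\<And>d. d \<in> T \<union> C \<Longrightarrow> J d \<subseteq> P"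
    using assms by (auto simp: chains_def)
  show "\<And>d. d \<in> T \<union> C \<Longrightarrow> I \<subseteq> J d" "\<And>d. d \<in> T \<union> C \<Longrightarrow> card (J d) = d"
    "\<And>c. c \<in> C \<Longrightarrow> downset (J c)"
    "\<And>v. v \<in> P \<Longrightarrow> v \<notin> I \<Longrightarrow> col v = (\<epsilon> \<noteq> odd (card {c \<in> C. v \<notin> J c}))"
    using assms unfolding chains_def by blast+
  show "finite (J d)" if "d \<in> T \<union> C" for d using sub[OF that] finite_P by (rule finite_subset)
  show "J d \<subseteq> J e" if "d \<in> T \<union> C" "e \<in> T \<union> C" "d \<le> e" for d e
    using assms that by (cases "d = e") (auto simp: chains_def)
qed

lemma chainsI:
  assumes "J \<in> (T \<union> C) \<rightarrow>\<^sub>E Pow P" "\<And>d. d \<in> T \<union> C \<Longrightarrow> I \<subseteq> J d"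
    "\<And>d. d \<in> T \<union> C \<Longrightarrow> card (J d) = d"
    "\<And>d e. d \<in> T \<union> C \<Longrightarrow> e \<in> T \<union> C \<Longrightarrow> d < e \<Longrightarrow> J d \<subseteq> J e"
    "\<And>c. c \<in> C \<Longrightarrow> downset (J c)"
    "\<And>v. v \<in> P \<Longrightarrow> v \<notin> I \<Longrightarrow> col v = (\<epsilon> \<noteq> odd (card {c \<in> C. v \<notin> J c}))"
  shows "J \<in> chains C T \<epsilon> I"
  using assms unfolding chains_def by blast

lemma finite_chains: "finite T \<Longrightarrow> finite C \<Longrightarrow> finite (chains C T \<epsilon> I)"
  by (rule finite_subset[of _ "(T \<union> C) \<rightarrow>\<^sub>E Pow P"]) (auto simp: chains_def finite_P intro!: finite_PiE)

lemma chains_cong_col: "(\<And>c. c \<in> C \<Longrightarrow> J c = J' c) \<Longrightarrow> {c \<in> C. v \<notin> J c} = {c \<in> C. v \<notin> J' c}"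
  by auto

lemma restrict_chain:
  assumes "J \<in> chains C S \<epsilon> I" "T \<subseteq> S"
  shows "restrict J (T \<union> C) \<in> chains C T \<epsilon> I"
proof (rule chainsI)
  note J = chainsD[OF assms(1)]
  fix v assume v: "v \<in> P" "v \<notin> I"
  have "{c \<in> C. v \<notin> restrict J (T \<union> C) c} = {c \<in> C. v \<notin> J c}" by auto
  then show "col v = (\<epsilon> \<noteq> odd (card {c \<in> C. v \<notin> restrict J (T \<union> C) c}))"
    using J(8)[OF v] by simp
next
  note J = chainsD[OF assms(1)]
  show "restrict J (T \<union> C) \<in> (T \<union> C) \<rightarrow>\<^sub>E Pow P" using J(2) assms(2) by (auto simp: PiE_iff)
  fix d assume d: "d \<in> T \<union> C"
  then have d': "d \<in> S \<union> C" using assms(2) by blast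
  show "I \<subseteq> restrict J (T \<union> C) d" "card (restrict J (T \<union> C) d) = d"
    using J(3,4)[OF d'] d by auto
  fix e assume e: "e \<in> T \<union> C" "d < e"
  then have "e \<in> S \<union> C" using assms(2) by blast
  then show "restrict J (T \<union> C) d \<subseteq> restrict J (T \<union> C) e" using J(6)[OF d'] d e by auto
next
  fix c assume "c \<in> C"
  then show "downset (restrict J (T \<union> C) c)" using chainsD(7)[OF assms(1)] by auto
qed

text \<open>A set of size \<open>d\<close> fits between the union \<open>L\<close> of the smaller
  members and the intersection \<open>U\<close> of the larger ones: \<open>L\<close> lies in the
  next smaller member (or is \<open>I\<close>), and \<open>U\<close> contains the next larger one
  (or is \<open>P\<close>). The new index belongs to \<open>T\<close>, so neither the down-set
  condition nor the parity condition sees it.\<close>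

lemma extend_chain_insert:
  assumes J: "J \<in> chains C T \<epsilon> I" and fin: "finite T" "finite C"
    and d: "d \<notin> T \<union> C" "card I \<le> d" "d \<le> card P" and I: "I \<subseteq> P"
  obtains J' where "J' \<in> chains C (insert d T) \<epsilon> I" "restrict J' (T \<union> C) = J"
proof -
  note J' = chainsD[OF J]
  define L where "L = I \<union> (\<Union>e\<in>{e \<in> T \<union> C. e < d}. J e)"
  define U where "U = P \<inter> (\<Inter>e\<in>{e \<in> T \<union> C. d < e}. J e)"
  have "card L \<le> d"
  proof (cases "{e \<in> T \<union> C. e < d} = {}")
    case True
    then have "L = I" unfolding L_def by auto
    then show ?thesis using d by simp
  next
    case False
    define m where "m = Max {e \<in> T \<union> C. e < d}"
    have m: "m \<in> T \<union> C" "m < d" using Max_in[OF _ False] fin by (auto simp: m_def)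
    have "e \<le> m" if "e \<in> T \<union> C" "e < d" for e unfolding m_def using fin that by (intro Max_ge) auto
    then have "L \<subseteq> J m" unfolding L_def using J'(3)[OF m(1)] J'(6)[OF _ m(1)] by blast
    then have "card L \<le> card (J m)" using J'(5)[OF m(1)] by (intro card_mono)
    then show ?thesis using J'(4)[OF m(1)] m by simp
  qed
  moreover have "d \<le> card U"
  proof (cases "{e \<in> T \<union> C. d < e} = {}")
    case True
    then have "U = P" unfolding U_def by auto
    then show ?thesis using d by simp
  next
    case False
    define m where "m = Min {e \<in> T \<union> C. d < e}"
    have m: "m \<in> T \<union> C" "d < m" using Min_in[OF _ False] fin by (auto simp: m_def)
    have "m \<le> e" if "e \<in> T \<union> C" "d < e" for e unfolding m_def using fin that by (intro Min_le) auto
    then have "J m \<subseteq> U" unfolding U_def using J'(2)[OF m(1)] J'(6)[OF m(1)] by blast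
    then have "card (J m) \<le> card U" using finite_P by (intro card_mono) (auto simp: U_def)
    then show ?thesis using J'(4)[OF m(1)] m by simp
  qed
  moreover have "L \<subseteq> U"
  proof -
    have "J e \<subseteq> J f" if "e \<in> T \<union> C" "e < d" "f \<in> T \<union> C" "d < f" for e f
      using J'(6)[of e f] that by auto
    then show ?thesis unfolding L_def U_def using J'(2,3) I by blast
  qed
  moreover have "finite U" using finite_P by (simp add: U_def)
  ultimately obtain A where A: "L \<subseteq> A" "A \<subseteq> U" "card A = d"
    using exists_subset_between[of L d U] by blast
  let ?J = "J(d := A)"
  have other: "?J e = J e" if "e \<in> T \<union> C" for e using that d by auto
  have "?J \<in> chains C (insert d T) \<epsilon> I"
  proof (rule chainsI)
    show "?J \<in> (insert d T \<union> C) \<rightarrow>\<^sub>E Pow P" using J'(1) A by (auto simp: PiE_iff U_def extensional_def)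
    fix e assume e: "e \<in> insert d T \<union> C"
    then have e': "e = d \<or> e \<in> T \<union> C" by auto
    show "I \<subseteq> ?J e" "card (?J e) = e" using e' A J'(3,4) d by (auto simp: L_def)
    fix f assume f: "f \<in> insert d T \<union> C" "e < f"
    then have f': "f = d \<or> f \<in> T \<union> C" by auto
    have 1: "J e \<subseteq> A" if "e \<in> T \<union> C" "e < d" for e using that A(1) unfolding L_def by blast
    have 2: "A \<subseteq> J e" if "e \<in> T \<union> C" "d < e" for e using that A(2) unfolding U_def by blast
    show "?J e \<subseteq> ?J f" using e' f' f(2) 1[of e] 2[of f] J'(6)[of e f] by (cases "e = d"; cases "f = d") auto
  next
    fix c assume "c \<in> C" then show "downset (?J c)" using J'(7) other by auto
  next
    fix v assume v: "v \<in> P" "v \<notin> I"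
    have "{c \<in> C. v \<notin> ?J c} = {c \<in> C. v \<notin> J c}" by (rule chains_cong_col) (use other in blast)
    then show "col v = (\<epsilon> \<noteq> odd (card {c \<in> C. v \<notin> ?J c}))" using J'(8)[OF v] by simp
  qed
  moreover have "restrict ?J (T \<union> C) = J"
    using J'(1) other by (auto simp: fun_eq_iff PiE_iff extensional_def)
  ultimately show ?thesis using that by blast
qed

lemma extend_chain:
  assumes J: "J \<in> chains C T \<epsilon> I" and S: "finite S" "T \<subseteq> S" "finite C" "S \<inter> C = {}"
    and bounds: "\<And>d. d \<in> S \<Longrightarrow> card I \<le> d \<and> d \<le> card P" and I: "I \<subseteq> P"
  shows "\<exists>J'\<in>chains C S \<epsilon> I. restrict J' (T \<union> C) = J"
proof -
  have "F \<subseteq> S - T \<Longrightarrow> \<exists>J'\<in>chains C (T \<union> F) \<epsilon> I. restrict J' (T \<union> C) = J" if "finite F" for F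
    using that
  proof (induction F rule: finite_induct)
    case empty
    have "restrict J (T \<union> C) = J" using chainsD(1)[OF J] by (auto simp: fun_eq_iff PiE_iff extensional_def)
    then show ?case using J by (intro bexI[of _ J]) (simp_all only: Un_empty_right)
  next
    case (insert d F)
    then obtain J1 where J1: "J1 \<in> chains C (T \<union> F) \<epsilon> I" "restrict J1 (T \<union> C) = J"
      by blast
    have "finite (T \<union> F)" using S insert.hyps finite_subset by auto
    moreover have "d \<notin> T \<union> F \<union> C" using insert.prems insert.hyps S by auto
    ultimately obtain J2 where J2: "J2 \<in> chains C (insert d (T \<union> F)) \<epsilon> I" "restrict J2 (T \<union> F \<union> C) = J1"
      using extend_chain_insert[OF J1(1) _ S(3), of d] bounds[of d] I insert.prems by auto
    have "restrict J2 (T \<union> C) = restrict (restrict J2 (T \<union> F \<union> C)) (T \<union> C)"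
      by (auto simp: fun_eq_iff)
    then show ?case using J1 J2 by (intro bexI[of _ J2]) auto
  qed
  from this[of "S - T"] show ?thesis using S by (simp add: Un_absorb1)
qed

text \<open>No descent between adjacent blocks implies sortedness inside each block cut out by
  \<open>T \<union> C\<close>. If a second index separates \<open>v\<close> and \<open>v'\<close>,
  then two indices e1 < e2 of \<open>S - T\<close> do, and any element \<open>u\<close> of
  \<open>J e2 - J e1\<close> lies between them. Fewer indices separate \<open>u\<close> from either
  one, so induction gives \<open>lab v < lab u < lab v'\<close>.\<close>

lemma unseparated_sorted:
  fixes lab :: "'a \<Rightarrow> nat"
  assumes J: "J \<in> chains C S \<epsilon> I" and T: "T \<subseteq> S" "S \<inter> C = {}" and fin: "finite S" "finite C"
    and lab: "inj_on lab P"
    and loc: "\<And>d v v'. d \<in> S - T \<Longrightarrow> v \<in> J d \<Longrightarrow> v' \<in> P - J d \<Longrightarrow>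
      (\<forall>e\<in>S \<union> C - {d}. v \<in> J e \<longleftrightarrow> v' \<in> J e) \<Longrightarrow> lab v < lab v'"
  shows "d \<in> S - T \<Longrightarrow> v \<in> J d \<Longrightarrow> v' \<in> P - J d \<Longrightarrow>
      (\<forall>e\<in>T \<union> C. v \<in> J e \<longleftrightarrow> v' \<in> J e) \<Longrightarrow> lab v < lab v'"
proof (induction "card {e \<in> S \<union> C. (v \<in> J e) \<noteq> (v' \<in> J e)}" arbitrary: d v v' rule: less_induct)
  case less
  note J' = chainsD[OF J]
  let ?sep = "\<lambda>v v'. {e \<in> S \<union> C. (v \<in> J e) \<noteq> (v' \<in> J e)}"
  have dS: "d \<in> S \<union> C" using less.prems by blast
  have nsub: "\<not> J e \<subseteq> J f \<Longrightarrow> f < e" if "e \<in> S \<union> C" "f \<in> S \<union> C" for e f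
    using J'(6)[OF that] by force
  have vP: "v \<in> P" "v' \<in> P" using less.prems J'(2)[OF dS] by auto
  show ?case
  proof (cases "\<forall>e\<in>S \<union> C - {d}. v \<in> J e \<longleftrightarrow> v' \<in> J e")
    case True
    then show ?thesis using loc less.prems by blast
  next
    case False
    then obtain e where e: "e \<in> S \<union> C" "e \<noteq> d" "(v \<in> J e) \<noteq> (v' \<in> J e)" by blast
    have eS: "e \<in> S - T" using e less.prems(4) T by blast
    have e': "v \<in> J e" "v' \<notin> J e"
      using e(3) J'(6)[OF e(1) dS] J'(6)[OF dS e(1)] less.prems(2,3) by (meson DiffD2 linear subsetD)+
    obtain e1 e2 where e12: "e1 < e2" "e1 \<in> S - T" "e2 \<in> S - T" "v \<in> J e1" "v' \<notin> J e2"
      "v \<in> J e2" "v' \<notin> J e1"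
    proof (cases "d < e")
      case True
      then show ?thesis using that[of d e] less.prems eS e' by blast
    next
      case False
      then show ?thesis using that[of e d] less.prems eS e' e(2) by auto
    qed
    have eSC: "e1 \<in> S \<union> C" "e2 \<in> S \<union> C" using e12 by auto
    have "J e1 \<subset> J e2"
      using J'(4)[OF eSC(1)] J'(4)[OF eSC(2)] J'(6)[OF eSC] e12(1) by (metis less_imp_le nat_less_le psubsetI)
    then obtain u where u: "u \<in> J e2" "u \<notin> J e1" by blast
    have uP: "u \<in> P" using u J'(2)[OF eSC(2)] by blast
    have block: "u \<in> J f \<longleftrightarrow> v \<in> J f" "u \<in> J f \<longleftrightarrow> v' \<in> J f" if f: "f \<in> T \<union> C" for f
    proof -
      have fSC: "f \<in> S \<union> C" using f T by blast
      have same: "v \<in> J f \<longleftrightarrow> v' \<in> J f" using less.prems(4) f by blast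
      consider "f \<le> e1" | "e2 \<le> f" | "e1 \<le> f" "f \<le> e2" by linarith
      then have "u \<in> J f \<longleftrightarrow> v \<in> J f"
      proof cases
        case 1
        then have "J f \<subseteq> J e1" using J'(6)[OF fSC eSC(1)] by blast
        then show ?thesis using same u e12 by blast
      next
        case 2
        then have "J e2 \<subseteq> J f" using J'(6)[OF eSC(2) fSC] by blast
        then show ?thesis using same u e12 by blast
      next
        case 3
        then have "J e1 \<subseteq> J f" "J f \<subseteq> J e2" using J'(6) fSC eSC by blast+
        then show ?thesis using same u e12 by blast
      qed
      then show "u \<in> J f \<longleftrightarrow> v \<in> J f" "u \<in> J f \<longleftrightarrow> v' \<in> J f" using same by auto
    qed
    have finsep: "finite (?sep v v')" using fin by auto
    have mono: "J f \<subseteq> J h \<or> J h \<subseteq> J f" if "f \<in> S \<union> C" "h \<in> S \<union> C" for f h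
      using J'(6)[OF that] J'(6)[OF that(2,1)] by force
    have "?sep v u \<subseteq> ?sep v v' - {e2}"
      using mono[OF _ eSC(1)] mono[OF _ eSC(2)] u e12 by blast
    then have "?sep v u \<subset> ?sep v v'" using e12 eSC by blast
    then have c1: "card (?sep v u) < card (?sep v v')" by (rule psubset_card_mono[OF finsep])
    have "?sep u v' \<subseteq> ?sep v v' - {e1}"
      using mono[OF _ eSC(1)] mono[OF _ eSC(2)] u e12 by blast
    then have "?sep u v' \<subset> ?sep v v'" using e12 eSC by blast
    then have c2: "card (?sep u v') < card (?sep v v')" by (rule psubset_card_mono[OF finsep])
    have "lab v < lab u"
      using less.hyps[OF c1 e12(2)] e12 u uP block by blast
    also have "lab u < lab v'"
      using less.hyps[OF c2 e12(3)] e12 u vP block by blast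
    finally show ?thesis .
  qed
qed

end

section \<open>Ribbon characters as quotients of permutation representations on chains\<close>

context parity_poset
begin

text \<open>Rank preservation is part of the notion, so that parity conditions are transported
  already in \<open>parity_poset\<close>; for order automorphisms of a ranked poset it is derived in
  \<open>rank_autI\<close>.\<close>

definition rank_aut :: "('a \<Rightarrow> 'a) \<Rightarrow> bool" where
  "rank_aut g \<longleftrightarrow> bij_betw g P P \<and> (\<forall>x\<in>P. \<forall>y\<in>P. (g x, g y) \<in> r \<longleftrightarrow> (x, y) \<in> r) \<and>
     (\<forall>x\<in>P. \<rho> (g x) = \<rho> x)"

lemma rank_autD:
  assumes "rank_aut g"
  shows "bij_betw g P P" "inj_on g P" "g ` P = P"
    "\<And>x y. x \<in> P \<Longrightarrow> y \<in> P \<Longrightarrow> (g x, g y) \<in> r \<longleftrightarrow> (x, y) \<in> r" "\<And>x. x \<in> P \<Longrightarrow> \<rho> (g x) = \<rho> x"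
    "\<And>x. x \<in> P \<Longrightarrow> col (g x) = col x"
  using assms by (auto simp: rank_aut_def bij_betw_def col_def)

lemma image_downset:
  assumes g: "rank_aut g" and I: "downset I"
  shows "downset (g ` I)"
  unfolding downset_def
proof (intro conjI ballI allI impI)
  note g' = rank_autD[OF g]
  have IP: "I \<subseteq> P" using I by (simp add: downset_def)
  then show "g ` I \<subseteq> P" using g'(3) by blast
  fix x y assume "x \<in> g ` I" and y: "(y, x) \<in> r"
  then obtain u where u: "u \<in> I" "x = g u" by blast
  have "y \<in> g ` P" using r_in_P[OF y] g'(3) by simp
  then obtain w where w: "w \<in> P" "y = g w" by blast
  have "(w, u) \<in> r" using y u w IP g'(4) by blast
  then have "w \<in> I" using I u by (auto simp: downset_def)
  then show "y \<in> g ` I" using w by blast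
qed

lemma image_chain:
  assumes g: "rank_aut g" and J: "J \<in> chains C T \<epsilon> {}"
  shows "(\<lambda>d\<in>T \<union> C. g ` J d) \<in> chains C T \<epsilon> {}"
proof (rule chainsI)
  note g' = rank_autD[OF g] and J' = chainsD[OF J]
  show "(\<lambda>d\<in>T \<union> C. g ` J d) \<in> (T \<union> C) \<rightarrow>\<^sub>E Pow P"
    using J'(2) g'(3) by (auto simp: PiE_iff)
  show "card ((\<lambda>d\<in>T \<union> C. g ` J d) d) = d" if "d \<in> T \<union> C" for d
    using J'(4)[OF that] inj_on_subset[OF g'(2) J'(2)[OF that]] that by (auto simp: card_image)
  show "(\<lambda>d\<in>T \<union> C. g ` J d) d \<subseteq> (\<lambda>d\<in>T \<union> C. g ` J d) e" if "d \<in> T \<union> C" "e \<in> T \<union> C" "d < e" for d e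
    using J'(6)[OF that(1,2)] that by auto
  show "downset ((\<lambda>d\<in>T \<union> C. g ` J d) c)" if "c \<in> C" for c
    using image_downset[OF g J'(7)[OF that]] that by auto
  fix v assume v: "v \<in> P"
  then obtain u where u: "u \<in> P" "v = g u" using g'(3) by blast
  have "{c \<in> C. v \<notin> (\<lambda>d\<in>T \<union> C. g ` J d) c} = {c \<in> C. u \<notin> J c}"
    using inj_on_image_mem_iff[OF g'(2) u(1) J'(2)] u by auto
  then show "col v = (\<epsilon> \<noteq> odd (card {c \<in> C. v \<notin> (\<lambda>d\<in>T \<union> C. g ` J d) c}))"
    using J'(8)[OF u(1)] g'(6)[OF u(1)] u(2) by simp
qed auto

text \<open>An instance of \<open>alternating_sum_character\<close>: chains indexed by
  \<open>S \<union> C\<close> are classified by their restrictions to \<open>T \<union> C\<close>.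
  For an arbitrary injective labelling, \<open>D J\<close> is the descent set of \<open>J\<close>:
  the indices of \<open>S\<close> at which the block just before contains a larger label than some
  element of the block just after. \<open>rk\<close> adds the labels over all members and is least
  for the sorted refinement of a coarser chain.\<close>

lemma chain_character:
  fixes \<Gamma> :: "('a \<Rightarrow> 'a, 'm) monoid_scheme"
  assumes G: "group \<Gamma>" and aut: "\<And>g. g \<in> carrier \<Gamma> \<Longrightarrow> rank_aut g"
    and mult: "\<And>g h x. g \<in> carrier \<Gamma> \<Longrightarrow> h \<in> carrier \<Gamma> \<Longrightarrow> x \<in> P \<Longrightarrow> (g \<otimes>\<^bsub>\<Gamma>\<^esub> h) x = g (h x)"
    and one: "\<And>x. x \<in> P \<Longrightarrow> \<one>\<^bsub>\<Gamma>\<^esub> x = x"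
    and S: "finite S" "finite C" "S \<inter> C = {}" "S \<subseteq> {..card P}"
  shows "on_carrier \<Gamma> (\<lambda>g. \<Sum>T\<in>Pow S. (-1) ^ card (S - T) *
      of_nat (card (fixed_chains g C T False {}))) \<in> characters \<Gamma>"
proof -
  obtain lab :: "'a \<Rightarrow> nat" where lab: "inj_on lab P"
    using finite_imp_inj_to_nat_seg[OF finite_P] by blast
  define X where "X = chains C S False {}"
  define res where "res T J = restrict J (T \<union> C)" for T and J :: "nat \<Rightarrow> 'a set"
  define act where "act g J = (\<lambda>d\<in>S \<union> C. g ` J d)" for g :: "'a \<Rightarrow> 'a" and J
  define bad where "bad J d v v' \<longleftrightarrow> v \<in> J d \<and> v' \<in> P - J d \<and>
      (\<forall>e\<in>S \<union> C - {d}. v \<in> J e \<longleftrightarrow> v' \<in> J e) \<and> lab v' < lab v" for J d v v'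
  define D where "D J = {d \<in> S. \<exists>v v'. bad J d v v'}" for J
  define rk where "rk J = (\<Sum>e\<in>S \<union> C. sum lab (J e))" for J
  have finX: "finite X" using finite_chains S by (simp add: X_def)
  have res_eq: "res T x = res T y \<longleftrightarrow> (\<forall>d\<in>T \<union> C. x d = y d)" for T and x y :: "nat \<Rightarrow> 'a set"
    unfolding res_def by (metis restrict_apply' restrict_ext)
  have X_ext: "x = y" if "x \<in> X" "y \<in> X" "\<And>d. d \<in> S \<union> C \<Longrightarrow> x d = y d" for x y
    using that chainsD(1) unfolding X_def by (metis PiE_ext)
  have act_in: "act g x \<in> X" if "g \<in> carrier \<Gamma>" "x \<in> X" for g x
    using image_chain aut that unfolding act_def X_def by blast
  have subP: "x d \<subseteq> P" if "x \<in> X" "d \<in> S \<union> C" for x d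
    using that chainsD(2) unfolding X_def by blast
  have "on_carrier \<Gamma> (\<lambda>g. \<Sum>T\<in>Pow S. (-1) ^ card (S - T) *
      of_nat (card (res T ` {x \<in> X. res T (act g x) = res T x}))) \<in> characters \<Gamma>"
  proof (rule alternating_sum_character[OF G S(1) finX, where D = D and rk = rk])
    fix g x assume "g \<in> carrier \<Gamma>" "x \<in> X" then show "act g x \<in> X" by (rule act_in)
  next
    fix g h x assume gh: "g \<in> carrier \<Gamma>" "h \<in> carrier \<Gamma>" and x: "x \<in> X"
    show "act (g \<otimes>\<^bsub>\<Gamma>\<^esub> h) x = act g (act h x)"
    proof
      fix d
      show "act (g \<otimes>\<^bsub>\<Gamma>\<^esub> h) x d = act g (act h x) d"
      proof (cases "d \<in> S \<union> C")
        case True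
        have "(g \<otimes>\<^bsub>\<Gamma>\<^esub> h) ` x d = (\<lambda>v. g (h v)) ` x d"
          using subP[OF x True] mult[OF gh] by (intro image_cong) auto
        then show ?thesis using True by (simp add: act_def image_image)
      qed (auto simp: act_def)
    qed
  next
    fix x assume x: "x \<in> X"
    show "act \<one>\<^bsub>\<Gamma>\<^esub> x = x"
    proof (rule X_ext)
      show "act \<one>\<^bsub>\<Gamma>\<^esub> x \<in> X" using act_in x G by (simp add: group.is_monoid)
      fix d assume d: "d \<in> S \<union> C"
      have "\<one>\<^bsub>\<Gamma>\<^esub> ` x d = (\<lambda>v. v) ` x d"
        using subP[OF x d] one by (intro image_cong) auto
      then show "act \<one>\<^bsub>\<Gamma>\<^esub> x d = x d" using d by (simp add: act_def)
    qed (fact x)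
  next
    fix g T x y assume "T \<subseteq> S" "res T x = res T y"
    then show "res T (act g x) = res T (act g y)" unfolding res_eq by (auto simp: act_def)
  next
    fix T T' x y assume "T' \<subseteq> T" "res T x = res T y"
    then show "res T' x = res T' y" unfolding res_eq by blast
  next
    fix x show "D x \<subseteq> S" by (auto simp: D_def)
  next
    fix x y assume x: "x \<in> X" and y: "y \<in> X" and xy: "res (D x) y = res (D x) x" "y \<noteq> x"
    note x' = chainsD[OF x[unfolded X_def]] and y' = chainsD[OF y[unfolded X_def]]
    have agree: "y d = x d" if "d \<in> D x \<union> C" for d using xy(1) that unfolding res_eq by blast
    have loc: "lab v < lab v'" if "d \<in> S - D x" "v \<in> x d" "v' \<in> P - x d"
      "\<forall>e\<in>S \<union> C - {d}. v \<in> x e \<longleftrightarrow> v' \<in> x e" for d v v'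
    proof -
      have "d \<in> S \<union> C" using that by blast
      then have "v \<in> P" using that x'(2) by blast
      then have "lab v \<noteq> lab v'" using lab that by (auto simp: inj_on_def)
      moreover have "\<not> lab v' < lab v" using that unfolding D_def bad_def by blast
      ultimately show ?thesis by simp
    qed
    have DS: "D x \<subseteq> S" by (auto simp: D_def)
    \<comment> \<open>As \<open>x\<close> and \<open>y\<close> agree on
      \<open>D x \<union> C\<close>, the elements \<open>a\<close> and \<open>b\<close> lie in one
      block of these indices. There \<open>x\<close> has no descent, hence is sorted, so whatever
      \<open>x d\<close> contains has a smaller label than what \<open>y d\<close> takes
      instead.\<close>
    have less: "sum lab (x d) < sum lab (y d)" if d: "d \<in> S \<union> C" "y d \<noteq> x d" for d
    proof (rule exchange_sum_less)
      show "finite (x d)" "finite (y d)" "card (x d) = card (y d)" "x d \<noteq> y d"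
        using x'(4,5)[OF d(1)] y'(4,5)[OF d(1)] d by auto
      fix a b assume ab: "a \<in> x d - y d" "b \<in> y d - x d"
      have dT: "d \<in> S - D x" using d agree by blast
      have "\<forall>e\<in>D x \<union> C. a \<in> x e \<longleftrightarrow> b \<in> x e"
      proof
        fix e assume e: "e \<in> D x \<union> C"
        then have eS: "e \<in> S \<union> C" using DS by blast
        have eq: "y e = x e" using agree e by blast
        show "a \<in> x e \<longleftrightarrow> b \<in> x e"
        proof (cases "e \<le> d")
          case True
          then show ?thesis using x'(6)[OF eS d(1)] y'(6)[OF eS d(1)] eq ab by blast
        next
          case False
          then have "d \<le> e" by simp
          then show ?thesis using x'(6)[OF d(1) eS] y'(6)[OF d(1) eS] eq ab by blast
        qed
      qed
      note sep = this
      have "b \<in> P - x d" "a \<in> x d" using ab y'(2)[OF d(1)] by blast+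
      show "lab a < lab b"
        by (rule unseparated_sorted[OF x[unfolded X_def] DS S(3,1,2) lab _ dT]) (rule loc; assumption | fact)+
    qed
    have "\<exists>d\<in>S \<union> C. y d \<noteq> x d" using X_ext[OF x y] xy(2) by metis
    then obtain d where d: "d \<in> S \<union> C" "y d \<noteq> x d" by blast
    show "rk x < rk y" unfolding rk_def
    proof (rule sum_strict_mono_ex1)
      show "\<forall>d\<in>S \<union> C. sum lab (x d) \<le> sum lab (y d)" using less by (metis less_imp_le order_refl)
      show "\<exists>d\<in>S \<union> C. sum lab (x d) < sum lab (y d)" using less d by blast
    qed (use S in auto)
  next
    fix T x assume T: "T \<subseteq> S" and x: "x \<in> X"
    \<comment> \<open>A member of the class with least \<open>rk\<close> has no descent outside
      \<open>T\<close>: exchanging the two elements of such a descent changes only the member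
      \<open>y d\<close>, keeps the restriction to \<open>T \<union> C\<close>, and lowers
      \<open>rk\<close>.\<close>
    let ?Q = "\<lambda>y. y \<in> X \<and> res T y = res T x"
    obtain y where y: "?Q y" and ymin: "\<And>z. ?Q z \<Longrightarrow> rk y \<le> rk z"
      using arg_min_nat_lemma[of ?Q x rk] x by blast
    have yX: "y \<in> chains C S False {}" using y X_def by simp
    note y' = chainsD[OF yX]
    have "D y \<subseteq> T"
    proof (rule ccontr)
      assume "\<not> D y \<subseteq> T"
      then obtain d v v' where d: "d \<in> S" "d \<notin> T" and b: "bad y d v v'" unfolding D_def by blast
      have dS: "d \<in> S \<union> C" and dC: "d \<notin> C" using d S by auto
      note b = b[unfolded bad_def]
      let ?A = "insert v' (y d - {v})"
      let ?z = "y(d := ?A)"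
      have "0 < d" using y'(4,5)[OF dS] b by (metis card_gt_0_iff empty_iff)
      have "?z \<in> chains C S False {}"
      proof (rule chainsI)
        show "?z \<in> (S \<union> C) \<rightarrow>\<^sub>E Pow P" using y'(1) y'(2)[OF dS] b dS by (auto simp: PiE_iff extensional_def)
        show "card (?z e) = e" if "e \<in> S \<union> C" for e
          using y'(4)[OF that] y'(5)[OF dS] b \<open>0 < d\<close> by (auto simp: card_Suc_Diff1)
        show "downset (?z c)" if "c \<in> C" for c using y'(7) that dC by auto
        show "?z e \<subseteq> ?z f" if "e \<in> S \<union> C" "f \<in> S \<union> C" "e < f" for e f
        proof -
          have "y e \<subseteq> y f" using y'(6) that by simp
          then show ?thesis using b that by (cases "e = d"; cases "f = d") auto
        qed
        fix u assume u: "u \<in> P"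
        have "{c \<in> C. u \<notin> ?z c} = {c \<in> C. u \<notin> y c}" using dC by (intro chains_cong_col) auto
        then show "col u = (False \<noteq> odd (card {c \<in> C. u \<notin> ?z c}))" using y'(8)[OF u] by simp
      qed auto
      moreover have "res T ?z = res T y" unfolding res_eq using d dC by auto
      ultimately have "rk y \<le> rk ?z" using y by (intro ymin) (auto simp: X_def)
      moreover have "rk ?z < rk y" unfolding rk_def
      proof (rule sum_strict_mono_ex1)
        have "sum lab ?A = lab v' + sum lab (y d - {v})" using b y'(5)[OF dS] by (simp add: sum.insert)
        moreover have "sum lab (y d) = lab v + sum lab (y d - {v})" using b y'(5)[OF dS] by (simp add: sum.remove)
        ultimately have "sum lab ?A < sum lab (y d)" using b by simp
        then show "\<forall>e\<in>S \<union> C. sum lab (?z e) \<le> sum lab (y e)" "\<exists>e\<in>S \<union> C. sum lab (?z e) < sum lab (y e)"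
          using dS by (auto intro!: bexI[of _ d])
      qed (use S in auto)
      ultimately show False by simp
    qed
    then show "\<exists>y\<in>X. D y \<subseteq> T \<and> res T y = res T x" using y by blast
  qed
  also have "on_carrier \<Gamma> (\<lambda>g. \<Sum>T\<in>Pow S. (-1) ^ card (S - T) *
      of_nat (card (res T ` {x \<in> X. res T (act g x) = res T x}))) =
    on_carrier \<Gamma> (\<lambda>g. \<Sum>T\<in>Pow S. (-1) ^ card (S - T) * of_nat (card (fixed_chains g C T False {})))"
  proof (intro on_carrier_cong sum.cong refl arg_cong2[where f = "(*)"] arg_cong[where f = of_nat] arg_cong[where f = card])
    fix g T assume g: "g \<in> carrier \<Gamma>" and "T \<in> Pow S"
    then have T: "T \<subseteq> S" by simp
    have fix_iff: "res T (act g x) = res T x \<longleftrightarrow> (\<forall>d\<in>T \<union> C. g ` x d = x d)" for x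
    proof -
      have "act g x d = g ` x d" if "d \<in> T \<union> C" for d using T that by (auto simp: act_def)
      then show ?thesis unfolding res_eq by simp
    qed
    show "res T ` {x \<in> X. res T (act g x) = res T x} = fixed_chains g C T False {}"
    proof safe
      fix x assume x: "x \<in> X" "res T (act g x) = res T x"
      then show "res T x \<in> fixed_chains g C T False {}"
        using restrict_chain[OF _ T] unfolding fix_iff by (auto simp: fixed_chains_def X_def res_def)
    next
      fix K assume K: "K \<in> fixed_chains g C T False {}"
      then have K': "K \<in> chains C T False {}" by (simp add: fixed_chains_def)
      \<comment> \<open>Every chain on the indices \<open>T \<union> C\<close> is a restriction of
        one on \<open>S \<union> C\<close>, so the classes are exactly the chains on
        \<open>T \<union> C\<close>, and the fixed classes are the fixed chains.\<close>
      have "\<exists>x\<in>chains C S False {}. restrict x (T \<union> C) = K"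
        by (rule extend_chain[OF K' S(1) T S(2,3)]) (use S(4) in auto)
      then obtain x where x: "x \<in> X" "res T x = K" unfolding X_def res_def by blast
      have "x d = K d" if "d \<in> T \<union> C" for d using x(2) that by (auto simp: res_def)
      then have "res T (act g x) = res T x" using K unfolding fix_iff by (auto simp: fixed_chains_def)
      then show "K \<in> res T ` {x \<in> X. res T (act g x) = res T x}" using x by blast
    qed
  qed
  finally show ?thesis .
qed

end

section \<open>Tilings and the transfer recursion\<close>

text \<open>A word describes the positions between consecutive elements in a linear ordering of \<open>P\<close>: at a
  \<open>Switch\<close> the rank parity changes, a \<open>Domino\<close> is a descent together with the ascent that must follow
  it, and a \<open>Single\<close> is any other ascent. Its \<open>weight\<close> is \<open>X\<close> to the number of dominoes and of every
  second switch, times \<open>1 + X\<close> to the number of singles.\<close>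

datatype tile = Switch | Single | Domino

fun words :: "nat \<Rightarrow> tile list set" where
  "words 0 = {[]}"
| "words (Suc 0) = {[Switch], [Single]}"
| "words (Suc (Suc n)) = Cons Switch ` words (Suc n) \<union> Cons Single ` words (Suc n) \<union> Cons Domino ` words n"

text \<open>Position \<open>N\<close> is the gap after the \<open>N\<close>-th element, so it is
  also the cardinality of the set cut off there. A word for all of \<open>P\<close> therefore has
  length \<open>card P - 1\<close> and is read from \<open>N = 1\<close>.\<close>

fun starts :: "nat \<Rightarrow> tile list \<Rightarrow> nat set" where
  "starts N [] = {}"
| "starts N (Switch # w) = insert N (starts (Suc N) w)"
| "starts N (Single # w) = starts (Suc N) w"
| "starts N (Domino # w) = starts (Suc (Suc N)) w"

fun doms :: "nat \<Rightarrow> tile list \<Rightarrow> nat set" where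
  "doms N [] = {}"
| "doms N (Switch # w) = doms (Suc N) w"
| "doms N (Single # w) = doms (Suc N) w"
| "doms N (Domino # w) = insert N (doms (Suc (Suc N)) w)"

fun weight :: "bool \<Rightarrow> tile list \<Rightarrow> complex fps" where
  "weight \<epsilon> [] = 1"
| "weight \<epsilon> (Switch # w) = (if \<epsilon> then fps_X else 1) * weight (\<not> \<epsilon>) w"
| "weight \<epsilon> (Single # w) = (1 + fps_X) * weight \<epsilon> w"
| "weight \<epsilon> (Domino # w) = fps_X * weight \<epsilon> w"

lemma finite_words: "finite (words n)"
  by (induction n rule: words.induct) auto

lemma sum_words_Suc:
  fixes f :: "tile list \<Rightarrow> 'b::comm_monoid_add"
  shows "(\<Sum>w\<in>words (Suc n). f w) = (\<Sum>w\<in>words n. f (Switch # w)) + (\<Sum>w\<in>words n. f (Single # w)) +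
    (if n = 0 then 0 else \<Sum>w\<in>words (n - 1). f (Domino # w))"
proof (cases n)
  case (Suc m)
  have "(\<Sum>w\<in>words (Suc (Suc m)). f w) = (\<Sum>w\<in>Cons Switch ` words (Suc m). f w) +
      (\<Sum>w\<in>Cons Single ` words (Suc m). f w) + (\<Sum>w\<in>Cons Domino ` words m. f w)"
    unfolding words.simps
    by (subst sum.union_disjoint; (auto simp: finite_words)?) (subst sum.union_disjoint; auto simp: finite_words)
  then show ?thesis by (simp add: Suc sum.reindex inj_on_def)
qed (simp add: add.commute)

lemma finite_doms: "finite (doms N w)" and finite_starts: "finite (starts N w)"
  by (induction N w rule: doms.induct) auto

lemma doms_ge: "d \<in> doms N w \<Longrightarrow> N \<le> d" and starts_ge: "d \<in> starts N w \<Longrightarrow> N \<le> d"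
  by (induction N w rule: doms.induct) fastforce+

lemma doms_starts_disjoint: "doms N w \<inter> starts N w = {}"
  using doms_ge starts_ge by (induction N w rule: doms.induct) fastforce+

lemma doms_less: "w \<in> words m \<Longrightarrow> d \<in> doms N w \<Longrightarrow> d < N + m"
proof (induction m arbitrary: w N rule: words.induct)
  case (3 n)
  then show ?case by (fastforce)
qed auto

lemma starts_less: "w \<in> words m \<Longrightarrow> d \<in> starts N w \<Longrightarrow> d < N + m"
proof (induction m arbitrary: w N rule: words.induct)
  case (3 n)
  then show ?case by (fastforce)
qed auto

section \<open>Values of ribbon characters at one group element, computed along its invariant
  down-sets\<close>

locale parity_poset_aut = parity_poset +
  fixes g :: "'a \<Rightarrow> 'a"
  assumes g_aut: "rank_aut g"
begin

definition ideals :: "'a set set" where "ideals = {I. downset I \<and> g ` I = I}"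

text \<open>The possible ends of a run of parity \<epsilon> that starts after \<open>I\<close>. The
  empty run is included, which makes the incidence matrix of \<open>up\<close>
  unitriangular.\<close>

definition up :: "bool \<Rightarrow> 'a set \<Rightarrow> 'a set set" where
  "up \<epsilon> I = {I' \<in> ideals. I \<subseteq> I' \<and> (\<forall>v\<in>I' - I. col v = \<epsilon>)}"

lemma ideals_sub: "I \<in> ideals \<Longrightarrow> I \<subseteq> P"
  by (simp add: ideals_def downset_def)

lemma finite_ideal: "I \<in> ideals \<Longrightarrow> finite I"
  using ideals_sub finite_P finite_subset by blast

lemma finite_ideals: "finite ideals"
  by (rule finite_subset[of _ "Pow P"]) (use ideals_sub finite_P in blast)+

lemma P_ideal: "P \<in> ideals"
  using rank_autD(3)[OF g_aut] r_in_P by (auto simp: ideals_def downset_def)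

lemma empty_ideal: "{} \<in> ideals" by (simp add: ideals_def downset_def)

lemma up_ideals: "I' \<in> up \<epsilon> I \<Longrightarrow> I' \<in> ideals" by (simp add: up_def)

lemma finite_up: "finite (up \<epsilon> I)"
  using finite_ideals by (simp add: up_def)

lemma up_refl: "I \<in> ideals \<Longrightarrow> I \<in> up \<epsilon> I" by (simp add: up_def)

lemma up_card: "I' \<in> up \<epsilon> I \<Longrightarrow> card I \<le> card I'"
  by (auto simp: up_def finite_ideal intro: card_mono)

lemma up_card_eq: "I' \<in> up \<epsilon> I \<Longrightarrow> card I' = card I \<Longrightarrow> I' = I"
  using card_subset_eq[OF finite_ideal[OF up_ideals], of I' \<epsilon> I I] by (simp add: up_def)

lemma ideals_card: "I \<in> ideals \<Longrightarrow> card I \<le> card P"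
  using ideals_sub finite_P by (intro card_mono) auto

lemma ideals_card_eq: "I \<in> ideals \<Longrightarrow> card I = card P \<longleftrightarrow> I = P"
  using ideals_sub finite_P card_subset_eq by blast

text \<open>Consecutive elements of a covering chain have different parities, so a run of constant parity is
  an antichain and may be cut anywhere.\<close>

lemma chain_downset:
  assumes J: "J \<in> chains C T \<epsilon> I" and I: "downset I" and C: "finite C" and d: "d \<in> T \<union> C"
  shows "downset (J d)"
  unfolding downset_def
proof (intro conjI ballI allI impI)
  note J' = chainsD[OF J]
  show "J d \<subseteq> P" using J'(2)[OF d] .
  fix x y assume x: "x \<in> J d" and yx: "(y, x) \<in> r"
  show "y \<in> J d"
  proof (rule ccontr)
    assume y: "y \<notin> J d"
    then have "y \<noteq> x" using x by blast
    then obtain z where z: "covers P r y z" "(z, x) \<in> r" using cover_below[OF yx] by blast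
    have yz: "(y, z) \<in> r" using z(1) by (simp add: covers_def)
    have yI: "y \<notin> I" using y J'(3)[OF d] by blast
    then have zI: "z \<notin> I" using yz I by (auto simp: downset_def)
    have P: "y \<in> P" "z \<in> P" using yz r_in_P by auto
    have "{c \<in> C. z \<notin> J c} = {c \<in> C. y \<notin> J c}"
    proof
      show "{c \<in> C. z \<notin> J c} \<subseteq> {c \<in> C. y \<notin> J c}"
      proof safe
        fix c assume c: "c \<in> C" "z \<notin> J c" "y \<in> J c"
        have "x \<notin> J c" using J'(7)[OF c(1)] z(2) c(2) unfolding downset_def by blast
        then have "\<not> J d \<subseteq> J c" using x by blast
        then have "c \<le> d" using J'(6)[of d c] d c(1) by force
        then show False using J'(6)[of c d] d c y by blast
      qed
      show "{c \<in> C. y \<notin> J c} \<subseteq> {c \<in> C. z \<notin> J c}"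
        using J'(7) yz by (auto simp: downset_def)
    qed
    then have "col y = col z" using J'(8)[OF P(1) yI] J'(8)[OF P(2) zI] by simp
    then show False using rank_covers[OF z(1)] by (simp add: col_def)
  qed
qed

text \<open>The smallest index \<open>N\<close> is split off: the member \<open>J N\<close> is an
  invariant down-set reached from \<open>I\<close> by elements of the current parity, and the rest
  is a chain above it. The flag \<open>brk\<close> tells whether \<open>N\<close> is a switch, in
  which case the parity flips, so one bijection serves both kinds of index.\<close>

lemma card_fixed_chains_split:
  assumes fin: "finite T" "finite C" and above: "\<And>d. d \<in> T \<union> C \<Longrightarrow> N < d" and I: "I \<in> ideals"
    and TC: "(T', C', \<epsilon>') = (if brk then (T, insert N C, \<not> \<epsilon>) else (insert N T, C, \<epsilon>))"
  shows "card (fixed_chains g C' T' \<epsilon> I) =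
    (\<Sum>I' | I' \<in> up \<epsilon> I \<and> card I' = N. card (fixed_chains g C T \<epsilon>' I'))"
proof -
  let ?U = "{I' \<in> up \<epsilon> I. card I' = N}"
  have un: "T' \<union> C' = insert N (T \<union> C)" using TC by (auto split: if_splits)
  have N: "N \<notin> T \<union> C" using above by blast
  have CC: "C' = (if brk then insert N C else C)" using TC by (auto split: if_splits)
  have eps: "\<epsilon>' = (if brk then \<not> \<epsilon> else \<epsilon>)" using TC by (auto split: if_splits)
  have finC': "finite C'" using fin CC by simp
  \<comment> \<open>An element of \<open>J N\<close> lies in every later member and has crossed no
    switch; an element outside has crossed \<open>N\<close> as well when \<open>N\<close> is a
    switch, and the changed parity \<epsilon>' absorbs this.\<close>
  have col_split: "(\<epsilon> \<noteq> odd (card {c \<in> C'. v \<notin> J c})) =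
      (if v \<in> J N then \<epsilon> else \<epsilon>' \<noteq> odd (card {c \<in> C. v \<notin> J c}))"
    if "\<And>c. c \<in> C \<Longrightarrow> J N \<subseteq> J c" for v and J :: "nat \<Rightarrow> 'a set"
  proof (cases "v \<in> J N")
    case True
    then have "{c \<in> C'. v \<notin> J c} = {}" using that CC by auto
    then have "card {c \<in> C'. v \<notin> J c} = 0" by (simp only: card.empty)
    then show ?thesis using True by simp
  next
    case False
    have "{c \<in> C'. v \<notin> J c} = (if brk then insert N {c \<in> C. v \<notin> J c} else {c \<in> C. v \<notin> J c})"
      using False CC by auto
    then show ?thesis using False eps fin N by auto
  qed
  have "bij_betw (\<lambda>J. (J N, restrict J (T \<union> C))) (fixed_chains g C' T' \<epsilon> I)
      (SIGMA I':?U. fixed_chains g C T \<epsilon>' I')"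
  proof (rule bij_betw_byWitness[where f' = "\<lambda>(I', J). J(N := I')"])
    show "\<forall>J\<in>fixed_chains g C' T' \<epsilon> I. (case (J N, restrict J (T \<union> C)) of (I', J) \<Rightarrow> J(N := I')) = J"
    proof
      fix J assume "J \<in> fixed_chains g C' T' \<epsilon> I"
      then have "J \<in> chains C' T' \<epsilon> I" by (simp add: fixed_chains_def)
      then have "J \<in> (T' \<union> C') \<rightarrow>\<^sub>E Pow P" by (rule chainsD(1))
      then show "(case (J N, restrict J (T \<union> C)) of (I', J) \<Rightarrow> J(N := I')) = J"
        unfolding un by (auto simp: fun_eq_iff PiE_iff extensional_def)
    qed
    show "\<forall>p\<in>SIGMA I':?U. fixed_chains g C T \<epsilon>' I'.
        ((case p of (I', J) \<Rightarrow> J(N := I')) N, restrict (case p of (I', J) \<Rightarrow> J(N := I')) (T \<union> C)) = p"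
    proof
      fix p assume "p \<in> (SIGMA I':?U. fixed_chains g C T \<epsilon>' I')"
      then obtain I' J where p: "p = (I', J)" "J \<in> fixed_chains g C T \<epsilon>' I'" by blast
      then have "J \<in> chains C T \<epsilon>' I'" by (simp add: fixed_chains_def)
      then have "J \<in> (T \<union> C) \<rightarrow>\<^sub>E Pow P" by (rule chainsD(1))
      then have "restrict (J(N := I')) (T \<union> C) = J"
        using N by (auto simp: fun_eq_iff PiE_iff extensional_def)
      then show "((case p of (I', J) \<Rightarrow> J(N := I')) N, restrict (case p of (I', J) \<Rightarrow> J(N := I')) (T \<union> C)) = p"
        by (simp add: p)
    qed
    show "(\<lambda>J. (J N, restrict J (T \<union> C))) ` fixed_chains g C' T' \<epsilon> I \<subseteq> (SIGMA I':?U. fixed_chains g C T \<epsilon>' I')"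
    proof safe
      fix J assume J: "J \<in> fixed_chains g C' T' \<epsilon> I"
      then have J1: "J \<in> chains C' T' \<epsilon> I" by (simp add: fixed_chains_def)
      note J' = chainsD[OF J1, unfolded un]
      have gJ: "g ` J d = J d" if "d \<in> insert N (T \<union> C)" for d
        using J that unfolding fixed_chains_def un by blast
      have "downset (J N)"
        using chain_downset[OF J1 _ finC'] I un by (auto simp: ideals_def)
      then have JN: "J N \<in> ideals" using gJ by (simp add: ideals_def)
      have NC: "J N \<subseteq> J c" if "c \<in> C" for c using J'(6)[of N c] above that by force
      have colJ: "col v = (if v \<in> J N then \<epsilon> else \<epsilon>' \<noteq> odd (card {c \<in> C. v \<notin> J c}))"
        if "v \<in> P" "v \<notin> I" for v using J'(8)[OF that] col_split[where J = J and v = v] NC by simp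
      show "J N \<in> up \<epsilon> I" using JN J'(3)[of N] colJ J'(2)[of N] by (auto simp: up_def)
      show "card (J N) = N" using J'(4) by simp
      have "restrict J (T \<union> C) \<in> chains C T \<epsilon>' (J N)"
      proof (rule chainsI)
        show "restrict J (T \<union> C) \<in> T \<union> C \<rightarrow>\<^sub>E Pow P" using J'(2) by (auto simp: PiE_iff)
        fix d assume d: "d \<in> T \<union> C"
        show "J N \<subseteq> restrict J (T \<union> C) d" using J'(6)[of N d] d above[OF d] by auto
        show "card (restrict J (T \<union> C) d) = d" using J'(4)[of d] d by auto
        fix e assume "e \<in> T \<union> C" "d < e"
        then show "restrict J (T \<union> C) d \<subseteq> restrict J (T \<union> C) e" using J'(6)[of d e] d by auto
      next
        fix c assume "c \<in> C"
        then show "downset (restrict J (T \<union> C) c)" using J'(7) CC by auto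
      next
        fix v assume v: "v \<in> P" "v \<notin> J N"
        have "{c \<in> C. v \<notin> restrict J (T \<union> C) c} = {c \<in> C. v \<notin> J c}" by auto
        then show "col v = (\<epsilon>' \<noteq> odd (card {c \<in> C. v \<notin> restrict J (T \<union> C) c}))"
          using colJ[of v] v J'(3)[of N] by auto
      qed
      then show "restrict J (T \<union> C) \<in> fixed_chains g C T \<epsilon>' (J N)"
        using gJ by (auto simp: fixed_chains_def)
    qed
    show "(\<lambda>(I', J). J(N := I')) ` (SIGMA I':?U. fixed_chains g C T \<epsilon>' I') \<subseteq> fixed_chains g C' T' \<epsilon> I"
    proof
      fix K assume "K \<in> (\<lambda>(I', J). J(N := I')) ` (SIGMA I':?U. fixed_chains g C T \<epsilon>' I')"
      then obtain I' J where K: "K = J(N := I')" and I': "I' \<in> up \<epsilon> I" "N = card I'"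
        and J: "J \<in> fixed_chains g C T \<epsilon>' I'" by auto
      let ?J = "J(N := I')"
      have J1: "J \<in> chains C T \<epsilon>' I'" using J by (simp add: fixed_chains_def)
      note J' = chainsD[OF J1]
      have other: "?J d = J d" if "d \<in> T \<union> C" for d using N that by auto
      have II: "I \<subseteq> I'" "I' \<in> ideals" "\<And>v. v \<in> I' - I \<Longrightarrow> col v = \<epsilon>" using I' by (auto simp: up_def)
      have "?J \<in> chains C' T' \<epsilon> I"
      proof (rule chainsI; (unfold un)?)
        show "?J \<in> insert N (T \<union> C) \<rightarrow>\<^sub>E Pow P"
          using J'(1) ideals_sub[OF II(2)] by (auto simp: PiE_iff extensional_def)
        fix d assume d: "d \<in> insert N (T \<union> C)"
        show "I \<subseteq> ?J d" using J'(3)[of d] II(1) d by auto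
        show "card (?J d) = d" using J'(4)[of d] I'(2) d by auto
        fix e assume e: "e \<in> insert N (T \<union> C)" "d < e"
        show "?J d \<subseteq> ?J e" using J'(3)[of e] J'(6)[of d e] d e above[of d] above[of e]
          by (cases "d = N"; cases "e = N") auto
      next
        fix c assume "c \<in> C'"
        then show "downset (?J c)" using J'(7) II(2) CC by (auto simp: ideals_def split: if_splits)
      next
        fix v assume v: "v \<in> P" "v \<notin> I"
        have "{c \<in> C. v \<notin> ?J c} = {c \<in> C. v \<notin> J c}" by (rule chains_cong_col) (use other in blast)
        then show "col v = (\<epsilon> \<noteq> odd (card {c \<in> C'. v \<notin> ?J c}))"
          using J'(3) J'(8)[OF v(1)] II(3)[of v] v other by (subst col_split) auto
      qed
      then show "K \<in> fixed_chains g C' T' \<epsilon> I"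
        unfolding K using J II(2) N unfolding fixed_chains_def un by (auto simp: ideals_def)
    qed
  qed
  then have "card (fixed_chains g C' T' \<epsilon> I) = card (SIGMA I':?U. fixed_chains g C T \<epsilon>' I')"
    by (rule bij_betw_same_card)
  also have "\<dots> = (\<Sum>I'\<in>?U. card (fixed_chains g C T \<epsilon>' I'))"
    using finite_up finite_chains[OF fin] by (subst card_SigmaI) (auto simp: fixed_chains_def)
  finally show ?thesis .
qed

text \<open>The value at \<open>g\<close> of the ribbon character with descent set \<open>S\<close>
  and switches \<open>C\<close>, for chains above \<open>I\<close> that start with parity
  \<epsilon>. Being a character value, it can be negative.\<close>

definition beta :: "nat set \<Rightarrow> nat set \<Rightarrow> bool \<Rightarrow> 'a set \<Rightarrow> int" where
  "beta S C \<epsilon> I = (\<Sum>T\<in>Pow S. (-1) ^ card (S - T) * int (card (fixed_chains g C T \<epsilon> I)))"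

lemma beta_start:
  assumes "finite S" "finite C" "\<And>d. d \<in> S \<union> C \<Longrightarrow> N < d" "I \<in> ideals"
  shows "beta S (insert N C) \<epsilon> I = (\<Sum>I' | I' \<in> up \<epsilon> I \<and> card I' = N. beta S C (\<not> \<epsilon>) I')"
proof -
  have "int (card (fixed_chains g (insert N C) T \<epsilon> I)) =
      (\<Sum>I' | I' \<in> up \<epsilon> I \<and> card I' = N. int (card (fixed_chains g C T (\<not> \<epsilon>) I')))" if "T \<subseteq> S" for T
  proof -
    have "card (fixed_chains g (insert N C) T \<epsilon> I) =
        (\<Sum>I' | I' \<in> up \<epsilon> I \<and> card I' = N. card (fixed_chains g C T (\<not> \<epsilon>) I'))"
      by (rule card_fixed_chains_split[where brk = True])
        (use assms that finite_subset[OF that assms(1)] in auto)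
    then show ?thesis by simp
  qed
  then show ?thesis unfolding beta_def
    by (simp add: sum_distrib_left sum.swap[of _ "Pow S"])
qed

text \<open>Subsets \<open>T\<close> containing \<open>N\<close> give the sum over the member of
  size \<open>N\<close>; for those omitting \<open>N\<close> the set \<open>S - T\<close> gains one
  element, which accounts for the minus sign.\<close>

lemma beta_dom:
  assumes "finite S" "finite C" "\<And>d. d \<in> S \<union> C \<Longrightarrow> N < d" "I \<in> ideals"
  shows "beta (insert N S) C \<epsilon> I = (\<Sum>I' | I' \<in> up \<epsilon> I \<and> card I' = N. beta S C \<epsilon> I') - beta S C \<epsilon> I"
proof -
  have N: "N \<notin> S" using assms(3) by blast
  have 1: "int (card (fixed_chains g C (insert N T) \<epsilon> I)) =
      (\<Sum>I' | I' \<in> up \<epsilon> I \<and> card I' = N. int (card (fixed_chains g C T \<epsilon> I')))" if "T \<subseteq> S" for T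
  proof -
    have "card (fixed_chains g C (insert N T) \<epsilon> I) =
        (\<Sum>I' | I' \<in> up \<epsilon> I \<and> card I' = N. card (fixed_chains g C T \<epsilon> I'))"
      by (rule card_fixed_chains_split[where brk = False])
        (use assms that finite_subset[OF that assms(1)] in auto)
    then show ?thesis by simp
  qed
  have "beta (insert N S) C \<epsilon> I =
      (\<Sum>T\<in>Pow S. (-1) ^ card (insert N S - T) * int (card (fixed_chains g C T \<epsilon> I))) +
      (\<Sum>T\<in>insert N ` Pow S. (-1) ^ card (insert N S - T) * int (card (fixed_chains g C T \<epsilon> I)))"
    unfolding beta_def Pow_insert using assms(1) N by (intro sum.union_disjoint) auto
  also have "(\<Sum>T\<in>insert N ` Pow S. (-1) ^ card (insert N S - T) * int (card (fixed_chains g C T \<epsilon> I))) =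
      (\<Sum>T\<in>Pow S. (-1) ^ card (insert N S - insert N T) * int (card (fixed_chains g C (insert N T) \<epsilon> I)))"
    using N by (subst sum.reindex) (auto simp: inj_on_def)
  also have "\<dots> = (\<Sum>T\<in>Pow S. (-1) ^ card (S - T) *
      (\<Sum>I' | I' \<in> up \<epsilon> I \<and> card I' = N. int (card (fixed_chains g C T \<epsilon> I'))))"
  proof (intro sum.cong refl)
    fix T assume "T \<in> Pow S"
    moreover have "insert N S - insert N T = S - T" using N by blast
    ultimately show "(-1) ^ card (insert N S - insert N T) * int (card (fixed_chains g C (insert N T) \<epsilon> I)) =
      (-1) ^ card (S - T) * (\<Sum>I' | I' \<in> up \<epsilon> I \<and> card I' = N. int (card (fixed_chains g C T \<epsilon> I')))"
      using 1 by simp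
  qed
  also have "\<dots> = (\<Sum>I' | I' \<in> up \<epsilon> I \<and> card I' = N. beta S C \<epsilon> I')"
    unfolding beta_def by (simp add: sum_distrib_left sum.swap[of _ "Pow S"])
  also have "(\<Sum>T\<in>Pow S. (-1) ^ card (insert N S - T) * int (card (fixed_chains g C T \<epsilon> I))) = - beta S C \<epsilon> I"
    unfolding beta_def sum_negf[symmetric]
  proof (intro sum.cong refl)
    fix T assume "T \<in> Pow S"
    then have "insert N S - T = insert N (S - T)" "N \<notin> S - T" using N by auto
    then show "(-1) ^ card (insert N S - T) * int (card (fixed_chains g C T \<epsilon> I)) =
        - ((-1) ^ card (S - T) * int (card (fixed_chains g C T \<epsilon> I)))"
      using assms(1) by simp
  qed
  finally show ?thesis by simp
qed

lemma beta_empty: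
  assumes "I \<in> ideals"
  shows "beta {} {} \<epsilon> I = (if P \<in> up \<epsilon> I then 1 else 0)"
proof -
  have "P \<in> up \<epsilon> I \<longleftrightarrow> (\<forall>v\<in>P - I. col v = \<epsilon>)"
    using P_ideal ideals_sub[OF assms] by (auto simp: up_def)
  then have "fixed_chains g {} {} \<epsilon> I = (if P \<in> up \<epsilon> I then {\<lambda>_. undefined} else {})"
    by (auto simp: fixed_chains_def chains_def)
  then show ?thesis by (simp add: beta_def)
qed

text \<open>The weighted sum over the words that fill the positions from \<open>N\<close> to
  \<open>card P - 1\<close> after \<open>I\<close>. At \<open>N = card P\<close> only the empty word
  is left; beyond that the value 0 expresses that a domino cannot reach over the end.\<close>

definition W :: "'a set \<Rightarrow> bool \<Rightarrow> nat \<Rightarrow> complex fps" where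
  "W I \<epsilon> N = (if N \<le> card P then
     \<Sum>w\<in>words (card P - N). weight \<epsilon> w * of_int (beta (doms N w) (starts N w) \<epsilon> I) else 0)"

text \<open>What may follow a member \<open>I\<close> of the chain at position
  \<open>card I\<close>: the end, a switch, or a domino. Of a domino only the positive part of
  \<open>beta_dom\<close> is counted here; the negative part does not use the member and stays in
  \<open>W_rec\<close>.\<close>

definition W_next :: "bool \<Rightarrow> 'a set \<Rightarrow> complex fps" where
  "W_next \<epsilon> I = (if I = P then 1 else 0) + (if \<epsilon> then fps_X else 1) * W I (\<not> \<epsilon>) (Suc (card I)) +
     fps_X * W I \<epsilon> (Suc (Suc (card I)))"

definition Q :: "'a set \<Rightarrow> bool \<Rightarrow> nat \<Rightarrow> complex fps" where
  "Q I \<epsilon> N = (\<Sum>I' | I' \<in> up \<epsilon> I \<and> card I' = N. W_next \<epsilon> I')"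

text \<open>Case distinction on the first tile. A single only moves the position; a switch and the
  positive part of a domino need a member of size \<open>N\<close> and form \<open>Q\<close>; the
  term with \<open>- fps_X\<close> is the negative part of a domino. At \<open>N = card P\<close>
  the summand 1 of \<open>W_next\<close> at \<open>P\<close> stands for the empty word.\<close>

lemma W_rec:
  assumes I: "I \<in> ideals" and N: "N \<le> card P"
  shows "W I \<epsilon> N = (1 + fps_X) * W I \<epsilon> (Suc N) - fps_X * W I \<epsilon> (Suc (Suc N)) + Q I \<epsilon> N"
proof (cases "N = card P")
  case True
  have "{I' \<in> up \<epsilon> I. card I' = N} = (if P \<in> up \<epsilon> I then {P} else {})"
    using True ideals_card_eq up_ideals by auto
  then show ?thesis using True beta_empty[OF I] by (simp add: W_def Q_def W_next_def)
next
  case False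
  define m where "m = card P - Suc N"
  have m: "card P - N = Suc m" using False N by (simp add: m_def)
  let ?U = "{I' \<in> up \<epsilon> I. card I' = N}"
  have fU: "finite ?U" using finite_up by simp
  let ?b = "\<lambda>N w \<epsilon> I. of_int (beta (doms N w) (starts N w) \<epsilon> I) :: complex fps"
  have s: "weight \<epsilon> (Switch # w) * ?b N (Switch # w) \<epsilon> I =
      (if \<epsilon> then fps_X else 1) * (\<Sum>I'\<in>?U. weight (\<not> \<epsilon>) w * ?b (Suc N) w (\<not> \<epsilon>) I')" for w
  proof -
    have "beta (doms (Suc N) w) (insert N (starts (Suc N) w)) \<epsilon> I =
        (\<Sum>I'\<in>?U. beta (doms (Suc N) w) (starts (Suc N) w) (\<not> \<epsilon>) I')"
      by (rule beta_start) (use I doms_ge starts_ge in \<open>fastforce simp: finite_doms finite_starts\<close>)+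
    then show ?thesis by (simp add: sum_distrib_left mult_ac)
  qed
  have d: "weight \<epsilon> (Domino # w) * ?b N (Domino # w) \<epsilon> I =
      fps_X * (\<Sum>I'\<in>?U. weight \<epsilon> w * ?b (Suc (Suc N)) w \<epsilon> I') - fps_X * (weight \<epsilon> w * ?b (Suc (Suc N)) w \<epsilon> I)" for w
  proof -
    have "beta (insert N (doms (Suc (Suc N)) w)) (starts (Suc (Suc N)) w) \<epsilon> I =
        (\<Sum>I'\<in>?U. beta (doms (Suc (Suc N)) w) (starts (Suc (Suc N)) w) \<epsilon> I') -
        beta (doms (Suc (Suc N)) w) (starts (Suc (Suc N)) w) \<epsilon> I"
      by (rule beta_dom) (use I doms_ge starts_ge in \<open>fastforce simp: finite_doms finite_starts\<close>)+
    then have "?b N (Domino # w) \<epsilon> I = (\<Sum>I'\<in>?U. ?b (Suc (Suc N)) w \<epsilon> I') - ?b (Suc (Suc N)) w \<epsilon> I"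
      by (simp only: doms.simps starts.simps of_int_diff of_int_sum)
    then show ?thesis by (simp only: weight.simps right_diff_distrib sum_distrib_left mult.assoc)
  qed
  have "(\<Sum>w\<in>words m. weight \<epsilon> (Switch # w) * ?b N (Switch # w) \<epsilon> I) =
      (\<Sum>I'\<in>?U. (if \<epsilon> then fps_X else 1) * W I' (\<not> \<epsilon>) (Suc N))"
  proof -
    have "W I' (\<not> \<epsilon>) (Suc N) = (\<Sum>w\<in>words m. weight (\<not> \<epsilon>) w * ?b (Suc N) w (\<not> \<epsilon>) I')" for I'
      using m by (simp add: W_def m_def)
    then show ?thesis unfolding s by (simp only: sum_distrib_left) (rule sum.swap)
  qed
  moreover have "(\<Sum>w\<in>words m. weight \<epsilon> (Single # w) * ?b N (Single # w) \<epsilon> I) = (1 + fps_X) * W I \<epsilon> (Suc N)"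
    using m by (simp add: W_def m_def sum_distrib_left mult_ac)
  moreover have "(if m = 0 then 0 else \<Sum>w\<in>words (m - 1). weight \<epsilon> (Domino # w) * ?b N (Domino # w) \<epsilon> I) =
      (\<Sum>I'\<in>?U. fps_X * W I' \<epsilon> (Suc (Suc N))) - fps_X * W I \<epsilon> (Suc (Suc N))"
  proof (cases "m = 0")
    case True
    then have "W I' \<epsilon> (Suc (Suc N)) = 0" for I' using m by (simp add: W_def)
    then show ?thesis using True by simp
  next
    case False
    then have W2: "W I' \<epsilon> (Suc (Suc N)) = (\<Sum>w\<in>words (m - 1). weight \<epsilon> w * ?b (Suc (Suc N)) w \<epsilon> I')" for I'
      using m by (auto simp: W_def m_def)
    show ?thesis unfolding if_not_P[OF False] d W2 sum_subtractf
      by (simp only: sum_distrib_left) (subst sum.swap, rule refl)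
  qed
  moreover have "Q I \<epsilon> N = (\<Sum>I'\<in>?U. (if \<epsilon> then fps_X else 1) * W I' (\<not> \<epsilon>) (Suc N)) +
      (\<Sum>I'\<in>?U. fps_X * W I' \<epsilon> (Suc (Suc N)))"
    unfolding Q_def sum.distrib[symmetric] by (intro sum.cong refl) (use False in \<open>auto simp: W_next_def\<close>)
  moreover have "W I \<epsilon> N = (\<Sum>w\<in>words (Suc m). weight \<epsilon> w * ?b N w \<epsilon> I)"
    using N m by (simp add: W_def)
  ultimately show ?thesis unfolding sum_words_Suc by (simp add: algebra_simps)
qed

text \<open>The coefficients \<open>1 + X + \<dots> + X\<^sup>k\<close> solve the homogeneous recursion.\<close>

lemma W_green:
  assumes I: "I \<in> ideals"
  shows "(1 - fps_X) * W I \<epsilon> N = (\<Sum>M\<in>{N..card P}. (1 - fps_X ^ Suc (M - N)) * Q I \<epsilon> M)"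
proof (induction "card P - N" arbitrary: N rule: less_induct)
  case less
  show ?case
  proof (cases "N \<le> card P")
    case False
    then show ?thesis by (simp add: W_def)
  next
    case True
    have g: "(1 - fps_X) * W I \<epsilon> N' = (\<Sum>M\<in>{N'..card P}. (1 - fps_X ^ Suc (M - N')) * Q I \<epsilon> M)" if "N < N'" for N'
    proof (cases "N' \<le> card P")
      case True
      then show ?thesis using that by (intro less) auto
    next
      case False
      then show ?thesis by (simp add: W_def)
    qed
    let ?S = "{Suc N..card P}"
    have g1: "(1 - fps_X) * W I \<epsilon> (Suc N) = (\<Sum>M\<in>?S. (1 - fps_X ^ (M - N)) * Q I \<epsilon> M)"
      unfolding g[OF lessI] by (intro sum.cong refl) (auto simp: Suc_diff_Suc)
    have "(1 - fps_X) * W I \<epsilon> (Suc (Suc N)) = (\<Sum>M\<in>{Suc (Suc N)..card P}. (1 - fps_X ^ (M - Suc N)) * Q I \<epsilon> M)"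
      by (subst g) (auto intro!: sum.cong simp: Suc_diff_Suc)
    also have "\<dots> = (\<Sum>M\<in>?S. (1 - fps_X ^ (M - Suc N)) * Q I \<epsilon> M)"
      by (rule sum.mono_neutral_left) (auto simp: not_less_eq_eq le_antisym)
    finally have g2: "(1 - fps_X) * W I \<epsilon> (Suc (Suc N)) = (\<Sum>M\<in>?S. (1 - fps_X ^ (M - Suc N)) * Q I \<epsilon> M)" .
    have "(1 - fps_X) * W I \<epsilon> N = (1 + fps_X) * ((1 - fps_X) * W I \<epsilon> (Suc N)) -
        fps_X * ((1 - fps_X) * W I \<epsilon> (Suc (Suc N))) + (1 - fps_X) * Q I \<epsilon> N"
      unfolding W_rec[OF I True] by (simp add: algebra_simps)
    also have "\<dots> = (\<Sum>M\<in>?S. (1 - fps_X ^ Suc (M - N)) * Q I \<epsilon> M) + (1 - fps_X) * Q I \<epsilon> N"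
      unfolding g1 g2 sum_distrib_left sum_subtractf[symmetric]
    proof (intro arg_cong2[where f = "(+)"] sum.cong refl)
      fix M assume "M \<in> ?S"
      then obtain k where k: "M - N = Suc k" "M - Suc N = k" by (metis Suc_diff_Suc Suc_le_lessD atLeastAtMost_iff diff_Suc_eq_diff_pred)
      show "(1 + fps_X) * ((1 - fps_X ^ (M - N)) * Q I \<epsilon> M) - fps_X * ((1 - fps_X ^ (M - Suc N)) * Q I \<epsilon> M) =
          (1 - fps_X ^ Suc (M - N)) * Q I \<epsilon> M"
        unfolding k by (simp add: algebra_simps)
    qed
    also have "\<dots> = (\<Sum>M\<in>{N..card P}. (1 - fps_X ^ Suc (M - N)) * Q I \<epsilon> M)"
      using True by (simp add: sum.atLeast_Suc_atMost add.commute)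
    finally show ?thesis .
  qed
qed

lemma W_sum_up:
  assumes I: "I \<in> ideals"
  shows "(1 - fps_X) * W I \<epsilon> N = (\<Sum>I' | I' \<in> up \<epsilon> I \<and> N \<le> card I'. (1 - fps_X ^ Suc (card I' - N)) * W_next \<epsilon> I')"
proof -
  have "(1 - fps_X) * W I \<epsilon> N =
      (\<Sum>M\<in>{N..card P}. \<Sum>I'\<in>{I' \<in> {I' \<in> up \<epsilon> I. N \<le> card I'}. card I' = M}. (1 - fps_X ^ Suc (card I' - N)) * W_next \<epsilon> I')"
    unfolding W_green[OF I] Q_def sum_distrib_left by (intro sum.cong refl) auto
  also have "\<dots> = (\<Sum>I' | I' \<in> up \<epsilon> I \<and> N \<le> card I'. (1 - fps_X ^ Suc (card I' - N)) * W_next \<epsilon> I')"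
    by (rule sum.group) (use finite_up up_ideals ideals_card in auto)
  finally show ?thesis .
qed

text \<open>At \<open>I' = I\<close> the coefficient is 1 - 1 = 0, so the sum may run over all of
  \<open>up\<close>. Hence this equation never involves \<open>W_next\<close> at \<open>I\<close>
  itself.\<close>

lemma W_up1:
  assumes I: "I \<in> ideals"
  shows "(1 - fps_X) * W I \<epsilon> (Suc (card I)) = (\<Sum>I'\<in>up \<epsilon> I. (1 - fps_X ^ (card I' - card I)) * W_next \<epsilon> I')"
proof -
  have "(1 - fps_X) * W I \<epsilon> (Suc (card I)) =
      (\<Sum>I' | I' \<in> up \<epsilon> I \<and> Suc (card I) \<le> card I'. (1 - fps_X ^ (card I' - card I)) * W_next \<epsilon> I')"
    unfolding W_sum_up[OF I] by (intro sum.cong refl) (auto simp: Suc_diff_Suc)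
  also have "\<dots> = (\<Sum>I'\<in>up \<epsilon> I. (1 - fps_X ^ (card I' - card I)) * W_next \<epsilon> I')"
    by (rule sum.mono_neutral_left) (use finite_up in \<open>auto simp: not_less_eq_eq\<close>)
  finally show ?thesis .
qed

text \<open>Down-sets with exactly one more element drop out by themselves, since X - X^1 = 0. For
  \<open>I\<close> the coefficient would be X - 1, so it has to be removed; it returns as a
  correction term in \<open>W_eq_transfer\<close>.\<close>

lemma W_up2:
  assumes I: "I \<in> ideals"
  shows "(1 - fps_X) * (fps_X * W I \<epsilon> (Suc (Suc (card I)))) =
    (\<Sum>I'\<in>up \<epsilon> I - {I}. (fps_X - fps_X ^ (card I' - card I)) * W_next \<epsilon> I')"
proof -
  have "(1 - fps_X) * (fps_X * W I \<epsilon> (Suc (Suc (card I)))) = fps_X * ((1 - fps_X) * W I \<epsilon> (Suc (Suc (card I))))"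
    by (simp add: algebra_simps)
  also have "\<dots> = (\<Sum>I' | I' \<in> up \<epsilon> I \<and> Suc (Suc (card I)) \<le> card I'. (fps_X - fps_X ^ (card I' - card I)) * W_next \<epsilon> I')"
    unfolding W_sum_up[OF I] sum_distrib_left
  proof (intro sum.cong refl)
    fix I' assume "I' \<in> {I' \<in> up \<epsilon> I. Suc (Suc (card I)) \<le> card I'}"
    then obtain k where k: "card I' - Suc (Suc (card I)) = k" "card I' - card I = Suc (Suc k)"
      by (auto simp: le_iff_add)
    show "fps_X * ((1 - fps_X ^ Suc (card I' - Suc (Suc (card I)))) * W_next \<epsilon> I') =
        (fps_X - fps_X ^ (card I' - card I)) * W_next \<epsilon> I'"
      unfolding k by (simp add: algebra_simps)
  qed
  also have "\<dots> = (\<Sum>I'\<in>up \<epsilon> I - {I}. (fps_X - fps_X ^ (card I' - card I)) * W_next \<epsilon> I')"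
  proof (rule sum.mono_neutral_left)
    show "\<forall>I'\<in>up \<epsilon> I - {I} - {I' \<in> up \<epsilon> I. Suc (Suc (card I)) \<le> card I'}.
        (fps_X - fps_X ^ (card I' - card I)) * W_next \<epsilon> I' = 0"
    proof
      fix I' assume I': "I' \<in> up \<epsilon> I - {I} - {I' \<in> up \<epsilon> I. Suc (Suc (card I)) \<le> card I'}"
      then have "card I \<le> card I'" "card I' \<noteq> card I" "\<not> Suc (Suc (card I)) \<le> card I'"
        using up_card up_card_eq by blast+
      then have "card I' - card I = 1" by simp
      then show "(fps_X - fps_X ^ (card I' - card I)) * W_next \<epsilon> I' = 0" by simp
    qed
  qed (use finite_up in auto)
  finally show ?thesis .
qed

end

section \<open>Signed weights\<close>

lemma sign_cycle_of_list:
  "distinct cs \<Longrightarrow> cs \<noteq> [] \<Longrightarrow> sign (cycle_of_list cs) = (-1) ^ (length cs - 1)"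
proof (induction cs rule: cycle_of_list.induct)
  case (1 i j cs)
  have "sign (cycle_of_list (i # j # cs)) = sign (transpose i j) * sign (cycle_of_list (j # cs))"
    unfolding cycle_of_list.simps by (rule sign_compose[OF permutation_swap_id permutation_of_cycle])
  then show ?case using 1 by (simp add: sign_swap_id del: cycle_of_list.simps)
qed (auto simp del: sign_id simp: sign_id[unfolded id_def] id_def)

text \<open>For an invariant set \<open>A\<close> this is (-1) to the number of cycles of
  \<open>g\<close> on \<open>A\<close>, because a cycle of length l contributes (-1)^l (-1)^(l - 1)
  = -1. It is also the signed principal minor that \<open>A\<close> contributes to det(1 - X
  g).\<close>

definition signed_weight :: "('a \<Rightarrow> 'a) \<Rightarrow> 'a set \<Rightarrow> int" where
  "signed_weight g A = (-1) ^ card A * sign (restrict_id g A)"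

lemma signed_weight_empty [simp]: "signed_weight g {} = 1"
proof -
  have "restrict_id g {} = id" by (auto simp: restrict_id_def)
  then show ?thesis by (simp add: signed_weight_def)
qed

lemma restrict_id_permutation:
  assumes "finite A" "inj_on g A" "g ` A = A"
  shows "restrict_id g A permutes A" "permutation (restrict_id g A)"
proof -
  show "restrict_id g A permutes A"
    by (rule permutes_restrict_id) (use assms in \<open>simp add: bij_betw_def\<close>)
  then show "permutation (restrict_id g A)"
    using assms(1) permutation_permutes by blast
qed

lemma signed_weight_Un:
  assumes "finite A" "finite B" "inj_on g A" "inj_on g B" "g ` A = A" "g ` B = B" "A \<inter> B = {}"
  shows "signed_weight g (A \<union> B) = signed_weight g A * signed_weight g B"
proof -
  have "restrict_id g (A \<union> B) = restrict_id g A \<circ> restrict_id g B"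
    using assms(5-7) by (auto simp: restrict_id_def fun_eq_iff)
  moreover have "sign (restrict_id g A \<circ> restrict_id g B) = sign (restrict_id g A) * sign (restrict_id g B)"
    using restrict_id_permutation(2) assms by (intro sign_compose) auto
  ultimately show ?thesis
    using assms by (simp add: signed_weight_def card_Un_disjoint power_add)
qed

text \<open>Adding or removing the cycle of \<open>g\<close> through a chosen \<open>a \<in> B\<close> reverses the sign.\<close>

lemma sum_signed_weight:
  assumes fin: "finite B" and inj: "inj_on g B" and inv: "g ` B = B" and ne: "B \<noteq> {}"
  shows "(\<Sum>A | A \<subseteq> B \<and> g ` A = A. signed_weight g A) = 0"
proof -
  obtain a where a: "a \<in> B" using ne by blast
  define p where "p = restrict_id g B"
  have p: "p permutes B" "permutation p"
    using restrict_id_permutation[OF fin inj inv] by (auto simp: p_def)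
  define cs where "cs = support p a"
  define c where "c = set cs"
  have c_range: "c = range (\<lambda>i. (p ^^ i) a)" unfolding c_def cs_def by (rule support_set[OF p(2)])
  have ac: "a \<in> c" unfolding c_range by (rule range_eqI[of _ _ 0]) simp
  \<comment> \<open>An invariant subset containing \<open>a\<close> contains the whole cycle
    \<open>c\<close>, so that removing and adding \<open>c\<close> are inverse to each other on
    invariant subsets.\<close>
  have c_least: "c \<subseteq> A" if "A \<subseteq> B" "g ` A = A" "a \<in> A" for A
  proof -
    have "(p ^^ i) a \<in> A" for i
      by (induction i) (use that in \<open>auto simp: p_def restrict_id_def\<close>)
    then show ?thesis by (auto simp: c_range)
  qed
  have cB: "c \<subseteq> B" by (rule c_least) (use inv a in auto)
  have inv_diff: "g ` (A - A') = A - A'" if "A \<subseteq> B" "g ` A = A" "A' \<subseteq> A" "g ` A' = A'" for A A'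
    using that inj_on_image_set_diff[OF inj_on_subset[OF inj that(1)], of A A'] by auto
  have gc: "g ` c = c"
  proof -
    have cyc: "p x = cycle_of_list cs x" if "x \<in> c" for x
      using cycle_restrict[OF p(2), of x a] that by (simp add: c_def cs_def)
    have "g ` c = p ` c" using cB by (intro image_cong) (auto simp: p_def subset_iff)
    also have "\<dots> = cycle_of_list cs ` c" using cyc by auto
    also have "\<dots> = c" unfolding c_def by (rule permutes_image[OF cycle_permutes])
    finally show ?thesis .
  qed
  have finc: "finite c" by (simp add: c_def)
  have dcs: "distinct cs" unfolding cs_def by (rule cycle_of_permutation[OF p(2)])
  have "restrict_id g c = cycle_of_list cs"
  proof
    fix x
    show "restrict_id g c x = cycle_of_list cs x"
    proof (cases "x \<in> c")
      case True
      then have "cycle_of_list cs x = p x"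
        using cycle_restrict[OF p(2), of x a] by (simp add: c_def cs_def)
      also have "\<dots> = g x" using True cB by (auto simp: p_def)
      finally show ?thesis using True by simp
    next
      case False
      then show ?thesis using id_outside_supp[of x cs] by (simp add: c_def)
    qed
  qed
  moreover have "cs \<noteq> []" using ac by (auto simp: c_def)
  ultimately have sc: "signed_weight g c = -1"
    using sign_cycle_of_list[OF dcs] distinct_card[OF dcs]
    by (cases cs) (auto simp: signed_weight_def c_def simp flip: power_mult_distrib)
  let ?S = "{A. A \<subseteq> B \<and> g ` A = A}"
  have finS: "finite ?S" using fin by (auto intro: finite_subset[of _ "Pow B"])
  have "(\<Sum>A\<in>{A \<in> ?S. a \<in> A}. signed_weight g A) = (\<Sum>A\<in>{A \<in> ?S. a \<notin> A}. - signed_weight g A)"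
  proof (rule sum.reindex_bij_witness[of _ "\<lambda>A. A \<union> c" "\<lambda>A. A - c"])
    fix A assume A: "A \<in> {A \<in> ?S. a \<in> A}"
    then have cA: "c \<subseteq> A" by (intro c_least) auto
    then show "A - c \<union> c = A" by blast
    show "A - c \<in> {A \<in> ?S. a \<notin> A}" using A inv_diff[of A c] cA gc ac by auto
    have "signed_weight g (A - c \<union> c) = signed_weight g (A - c) * signed_weight g c"
    proof (rule signed_weight_Un)
      show "finite (A - c)" using A fin finite_subset by auto
      show "inj_on g (A - c)" "inj_on g c" using A cB inj by (auto intro: inj_on_subset)
      show "g ` (A - c) = A - c" using A inv_diff[of A c] cA gc by auto
    qed (use finc gc in auto)
    then show "- signed_weight g (A - c) = signed_weight g A"
      using sc cA by (simp add: Un_absorb2)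
  next
    fix A assume A: "A \<in> {A \<in> ?S. a \<notin> A}"
    have "c \<subseteq> B - A"
      by (rule c_least) (use A inv_diff[of B A] inv a in auto)
    then show "A \<union> c - c = A" by blast
    show "A \<union> c \<in> {A \<in> ?S. a \<in> A}" using A ac cB gc by (auto simp: image_Un)
  qed
  moreover have "(\<Sum>A\<in>?S. signed_weight g A) =
      (\<Sum>A\<in>{A \<in> ?S. a \<in> A}. signed_weight g A) + (\<Sum>A\<in>{A \<in> ?S. a \<notin> A}. signed_weight g A)"
    by (subst sum.union_disjoint[symmetric]) (auto intro: sum.cong finite_subset[OF _ finS])
  ultimately show ?thesis by (simp add: sum_negf)
qed

section \<open>Determinants det(1 - X g) and intervals of invariant down-sets\<close>

context parity_poset_aut
begin

definition invsubs :: "'a set \<Rightarrow> 'a set set" where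
  "invsubs B = {A. A \<subseteq> B \<and> g ` A = A}"

text \<open>For an invariant \<open>B\<close> this is det(1 - X g) on the functions on
  \<open>B\<close>, expanded in principal minors, and hence the product of 1 - X^l over the cycle
  lengths l of \<open>g\<close> on \<open>B\<close>.\<close>

definition wgt :: "'a set \<Rightarrow> complex fps" where
  "wgt B = (\<Sum>A\<in>invsubs B. of_int (signed_weight g A) * fps_X ^ card A)"

lemma g_inj: "A \<subseteq> P \<Longrightarrow> inj_on g A"
  using rank_autD(2)[OF g_aut] inj_on_subset by blast

lemma finite_invsubs: "finite B \<Longrightarrow> finite (invsubs B)"
  by (rule finite_subset[of _ "Pow B"]) (auto simp: invsubs_def)

lemma invsubs_Diff: "B \<subseteq> P \<Longrightarrow> g ` B = B \<Longrightarrow> A \<in> invsubs B \<Longrightarrow> B - A \<in> invsubs B"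
  using inj_on_image_set_diff[OF g_inj, of B B A] by (auto simp: invsubs_def)

lemma wgt_empty: "wgt {} = 1"
proof -
  have "invsubs {} = {{}}" by (auto simp: invsubs_def)
  then show ?thesis by (simp add: wgt_def)
qed

lemma wgt_Un:
  assumes B: "B \<subseteq> P" "B' \<subseteq> P" "g ` B = B" "g ` B' = B'" "B \<inter> B' = {}"
  shows "wgt (B \<union> B') = wgt B * wgt B'"
proof -
  have fin: "finite B" "finite B'" using finite_subset[OF B(1) finite_P] finite_subset[OF B(2) finite_P] by auto
  let ?f = "\<lambda>A. of_int (signed_weight g A) * fps_X ^ card A :: complex fps"
  have "wgt B * wgt B' = (\<Sum>(A, A')\<in>invsubs B \<times> invsubs B'. ?f A * ?f A')"
    unfolding wgt_def sum_product sum.cartesian_product ..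
  also have "\<dots> = (\<Sum>A\<in>invsubs (B \<union> B'). ?f A)"
  proof (rule sum.reindex_bij_witness[of _ "\<lambda>A. (A \<inter> B, A \<inter> B')" "\<lambda>(A, A'). A \<union> A'"])
    fix A assume "A \<in> invsubs (B \<union> B')"
    then have A: "A \<subseteq> B \<union> B'" "g ` A = A" by (auto simp: invsubs_def)
    then have AP: "A \<subseteq> P" using B by blast
    have "g ` (A \<inter> C) = A \<inter> C" if "C \<subseteq> P" "g ` C = C" for C
      using inj_on_image_Int[OF g_inj[of P], of A C] AP A(2) that by auto
    then show "(A \<inter> B, A \<inter> B') \<in> invsubs B \<times> invsubs B'"
      using B by (auto simp: invsubs_def)
    show "(case (A \<inter> B, A \<inter> B') of (A, A') \<Rightarrow> A \<union> A') = A" using A by auto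
  next
    fix q assume "q \<in> invsubs B \<times> invsubs B'"
    then obtain A A' where q: "q = (A, A')" "A \<subseteq> B" "A' \<subseteq> B'" "g ` A = A" "g ` A' = A'"
      by (auto simp: invsubs_def)
    have disj: "A \<inter> A' = {}" using q B by blast
    have finA: "finite A" "finite A'" using finite_subset[OF q(2) fin(1)] finite_subset[OF q(3) fin(2)] by auto
    show "(case q of (A, A') \<Rightarrow> A \<union> A') \<in> invsubs (B \<union> B')"
      using q by (auto simp: invsubs_def image_Un)
    show "((case q of (A, A') \<Rightarrow> A \<union> A') \<inter> B, (case q of (A, A') \<Rightarrow> A \<union> A') \<inter> B') = q"
      using q B by auto
    have "signed_weight g (A \<union> A') = signed_weight g A * signed_weight g A'"
      using finA q B disj by (intro signed_weight_Un g_inj) auto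
    then show "?f (case q of (A, A') \<Rightarrow> A \<union> A') = (case q of (A, A') \<Rightarrow> ?f A * ?f A')"
      using finA disj by (simp add: q card_Un_disjoint power_add mult_ac)
  qed
  finally show ?thesis unfolding wgt_def[of "B \<union> B'"] by simp
qed

text \<open>Otherwise the first cover \<open>z\<close> above \<open>y\<close> on the way to
  \<open>x\<close> would lie in \<open>I' - I\<close> together with \<open>y\<close>, although its
  parity is the opposite one.\<close>

lemma no_same_parity_pair:
  assumes I: "I \<in> ideals" and I': "I' \<in> up \<epsilon> I" and xy: "x \<in> I' - I" "(y, x) \<in> r" "y \<notin> I"
  shows "y = x"
proof (rule ccontr)
  assume "y \<noteq> x"
  then obtain z where z: "covers P r y z" "(z, x) \<in> r" using cover_below[OF xy(2)] by blast
  have yz: "(y, z) \<in> r" using z(1) by (simp add: covers_def)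
  have "y \<in> I'" "z \<in> I'" using I' xy z unfolding up_def ideals_def downset_def by blast+
  moreover have "z \<notin> I" using I xy(3) yz unfolding ideals_def downset_def by blast
  ultimately have "col y = \<epsilon>" "col z = \<epsilon>" using I' xy(3) by (auto simp: up_def)
  then show False using rank_covers[OF z(1)] by (auto simp: col_def)
qed

text \<open>Within a run no element waits for another one, so any invariant part of the run can be
  added first. The interval from \<open>I\<close> to \<open>I'\<close> in \<open>up\<close> is thus
  the Boolean lattice on the cycles of \<open>g\<close> in \<open>I' - I\<close>.\<close>

lemma up_Un_invsub:
  assumes I: "I \<in> ideals" and I': "I' \<in> up \<epsilon> I" and D: "D \<in> invsubs (I' - I)"
  shows "I \<union> D \<in> up \<epsilon> I" "I' \<in> up \<epsilon> (I \<union> D)"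
proof -
  have D': "D \<subseteq> I' - I" "g ` D = D" using D by (auto simp: invsubs_def)
  have I'': "I \<subseteq> I'" "I' \<in> ideals" "\<And>v. v \<in> I' - I \<Longrightarrow> col v = \<epsilon>" using I' by (auto simp: up_def)
  have "downset (I \<union> D)" unfolding downset_def
  proof (intro conjI ballI allI impI)
    show "I \<union> D \<subseteq> P" using ideals_sub[OF I] ideals_sub[OF I''(2)] D' by blast
    fix x y assume x: "x \<in> I \<union> D" and yx: "(y, x) \<in> r"
    show "y \<in> I \<union> D"
    proof (cases "y \<in> I")
      case False
      then have "x \<notin> I" using I yx unfolding ideals_def downset_def by blast
      then have "x \<in> I' - I" using x D' by blast
      then have "y = x" using no_same_parity_pair[OF I I' _ yx False] by blast
      then show ?thesis using x by simp
    qed simp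
  qed
  moreover have "g ` (I \<union> D) = I \<union> D" using I D' by (auto simp: ideals_def image_Un)
  ultimately have id: "I \<union> D \<in> ideals" by (simp add: ideals_def)
  then show "I \<union> D \<in> up \<epsilon> I" using I''(3) D' by (auto simp: up_def)
  show "I' \<in> up \<epsilon> (I \<union> D)" using I'' D' by (auto simp: up_def)
qed

lemma ideals_Diff_inv: "I \<in> ideals \<Longrightarrow> I' \<in> ideals \<Longrightarrow> I \<subseteq> I' \<Longrightarrow> g ` (I' - I) = I' - I"
  using inj_on_image_set_diff[OF g_inj[of I'], of I' I] ideals_sub[of I'] by (auto simp: ideals_def)

text \<open>Two consecutive steps amount to their end \<open>I''\<close> and the invariant set
  \<open>D\<close> added first. Products of matrices along \<open>up\<close> thereby turn into sums
  over the invariant subsets of one set, to which \<open>sum_signed_weight\<close> applies.\<close>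

lemma up_up_sum:
  fixes h :: "'a set \<Rightarrow> 'a set \<Rightarrow> 'b::comm_monoid_add"
  assumes I: "I \<in> ideals"
  shows "(\<Sum>I'\<in>up \<epsilon> I. \<Sum>I''\<in>up \<epsilon> I'. h I' I'') =
    (\<Sum>I''\<in>up \<epsilon> I. \<Sum>D\<in>invsubs (I'' - I). h (I \<union> D) I'')"
proof -
  have finD: "finite (invsubs (I'' - I))" if "I'' \<in> up \<epsilon> I" for I''
    using finite_ideal[OF up_ideals[OF that]] by (intro finite_invsubs) auto
  have "(\<Sum>I'\<in>up \<epsilon> I. \<Sum>I''\<in>up \<epsilon> I'. h I' I'') = (\<Sum>(I', I'')\<in>(SIGMA I':up \<epsilon> I. up \<epsilon> I'). h I' I'')"
    by (rule sum.Sigma) (auto simp: finite_up)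
  also have "\<dots> = (\<Sum>(I'', D)\<in>(SIGMA I'':up \<epsilon> I. invsubs (I'' - I)). h (I \<union> D) I'')"
  proof (rule sum.reindex_bij_witness[of _ "\<lambda>(I'', D). (I \<union> D, I'')" "\<lambda>(I', I''). (I'', I' - I)"])
    fix q assume "q \<in> (SIGMA I':up \<epsilon> I. up \<epsilon> I')"
    then obtain I' I'' where q: "q = (I', I'')" "I' \<in> up \<epsilon> I" "I'' \<in> up \<epsilon> I'" by blast
    have sub: "I \<subseteq> I'" "I' \<subseteq> I''" using q by (auto simp: up_def)
    show "(case case q of (I', I'') \<Rightarrow> (I'', I' - I) of (I'', D) \<Rightarrow> (I \<union> D, I'')) = q"
      using q sub by auto
    show "(case q of (I', I'') \<Rightarrow> (I'', I' - I)) \<in> (SIGMA I'':up \<epsilon> I. invsubs (I'' - I))"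
      using q sub ideals_Diff_inv[OF I up_ideals[OF q(2)] sub(1)] by (auto simp: up_def invsubs_def)
    show "(case case q of (I', I'') \<Rightarrow> (I'', I' - I) of (I'', D) \<Rightarrow> h (I \<union> D) I'') = (case q of (I', I'') \<Rightarrow> h I' I'')"
      using q sub by (simp add: Un_absorb1)
  next
    fix q assume "q \<in> (SIGMA I'':up \<epsilon> I. invsubs (I'' - I))"
    then obtain I'' D where q: "q = (I'', D)" "I'' \<in> up \<epsilon> I" "D \<in> invsubs (I'' - I)" by blast
    then show "(case case q of (I'', D) \<Rightarrow> (I \<union> D, I'') of (I', I'') \<Rightarrow> (I'', I' - I)) = q"
      by (auto simp: invsubs_def)
    show "(case q of (I'', D) \<Rightarrow> (I \<union> D, I'')) \<in> (SIGMA I':up \<epsilon> I. up \<epsilon> I')"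
      using up_Un_invsub[OF I q(2,3)] q by simp
  qed
  also have "\<dots> = (\<Sum>I''\<in>up \<epsilon> I. \<Sum>D\<in>invsubs (I'' - I). h (I \<union> D) I'')"
    by (rule sum.Sigma[symmetric]) (use finite_up finD in auto)
  finally show ?thesis .
qed

lemma sum_invsubs_swap:
  fixes h :: "'a set \<Rightarrow> 'a set \<Rightarrow> 'b::comm_monoid_add"
  assumes "B \<subseteq> P" "g ` B = B"
  shows "(\<Sum>D\<in>invsubs B. h D (B - D)) = (\<Sum>D\<in>invsubs B. h (B - D) D)"
  by (rule sum.reindex_bij_witness[of _ "\<lambda>D. B - D" "\<lambda>D. B - D"])
    (use invsubs_Diff[OF assms] in \<open>auto simp: invsubs_def double_diff\<close>)

text \<open>If \<open>H\<^sub>\<epsilon>\<close> is the incidence matrix of \<open>up \<epsilon>\<close> and \<open>H\<^sub>\<epsilon>(X)\<close> is its version graded by the number of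
  added elements, then pointwise multiplication of \<open>H\<^sub>\<epsilon>\<close> by the multiplicative function \<open>wgt\<close> gives
  \<open>H\<^sub>\<epsilon> H\<^sub>\<epsilon>(X)\<^sup>-\<^sup>1\<close>; this turns the recursion for \<open>W\<close> into the transfer recursion for \<open>y\<close>.\<close>

lemma W_eq_transfer:
  fixes y :: "bool \<Rightarrow> 'a set \<Rightarrow> complex fps"
  assumes y0: "\<And>I. I \<in> ideals \<Longrightarrow> y False I = (\<Sum>I'\<in>up False I. y True I')"
    and y1: "\<And>I. I \<in> ideals \<Longrightarrow> y True I = (\<Sum>I'\<in>up True I. (if I' = P then 1 else 0) + fps_X * y False I')"
    and min: "up True {} = {{}}" and ne: "P \<noteq> {}"
  shows "W {} False (Suc 0) = (1 - fps_X) * wgt P * y False {}"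
proof -
  define e where "e I = (if I = P then 1 else 0 :: complex fps)" for I
  define yh where "yh \<epsilon> I = (1 - fps_X) * wgt (P - I) * y \<epsilon> I" for \<epsilon> I
  \<comment> \<open>\<open>z\<close> is the input of one transfer step after normalisation by
    \<open>(1 - fps_X) * wgt (P - I)\<close>: by multiplicativity of \<open>wgt\<close>, a step from
    \<open>I\<close> to \<open>I'\<close> is then weighted by \<open>wgt (I' - I)\<close>, as
    \<open>yh_eq\<close> states. The boundary term needs no further factor, since
    \<open>wgt {} = 1\<close>.\<close>
  define z where "z \<epsilon> I = (if \<epsilon> then (1 - fps_X) * e I + fps_X * yh False I else yh True I)" for \<epsilon> I
  define s where "s D = (of_int (signed_weight g D) * fps_X ^ card D :: complex fps)" for D :: "'a set"
  \<comment> \<open>The signed monomials \<open>s\<close> are the entries of the inverse of the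
    incidence matrix graded by size, so this is that inverse applied to \<open>z\<close>.
    \<open>HtAs\<close> confirms the inversion, and \<open>HAs\<close> shows that the ungraded
    matrix takes the result to \<open>yh\<close>.\<close>
  define As where "As \<epsilon> I = (\<Sum>I'\<in>up \<epsilon> I. s (I' - I) * z \<epsilon> I')" for \<epsilon> I
  have wgt_s: "wgt B = (\<Sum>D\<in>invsubs B. s D)" for B by (simp add: wgt_def s_def)
  have wgt_mult: "wgt (P - I) = wgt (I' - I) * wgt (P - I')" if "I \<in> ideals" "I' \<in> up \<epsilon> I" for I I' \<epsilon>
  proof -
    have I': "I \<subseteq> I'" "I' \<in> ideals" using that by (auto simp: up_def)
    have "P - I = (I' - I) \<union> (P - I')" using ideals_sub[OF I'(2)] I' by blast
    then show ?thesis
      using wgt_Un[of "I' - I" "P - I'"] ideals_Diff_inv[OF that(1) I'(2,1)]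
        ideals_Diff_inv[OF I'(2) P_ideal ideals_sub[OF I'(2)]] ideals_sub[OF I'(2)] by auto
  qed
  have yh_eq: "yh \<epsilon> I = (\<Sum>I'\<in>up \<epsilon> I. wgt (I' - I) * z \<epsilon> I')" if I: "I \<in> ideals" for \<epsilon> I
  proof (cases \<epsilon>)
    case True
    have "yh True I = (\<Sum>I'\<in>up True I. (1 - fps_X) * wgt (P - I) * (e I' + fps_X * y False I'))"
      unfolding yh_def y1[OF I] sum_distrib_left by (simp add: e_def)
    also have "\<dots> = (\<Sum>I'\<in>up True I. wgt (I' - I) * z True I')"
    proof (intro sum.cong refl)
      fix I' assume I': "I' \<in> up True I"
      show "(1 - fps_X) * wgt (P - I) * (e I' + fps_X * y False I') = wgt (I' - I) * z True I'"
        unfolding wgt_mult[OF I I'] z_def yh_def e_def by (simp add: algebra_simps wgt_empty)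
    qed
    finally show ?thesis using True by simp
  next
    case False
    have "yh False I = (\<Sum>I'\<in>up False I. (1 - fps_X) * wgt (P - I) * y True I')"
      unfolding yh_def y0[OF I] sum_distrib_left ..
    also have "\<dots> = (\<Sum>I'\<in>up False I. wgt (I' - I) * z False I')"
      by (intro sum.cong refl) (simp add: wgt_mult[OF I] z_def yh_def mult_ac)
    finally show ?thesis using False by simp
  qed
  have split: "I' - (I \<union> D) = (I' - I) - D" for I I' D :: "'a set" by blast
  have HtAs: "(\<Sum>I'\<in>up \<epsilon> I. fps_X ^ (card I' - card I) * As \<epsilon> I') = z \<epsilon> I" if I: "I \<in> ideals" for \<epsilon> I
  proof -
    have "(\<Sum>I'\<in>up \<epsilon> I. fps_X ^ (card I' - card I) * As \<epsilon> I') =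
        (\<Sum>I'\<in>up \<epsilon> I. \<Sum>I''\<in>up \<epsilon> I'. fps_X ^ (card I' - card I) * s (I'' - I') * z \<epsilon> I'')"
      by (simp add: As_def sum_distrib_left mult_ac)
    also have "\<dots> = (\<Sum>I''\<in>up \<epsilon> I. \<Sum>D\<in>invsubs (I'' - I). fps_X ^ (card (I \<union> D) - card I) * s (I'' - (I \<union> D)) * z \<epsilon> I'')"
      by (rule up_up_sum[OF I])
    also have "\<dots> = (\<Sum>I''\<in>up \<epsilon> I. if I'' = I then z \<epsilon> I'' else 0)"
    proof (intro sum.cong refl)
      fix I'' assume I'': "I'' \<in> up \<epsilon> I"
      let ?B = "I'' - I"
      have sub: "I \<subseteq> I''" "I'' \<in> ideals" using I'' by (auto simp: up_def)
      have B: "?B \<subseteq> P" "g ` ?B = ?B" "finite ?B"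
        using ideals_sub[OF sub(2)] ideals_Diff_inv[OF I sub(2,1)] finite_ideal[OF sub(2)] by auto
      have "(\<Sum>D\<in>invsubs ?B. fps_X ^ (card (I \<union> D) - card I) * s (I'' - (I \<union> D)) * z \<epsilon> I'') =
          (\<Sum>D\<in>invsubs ?B. fps_X ^ card D * s (?B - D)) * z \<epsilon> I''"
        unfolding sum_distrib_right split
      proof (intro sum.cong refl)
        fix D assume "D \<in> invsubs ?B"
        then have D: "D \<subseteq> ?B" by (simp add: invsubs_def)
        then have "card (I \<union> D) = card I + card D"
          using finite_ideal[OF I] finite_subset[OF D B(3)] by (intro card_Un_disjoint) auto
        then show "fps_X ^ (card (I \<union> D) - card I) * s (?B - D) * z \<epsilon> I'' =
            fps_X ^ card D * s (?B - D) * z \<epsilon> I''" by simp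
      qed
      also have "(\<Sum>D\<in>invsubs ?B. fps_X ^ card D * s (?B - D)) = (\<Sum>D\<in>invsubs ?B. fps_X ^ card (?B - D) * s D)"
        by (rule sum_invsubs_swap[OF B(1,2)])
      also have "\<dots> = (\<Sum>D\<in>invsubs ?B. of_int (signed_weight g D) * fps_X ^ card ?B)"
      proof (intro sum.cong refl)
        fix D assume "D \<in> invsubs ?B"
        then have D: "D \<subseteq> ?B" by (simp add: invsubs_def)
        then have "card ?B = card (?B - D) + card D"
          using B by (metis card_Diff_subset card_mono finite_subset le_add_diff_inverse2)
        then show "fps_X ^ card (?B - D) * s D = of_int (signed_weight g D) * fps_X ^ card ?B"
          by (simp add: s_def power_add mult_ac)
      qed
      also have "\<dots> = of_int (\<Sum>D\<in>invsubs ?B. signed_weight g D) * fps_X ^ card ?B"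
        by (simp add: sum_distrib_right)
      \<comment> \<open>Over a nonempty run the signed weights of the invariant subsets cancel; only
        the trivial step remains.\<close>
      also have "\<dots> = (if I'' = I then 1 else 0)"
      proof (cases "I'' = I")
        case True
        have "invsubs {} = {{}}" by (auto simp: invsubs_def)
        then show ?thesis using True by simp
      next
        case False
        then have "?B \<noteq> {}" using sub by blast
        then show ?thesis
          using sum_signed_weight[OF B(3) g_inj[OF B(1)] B(2)] False by (simp add: invsubs_def)
      qed
      finally show "(\<Sum>D\<in>invsubs ?B. fps_X ^ (card (I \<union> D) - card I) * s (I'' - (I \<union> D)) * z \<epsilon> I'') =
          (if I'' = I then z \<epsilon> I'' else 0)" by simp
    qed
    also have "\<dots> = z \<epsilon> I" using up_refl[OF I] finite_up by simp
    finally show ?thesis .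
  qed
  have HAs: "(\<Sum>I'\<in>up \<epsilon> I. As \<epsilon> I') = yh \<epsilon> I" if I: "I \<in> ideals" for \<epsilon> I
  proof -
    have "(\<Sum>I'\<in>up \<epsilon> I. As \<epsilon> I') =
        (\<Sum>I''\<in>up \<epsilon> I. \<Sum>D\<in>invsubs (I'' - I). s (I'' - (I \<union> D)) * z \<epsilon> I'')"
      unfolding As_def by (rule up_up_sum[OF I])
    also have "\<dots> = (\<Sum>I''\<in>up \<epsilon> I. wgt (I'' - I) * z \<epsilon> I'')"
    proof (intro sum.cong refl)
      fix I'' assume I'': "I'' \<in> up \<epsilon> I"
      then have sub: "I \<subseteq> I''" "I'' \<in> ideals" by (auto simp: up_def)
      have "(\<Sum>D\<in>invsubs (I'' - I). s (I'' - I - D)) = (\<Sum>D\<in>invsubs (I'' - I). s D)"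
        by (rule sum_invsubs_swap[of _ "\<lambda>_. s"])
          (use ideals_sub[OF sub(2)] ideals_Diff_inv[OF I sub(2,1)] in auto)
      then show "(\<Sum>D\<in>invsubs (I'' - I). s (I'' - (I \<union> D)) * z \<epsilon> I'') = wgt (I'' - I) * z \<epsilon> I''"
        unfolding wgt_s split sum_distrib_right[symmetric] by simp
    qed
    finally show ?thesis using yh_eq[OF I] by simp
  qed
  \<comment> \<open>Induction from \<open>P\<close> downwards. \<open>W1\<close> and
    \<open>W2\<close> express the two values of \<open>W\<close> through strictly larger down-sets,
    up to the correction \<open>(fps_X - 1) * As \<epsilon> I\<close>. With the chosen
    \<open>z\<close> all terms in \<open>yh\<close> and \<open>z\<close> cancel for both parities,
    and \<open>(1 - fps_X) * As \<epsilon> I\<close> is left.\<close>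
  have W_next_As: "W_next \<epsilon> I = As \<epsilon> I" if "I \<in> ideals" for \<epsilon> I
    using that
  proof (induction "card P - card I" arbitrary: \<epsilon> I rule: less_induct)
    case less
    note I = less.prems
    have IH: "W_next \<epsilon> I' = As \<epsilon> I'" if "I' \<in> up \<epsilon>' I" "I' \<noteq> I" for \<epsilon> \<epsilon>' I'
    proof (rule less.hyps)
      show "I' \<in> ideals" using that up_ideals by blast
      then show "card P - card I' < card P - card I"
        using that ideals_card up_card up_card_eq by (metis diff_less_mono2 le_neq_implies_less order_less_le_trans)
    qed
    have W1: "(1 - fps_X) * W I \<epsilon> (Suc (card I)) = yh \<epsilon> I - z \<epsilon> I" for \<epsilon>
    proof -
      have "(1 - fps_X) * W I \<epsilon> (Suc (card I)) = (\<Sum>I'\<in>up \<epsilon> I. (1 - fps_X ^ (card I' - card I)) * As \<epsilon> I')"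
        unfolding W_up1[OF I]
      proof (intro sum.cong refl)
        fix I' assume "I' \<in> up \<epsilon> I"
        then show "(1 - fps_X ^ (card I' - card I)) * W_next \<epsilon> I' = (1 - fps_X ^ (card I' - card I)) * As \<epsilon> I'"
          using IH[of I' \<epsilon> \<epsilon>] by (cases "I' = I") auto
      qed
      then show ?thesis by (simp add: left_diff_distrib sum_subtractf HAs[OF I] HtAs[OF I])
    qed
    have W2: "(1 - fps_X) * (fps_X * W I \<epsilon> (Suc (Suc (card I)))) = fps_X * yh \<epsilon> I - z \<epsilon> I - (fps_X - 1) * As \<epsilon> I"
    proof -
      have "(1 - fps_X) * (fps_X * W I \<epsilon> (Suc (Suc (card I)))) =
          (\<Sum>I'\<in>up \<epsilon> I - {I}. (fps_X - fps_X ^ (card I' - card I)) * As \<epsilon> I')"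
        unfolding W_up2[OF I] by (intro sum.cong refl) (use IH in auto)
      also have "\<dots> = (\<Sum>I'\<in>up \<epsilon> I. (fps_X - fps_X ^ (card I' - card I)) * As \<epsilon> I') - (fps_X - 1) * As \<epsilon> I"
        using up_refl[OF I] finite_up by (simp add: sum_diff1)
      also have "(\<Sum>I'\<in>up \<epsilon> I. (fps_X - fps_X ^ (card I' - card I)) * As \<epsilon> I') = fps_X * yh \<epsilon> I - z \<epsilon> I"
        by (simp add: left_diff_distrib sum_subtractf HAs[OF I, symmetric] HtAs[OF I] sum_distrib_left)
      finally show ?thesis by simp
    qed
    have "(1 - fps_X) * W_next \<epsilon> I = (1 - fps_X) * e I +
        (if \<epsilon> then fps_X else 1) * ((1 - fps_X) * W I (\<not> \<epsilon>) (Suc (card I))) +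
        (1 - fps_X) * (fps_X * W I \<epsilon> (Suc (Suc (card I))))"
      unfolding W_next_def e_def by (simp add: algebra_simps)
    also have "\<dots> = (1 - fps_X) * As \<epsilon> I"
      unfolding W1 W2 by (cases \<epsilon>) (simp_all add: z_def algebra_simps)
    finally show ?case by (simp add: fps_X_neq_one[symmetric])
  qed
  have "(1 - fps_X) * W {} False (Suc (card ({} :: 'a set))) = yh False {} - z False {}"
    unfolding W_up1[OF empty_ideal] using W_next_As up_ideals
    by (simp add: left_diff_distrib sum_subtractf HAs[OF empty_ideal, symmetric] HtAs[OF empty_ideal, symmetric])
  \<comment> \<open>No run of odd parity can start at the bottom, so the second transfer equation at
    the empty set has the single term \<open>{}\<close>, which differs from
    \<open>P\<close>.\<close>
  moreover have "z False {} = fps_X * yh False {}"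
    using y1[OF empty_ideal] min ne by (simp add: z_def yh_def)
  ultimately have "(1 - fps_X) * W {} False (Suc 0) = (1 - fps_X) * yh False {}"
    by (simp add: left_diff_distrib)
  then have "W {} False (Suc 0) = yh False {}" by (simp add: fps_X_neq_one[symmetric])
  then show ?thesis by (simp add: yh_def)
qed

end

section \<open>Lattice points of the order polytope\<close>

context parity_poset
begin

lemma cover_induct:
  assumes "(y, x) \<in> r" "Q x" and step: "\<And>y z. covers P r y z \<Longrightarrow> (z, x) \<in> r \<Longrightarrow> Q z \<Longrightarrow> Q y"
  shows "Q y"
  using assms(1)
proof (induction "card {w. (y, w) \<in> r}" arbitrary: y rule: less_induct)
  case less
  show ?case
  proof (cases "y = x")
    case False
    then obtain z where z: "covers P r y z" "(z, x) \<in> r" using cover_below[OF less.prems] by blast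
    have yz: "(y, z) \<in> r" "y \<noteq> z" using z(1) by (auto simp: covers_def)
    have "{w. (z, w) \<in> r} \<subset> {w. (y, w) \<in> r}"
      using r_trans[OF yz(1)] r_antisym[OF yz(1)] yz r_refl r_in_P[OF yz(1)] by blast
    moreover have "finite {w. (y, w) \<in> r}"
      by (rule finite_subset[OF _ finite_P]) (use r_in_P in auto)
    ultimately have "card {w. (z, w) \<in> r} < card {w. (y, w) \<in> r}" by (intro psubset_card_mono)
    then show ?thesis using less.hyps z step by blast
  qed (use assms in simp)
qed

text \<open>Along each cover \<open>h\<close> grows by at least one and the rank by exactly one. The
  inequality of differences is written as one of sums because the values are natural
  numbers.\<close>

lemma rank_bound:
  fixes h :: "'a \<Rightarrow> nat"
  assumes "(y, x) \<in> r" "\<And>u v. covers P r u v \<Longrightarrow> (v, x) \<in> r \<Longrightarrow> h u < h v"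
  shows "h y + \<rho> x \<le> h x + \<rho> y"
proof (rule cover_induct[OF assms(1), where Q = "\<lambda>y. h y + \<rho> x \<le> h x + \<rho> y"])
  fix u v assume "covers P r u v" "(v, x) \<in> r" "h v + \<rho> x \<le> h x + \<rho> v"
  then show "h u + \<rho> x \<le> h x + \<rho> u" using assms(2)[of u v] rank_covers[of u v] by simp
qed simp

lemma rank_mono: "(y, x) \<in> r \<Longrightarrow> \<rho> y \<le> \<rho> x"
  by (erule cover_induct[where Q = "\<lambda>y. \<rho> y \<le> \<rho> x"]) (auto dest: rank_covers)

lemma rank_strict_mono:
  assumes "(y, x) \<in> r" "y \<noteq> x" shows "\<rho> y < \<rho> x"
  using cover_below[OF assms] rank_covers rank_mono by (metis Suc_le_lessD)

lemma minimal_below: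
  assumes "x \<in> P"
  obtains y where "(y, x) \<in> r" "\<And>z. (z, y) \<in> r \<Longrightarrow> z = y"
proof -
  obtain y where y: "(y, x) \<in> r" "\<And>z. (z, x) \<in> r \<Longrightarrow> \<rho> y \<le> \<rho> z"
    using arg_min_nat_lemma[of "\<lambda>y. (y, x) \<in> r" x \<rho>] r_refl[OF assms] by blast
  have "z = y" if "(z, y) \<in> r" for z
    using rank_strict_mono[OF that] y(2)[OF r_trans[OF that y(1)]] by fastforce
  then show ?thesis using y that by blast
qed

lemma maximal_above:
  assumes "x \<in> P"
  obtains y where "(x, y) \<in> r" "\<And>z. (y, z) \<in> r \<Longrightarrow> z = y"
proof -
  have fin: "finite {y. (x, y) \<in> r}" by (rule finite_subset[OF _ finite_P]) (use r_in_P in auto)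
  have "{y. (x, y) \<in> r} \<noteq> {}" using r_refl[OF assms] by blast
  then have "Max (\<rho> ` {y. (x, y) \<in> r}) \<in> \<rho> ` {y. (x, y) \<in> r}" using fin by (intro Max_in) auto
  then obtain y where y: "(x, y) \<in> r" "\<rho> y = Max (\<rho> ` {y. (x, y) \<in> r})" by force
  have "z = y" if "(y, z) \<in> r" for z
  proof (rule ccontr)
    assume "z \<noteq> y"
    then have "\<rho> y < \<rho> z" using rank_strict_mono[OF that] by blast
    moreover have "\<rho> z \<le> Max (\<rho> ` {y. (x, y) \<in> r})"
      using r_trans[OF y(1) that] fin by (intro Max_ge) auto
    ultimately show False using y(2) by simp
  qed
  then show ?thesis using y that by blast
qed

end

section \<open>Level functions and the transfer recursion that counts them\<close>

context parity_poset_aut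
begin

text \<open>Level 0 receives elements of parity \<epsilon> and the parities alternate from level to
  level. With \<epsilon> = \<open>False\<close> the parity of the level is that of the rank. Only
  level functions fixed by \<open>g\<close> are kept.\<close>

definition levels :: "bool \<Rightarrow> nat \<Rightarrow> 'a set \<Rightarrow> ('a \<Rightarrow> nat) set" where
  "levels \<epsilon> l I = {F \<in> (P - I) \<rightarrow>\<^sub>E {..<l}.
     (\<forall>x\<in>P - I. \<forall>y\<in>P - I. (x, y) \<in> r \<and> x \<noteq> y \<longrightarrow> F x < F y) \<and>
     (\<forall>x\<in>P - I. odd (F x) = (col x \<noteq> \<epsilon>)) \<and> (\<forall>x\<in>P - I. F (g x) = F x)}"

lemma finite_levels: "finite (levels \<epsilon> l I)"
  by (rule finite_subset[of _ "(P - I) \<rightarrow>\<^sub>E {..<l}"]) (auto simp: levels_def finite_P intro!: finite_PiE)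

lemma card_levels_0: "I \<in> ideals \<Longrightarrow> card (levels \<epsilon> 0 I) = (if I = P then 1 else 0)"
proof -
  assume I: "I \<in> ideals"
  show ?thesis
  proof (cases "I = P")
    case True
    then have "levels \<epsilon> 0 I = {\<lambda>_. undefined}" by (auto simp: levels_def)
    then show ?thesis using True by simp
  next
    case False
    then obtain x where "x \<in> P - I" using ideals_sub[OF I] by blast
    then have "levels \<epsilon> 0 I = {}" by (auto simp: levels_def PiE_iff)
    then show ?thesis using False by simp
  qed
qed

lemma g_compl: "I \<in> ideals \<Longrightarrow> x \<in> P - I \<Longrightarrow> g x \<in> P - I"
  using ideals_Diff_inv[OF _ P_ideal, of I] ideals_sub[of I] by blast

text \<open>The lowest level is stripped off: together with \<open>I\<close> it is a down-set in
  \<open>up \<epsilon> I\<close>, and lowering the other values by one exchanges the parities. In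
  the converse direction strictness survives, because by \<open>no_same_parity_pair\<close> an
  element of \<open>I' - I\<close> has nothing below it outside \<open>I\<close> except
  itself.\<close>

lemma card_levels_Suc:
  assumes I: "I \<in> ideals"
  shows "card (levels \<epsilon> (Suc l) I) = (\<Sum>I'\<in>up \<epsilon> I. card (levels (\<not> \<epsilon>) l I'))"
proof -
  define bot where "bot F = I \<union> {x \<in> P - I. F x = 0}" for F :: "'a \<Rightarrow> nat"
  define dn where "dn F = (\<lambda>x\<in>P - bot F. F x - 1)" for F :: "'a \<Rightarrow> nat"
  define lift where "lift I' F = (\<lambda>x\<in>P - I. if x \<in> I' then 0 else Suc (F x))" for I' and F :: "'a \<Rightarrow> nat"
  have "bij_betw (\<lambda>F. (bot F, dn F)) (levels \<epsilon> (Suc l) I) (SIGMA I':up \<epsilon> I. levels (\<not> \<epsilon>) l I')"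
  proof (rule bij_betw_byWitness[where f' = "\<lambda>(I', F). lift I' F"])
    show "\<forall>F\<in>levels \<epsilon> (Suc l) I. (case (bot F, dn F) of (I', F) \<Rightarrow> lift I' F) = F"
    proof
      fix F assume "F \<in> levels \<epsilon> (Suc l) I"
      then have "F \<in> (P - I) \<rightarrow>\<^sub>E {..<Suc l}" by (simp add: levels_def)
      then show "(case (bot F, dn F) of (I', F) \<Rightarrow> lift I' F) = F"
        by (auto simp: fun_eq_iff lift_def dn_def bot_def PiE_iff extensional_def)
    qed
    show "\<forall>q\<in>SIGMA I':up \<epsilon> I. levels (\<not> \<epsilon>) l I'.
        (bot (case q of (I', F) \<Rightarrow> lift I' F), dn (case q of (I', F) \<Rightarrow> lift I' F)) = q"
    proof
      fix q assume "q \<in> (SIGMA I':up \<epsilon> I. levels (\<not> \<epsilon>) l I')"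
      then obtain I' F where q: "q = (I', F)" "I' \<in> up \<epsilon> I" "F \<in> levels (\<not> \<epsilon>) l I'" by blast
      have I': "I \<subseteq> I'" "I' \<subseteq> P" using q(2) ideals_sub by (auto simp: up_def)
      have F: "F \<in> (P - I') \<rightarrow>\<^sub>E {..<l}" using q(3) by (simp add: levels_def)
      have b: "bot (lift I' F) = I'" using I' by (auto simp: bot_def lift_def split: if_splits)
      then have "dn (lift I' F) = F"
        using F I' by (auto simp: fun_eq_iff dn_def lift_def PiE_iff extensional_def)
      then show "(bot (case q of (I', F) \<Rightarrow> lift I' F), dn (case q of (I', F) \<Rightarrow> lift I' F)) = q"
        using b by (simp add: q)
    qed
    show "(\<lambda>F. (bot F, dn F)) ` levels \<epsilon> (Suc l) I \<subseteq> (SIGMA I':up \<epsilon> I. levels (\<not> \<epsilon>) l I')"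
    proof
      fix q assume "q \<in> (\<lambda>F. (bot F, dn F)) ` levels \<epsilon> (Suc l) I"
      then obtain F where q: "q = (bot F, dn F)" and F: "F \<in> levels \<epsilon> (Suc l) I" by blast
      have F1: "F x < Suc l" if "x \<in> P - I" for x using F that by (auto simp: levels_def PiE_iff)
      have F2: "F x < F y" if "x \<in> P - I" "y \<in> P - I" "(x, y) \<in> r" "x \<noteq> y" for x y
        using F that unfolding levels_def by blast
      have F3: "odd (F x) = (col x \<noteq> \<epsilon>)" if "x \<in> P - I" for x using F that unfolding levels_def by blast
      have F4: "F (g x) = F x" if "x \<in> P - I" for x using F that unfolding levels_def by blast
      have IP: "I \<subseteq> P" by (rule ideals_sub[OF I])
      have "downset (bot F)" unfolding downset_def
      proof (intro conjI ballI allI impI)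
        show "bot F \<subseteq> P" using IP by (auto simp: bot_def)
        fix x y assume x: "x \<in> bot F" and yx: "(y, x) \<in> r"
        show "y \<in> bot F"
        proof (cases "y \<in> I \<or> y = x")
          case True
          then show ?thesis using x by (auto simp: bot_def)
        next
          case False
          then have "x \<notin> I" using I yx unfolding ideals_def downset_def by blast
          then have x': "x \<in> P - I" "F x = 0" using x by (auto simp: bot_def)
          have "y \<in> P - I" using False r_in_P[OF yx] by blast
          then have "F y < F x" using F2 x' yx False by blast
          then show ?thesis using x' by simp
        qed
      qed
      moreover have "g ` bot F = bot F"
      proof
        have gI: "g ` I = I" using I by (simp add: ideals_def)
        show sub: "g ` bot F \<subseteq> bot F"
          using gI g_compl[OF I] F4 by (auto simp: bot_def)
        have "finite (bot F)" using IP finite_P by (auto simp: bot_def intro: finite_subset)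
        moreover have "card (g ` bot F) = card (bot F)"
          using IP by (intro card_image g_inj) (auto simp: bot_def)
        ultimately show "bot F \<subseteq> g ` bot F" using card_subset_eq[OF _ sub] by simp
      qed
      ultimately have b: "bot F \<in> ideals" by (simp add: ideals_def)
      have "col v = \<epsilon>" if "v \<in> bot F - I" for v using that F3[of v] by (auto simp: bot_def)
      then have bup: "bot F \<in> up \<epsilon> I" using b by (auto simp: up_def bot_def)
      have pos: "0 < F x" "x \<in> P - I" if "x \<in> P - bot F" for x using that by (auto simp: bot_def)
      have "dn F \<in> levels (\<not> \<epsilon>) l (bot F)"
        unfolding levels_def
      proof (intro CollectI conjI ballI impI)
        show "dn F \<in> P - bot F \<rightarrow>\<^sub>E {..<l}"
        proof (rule PiE_I)
          fix x assume x: "x \<in> P - bot F"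
          then show "dn F x \<in> {..<l}" using pos[OF x] F1[of x] by (auto simp: dn_def)
        qed (auto simp: dn_def)
        fix x assume x: "x \<in> P - bot F"
        show "odd (dn F x) = (col x \<noteq> (\<not> \<epsilon>))" using pos[OF x] F3[of x] x by (auto simp: dn_def)
        show "dn F (g x) = dn F x" using pos[OF x] F4[of x] x g_compl[OF b x] by (simp add: dn_def)
        fix y assume y: "y \<in> P - bot F" "(x, y) \<in> r \<and> x \<noteq> y"
        then show "dn F x < dn F y" using pos[OF x] pos[OF y(1)] F2[of x y] x by (auto simp: dn_def)
      qed
      then show "q \<in> (SIGMA I':up \<epsilon> I. levels (\<not> \<epsilon>) l I')" using bup by (simp add: q)
    qed
    show "(\<lambda>(I', F). lift I' F) ` (SIGMA I':up \<epsilon> I. levels (\<not> \<epsilon>) l I') \<subseteq> levels \<epsilon> (Suc l) I"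
    proof
      fix K assume "K \<in> (\<lambda>(I', F). lift I' F) ` (SIGMA I':up \<epsilon> I. levels (\<not> \<epsilon>) l I')"
      then obtain I' F where K: "K = lift I' F" and I': "I' \<in> up \<epsilon> I" and F: "F \<in> levels (\<not> \<epsilon>) l I'" by auto
      have I'': "I \<subseteq> I'" "I' \<in> ideals" "\<And>v. v \<in> I' - I \<Longrightarrow> col v = \<epsilon>" using I' by (auto simp: up_def)
      have F1: "F x < l" if "x \<in> P - I'" for x using F that by (auto simp: levels_def PiE_iff)
      have F2: "F x < F y" if "x \<in> P - I'" "y \<in> P - I'" "(x, y) \<in> r" "x \<noteq> y" for x y
        using F that unfolding levels_def by blast
      have F3: "odd (F x) = (col x \<noteq> (\<not> \<epsilon>))" if "x \<in> P - I'" for x using F that unfolding levels_def by blast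
      have F4: "F (g x) = F x" if "x \<in> P - I'" for x using F that unfolding levels_def by blast
      show "K \<in> levels \<epsilon> (Suc l) I"
        unfolding levels_def
      proof (intro CollectI conjI ballI impI)
        show "K \<in> P - I \<rightarrow>\<^sub>E {..<Suc l}" using F1 by (auto simp: K lift_def)
        fix x assume x: "x \<in> P - I"
        show "odd (K x) = (col x \<noteq> \<epsilon>)" using x F3[of x] I''(3)[of x] by (auto simp: K lift_def)
        have "g x \<in> I' \<longleftrightarrow> x \<in> I'"
          using g_compl[OF I''(2), of x] I''(2) x unfolding ideals_def by blast
        then show "K (g x) = K x" using x F4[of x] g_compl[OF I x] by (simp add: K lift_def)
        fix y assume y: "y \<in> P - I" "(x, y) \<in> r \<and> x \<noteq> y"
        then have "y \<notin> I'" using no_same_parity_pair[OF I I', of y x] x by blast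
        then show "K x < K y" using x y F2[of x y] by (auto simp: K lift_def)
      qed
    qed
  qed
  then have "card (levels \<epsilon> (Suc l) I) = card (SIGMA I':up \<epsilon> I. levels (\<not> \<epsilon>) l I')"
    by (rule bij_betw_same_card)
  then show ?thesis by (simp add: card_SigmaI finite_up finite_levels)
qed

lemma W_eq_levels:
  assumes "up True {} = {{}}" "P \<noteq> {}"
  shows "W {} False (Suc 0) = (1 - fps_X) * wgt P *
    Abs_fps (\<lambda>j. of_nat (card (levels False (Suc (Suc (2 * j))) {})))"
proof -
  \<comment> \<open>One power of X stands for a pair of levels. Starting with odd parity there are
    2j + 1 levels; peeling off one leaves 2j, which is the coefficient of \<open>y False\<close> at
    j - 1 and, for j = 0, the boundary term at \<open>P\<close>.\<close>
  define y where "y \<epsilon> I = Abs_fps (\<lambda>j. of_nat (card (levels \<epsilon> (if \<epsilon> then Suc (2 * j) else Suc (Suc (2 * j))) I)) :: complex)"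
    for \<epsilon> I
  have "W {} False (Suc 0) = (1 - fps_X) * wgt P * y False {}"
  proof (rule W_eq_transfer[OF _ _ assms])
    fix I assume I: "I \<in> ideals"
    show "y False I = (\<Sum>I'\<in>up False I. y True I')"
      by (rule fps_ext) (simp add: y_def fps_sum_nth card_levels_Suc[OF I])
    show "y True I = (\<Sum>I'\<in>up True I. (if I' = P then 1 else 0) + fps_X * y False I')"
    proof (rule fps_ext)
      fix j
      have "fps_nth ((if I' = P then 1 else 0) + fps_X * y False I') j = of_nat (card (levels False (2 * j) I'))"
        if "I' \<in> up True I" for I'
        using card_levels_0[OF up_ideals[OF that]] by (cases j) (auto simp: y_def)
      then have "fps_nth (\<Sum>I'\<in>up True I. (if I' = P then 1 else 0) + fps_X * y False I') j =
          (\<Sum>I'\<in>up True I. of_nat (card (levels False (2 * j) I')))"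
        unfolding fps_sum_nth by (intro sum.cong refl)
      then show "fps_nth (y True I) j = fps_nth (\<Sum>I'\<in>up True I. (if I' = P then 1 else 0) + fps_X * y False I') j"
        by (simp add: y_def card_levels_Suc[OF I])
    qed
  qed
  then show ?thesis by (simp add: y_def)
qed

end

section \<open>Lattice points as level functions\<close>

locale ranked_poset = parity_poset +
  fixes R :: nat
  assumes rank_minimal: "\<And>x. x \<in> P \<Longrightarrow> (\<And>y. (y, x) \<in> r \<Longrightarrow> y = x) \<Longrightarrow> \<rho> x = 0"
    and rank_maximal: "\<And>x. x \<in> P \<Longrightarrow> (\<And>y. (x, y) \<in> r \<Longrightarrow> y = x) \<Longrightarrow> \<rho> x = R"
    and nonempty: "P \<noteq> {}"
begin

lemma bottom_below: "x \<in> P \<Longrightarrow> \<exists>y. (y, x) \<in> r \<and> \<rho> y = 0"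
  using minimal_below rank_minimal r_in_P by metis

lemma top_above: "x \<in> P \<Longrightarrow> \<exists>y. (x, y) \<in> r \<and> \<rho> y = R"
  using maximal_above rank_maximal r_in_P by metis

lemma rank_le: "x \<in> P \<Longrightarrow> \<rho> x \<le> R"
  using top_above rank_mono by metis

lemma rank_le_strict:
  fixes h :: "'a \<Rightarrow> nat"
  assumes "x \<in> P" "\<And>u v. covers P r u v \<Longrightarrow> h u < h v"
  shows "\<rho> x \<le> h x"
proof -
  obtain y where "(y, x) \<in> r" "\<rho> y = 0" using bottom_below assms(1) by blast
  then show ?thesis using rank_bound[of y x h] assms(2) by simp
qed

text \<open>The number of switches before an element has the parity of its rank and increases weakly
  with the order, hence strictly along covers, and so is at least the rank. A maximal element above
  a member of the last run has rank \<open>R\<close> and comes after all switches.\<close>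

lemma chain_switches:
  assumes J: "J \<in> chains C T False {}" and C: "finite C" "C \<subseteq> {..<card P}"
  shows "R \<le> card C \<and> (odd (card C) \<longleftrightarrow> odd R)"
proof -
  note J' = chainsD[OF J]
  define h where "h v = card {c \<in> C. v \<notin> J c}" for v
  have col_h: "col v = odd (h v)" if "v \<in> P" for v using J'(8)[OF that] by (simp add: h_def)
  have "\<exists>v\<in>P. \<forall>c\<in>C. v \<notin> J c"
  proof (cases "C = {}")
    case False
    define m where "m = Max C"
    have m: "m \<in> C" using C False by (simp add: m_def)
    have "J c \<subseteq> J m" if "c \<in> C" for c
      using J'(6)[of c m] that m C by (auto simp: m_def)
    moreover have "\<not> P \<subseteq> J m"
    proof
      assume "P \<subseteq> J m"
      then have "card P \<le> card (J m)" using J'(5) m by (intro card_mono) auto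
      then show False using J'(4)[of m] m C by auto
    qed
    ultimately show ?thesis by blast
  qed (use nonempty in auto)
  then obtain v where v: "v \<in> P" "\<And>c. c \<in> C \<Longrightarrow> v \<notin> J c" by blast
  obtain t where t: "(v, t) \<in> r" "\<rho> t = R" using top_above[OF v(1)] by blast
  have tP: "t \<in> P" using r_in_P[OF t(1)] by blast
  have "t \<notin> J c" if "c \<in> C" for c using J'(7)[OF that] t(1) v(2)[OF that] unfolding downset_def by blast
  then have "{c \<in> C. t \<notin> J c} = C" by blast
  then have ht: "h t = card C" by (simp add: h_def)
  have "\<rho> t \<le> h t"
  proof (rule rank_le_strict[OF tP])
    fix u w assume uw: "covers P r u w"
    then have uw': "u \<in> P" "w \<in> P" "(u, w) \<in> r" by (auto simp: covers_def)
    have "{c \<in> C. u \<notin> J c} \<subseteq> {c \<in> C. w \<notin> J c}" using J'(7) uw'(3) by (auto simp: downset_def)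
    then have "h u \<le> h w" unfolding h_def using C by (intro card_mono) auto
    moreover have "odd (h u) \<noteq> odd (h w)"
      using col_h[OF uw'(1)] col_h[OF uw'(2)] rank_covers[OF uw] by (auto simp: col_def)
    ultimately show "h u < h w" by (cases "h u = h w") auto
  qed
  moreover have "odd R = odd (card C)" using col_h[OF tP] ht t(2) by (simp add: col_def)
  ultimately show ?thesis using ht t(2) by simp
qed

definition antitone_maps :: "nat \<Rightarrow> ('a \<Rightarrow> nat) set" where
  "antitone_maps m = {K \<in> P \<rightarrow>\<^sub>E {..m}. \<forall>p\<in>P. \<forall>q\<in>P. (p, q) \<in> r \<longrightarrow> K q \<le> K p}"

lemma lattice_points_eq: "lattice_points P r m = (\<lambda>K. \<lambda>p\<in>P. real (K p)) ` antitone_maps m"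
proof
  show "lattice_points P r m \<subseteq> (\<lambda>K. \<lambda>p\<in>P. real (K p)) ` antitone_maps m"
  proof
    fix f assume "f \<in> lattice_points P r m"
    then obtain h where h: "h \<in> order_polytope P r" "f = (\<lambda>p\<in>P. real m * h p)" and fZ: "f \<in> P \<rightarrow>\<^sub>E \<int>"
      by (auto simp: lattice_points_def)
    have h01: "0 \<le> h p" "h p \<le> 1" if "p \<in> P" for p using h(1) that by (auto simp: order_polytope_def PiE_iff)
    define K where "K = (\<lambda>p\<in>P. nat \<lfloor>f p\<rfloor>)"
    have K: "real (K p) = f p" if p: "p \<in> P" for p
    proof -
      have "f p \<in> \<int>" using fZ p by (auto simp: PiE_iff)
      moreover have "0 \<le> f p" using h01[OF p] by (simp add: h(2) p)
      ultimately show ?thesis using p by (auto simp: K_def elim!: Ints_cases)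
    qed
    have "K p \<le> m" if p: "p \<in> P" for p
    proof -
      have "real (K p) \<le> real m * 1"
        unfolding K[OF p] using mult_left_mono[OF h01(2)[OF p], of "real m"] p by (simp add: h(2))
      then show ?thesis by simp
    qed
    moreover have "K q \<le> K p" if "p \<in> P" "q \<in> P" "(p, q) \<in> r" for p q
    proof -
      have "real (K q) \<le> real (K p)"
        unfolding K[OF that(1)] K[OF that(2)]
        using h(1) that by (auto simp: h(2) order_polytope_def intro: mult_left_mono)
      then show ?thesis by simp
    qed
    ultimately have "K \<in> antitone_maps m" by (auto simp: antitone_maps_def K_def)
    moreover have "f = (\<lambda>p\<in>P. real (K p))" using K by (auto simp: fun_eq_iff h(2))
    ultimately show "f \<in> (\<lambda>K. \<lambda>p\<in>P. real (K p)) ` antitone_maps m" by blast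
  qed
  show "(\<lambda>K. \<lambda>p\<in>P. real (K p)) ` antitone_maps m \<subseteq> lattice_points P r m"
  proof safe
    fix K assume K: "K \<in> antitone_maps m"
    \<comment> \<open>For \<open>m = 0\<close> the quotient by zero is 0, which agrees with
      \<open>K = 0\<close> there, so the zeroth dilate needs no other witness.\<close>
    define h where "h = (\<lambda>p\<in>P. real (K p) / real m)"
    have Km: "K p \<le> m" if "p \<in> P" for p using K that by (auto simp: antitone_maps_def PiE_iff)
    have "h \<in> order_polytope P r"
      using K Km unfolding order_polytope_def h_def antitone_maps_def
      by (auto simp: PiE_iff divide_le_eq_1 intro!: divide_right_mono)
    moreover have "(\<lambda>p\<in>P. real (K p)) = (\<lambda>p\<in>P. real m * h p)"
      using Km by (cases "m = 0") (auto simp: h_def fun_eq_iff)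
    ultimately have "(\<lambda>p\<in>P. real (K p)) \<in> (\<lambda>f. \<lambda>p\<in>P. real m * f p) ` order_polytope P r"
      by (rule image_eqI[where f = "\<lambda>f. \<lambda>p\<in>P. real m * f p" and x = h, rotated])
    moreover have "(\<lambda>p\<in>P. real (K p)) \<in> P \<rightarrow>\<^sub>E \<int>" by auto
    ultimately show "(\<lambda>p\<in>P. real (K p)) \<in> lattice_points P r m"
      unfolding lattice_points_def by (rule IntI)
  qed
qed

lemma finite_lattice_points: "finite (lattice_points P r m)"
proof -
  have "finite (antitone_maps m)"
    by (rule finite_subset[of _ "P \<rightarrow>\<^sub>E {..m}"]) (auto simp: antitone_maps_def finite_P intro!: finite_PiE)
  then show ?thesis unfolding lattice_points_eq by simp
qed

lemma fixed_lattice_points: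
  assumes g: "rank_aut g"
  shows "card {f \<in> lattice_points P r m. translate P g f = f} =
    card {K \<in> antitone_maps m. \<forall>p\<in>P. K (g p) = K p}"
proof -
  let ?e = "\<lambda>K :: 'a \<Rightarrow> nat. \<lambda>p\<in>P. real (K p)"
  note g' = rank_autD[OF g]
  have fix_iff: "translate P g (?e K) = ?e K \<longleftrightarrow> (\<forall>p\<in>P. K (g p) = K p)" for K
  proof
    assume l: "translate P g (?e K) = ?e K"
    show "\<forall>p\<in>P. K (g p) = K p"
    proof
      fix p assume p: "p \<in> P"
      then have "g p \<in> P" using g'(3) by blast
      then show "K (g p) = K p"
        using fun_cong[OF l, of "g p"] p g'(2) by (simp add: translate_def)
    qed
  next
    assume rr: "\<forall>p\<in>P. K (g p) = K p"
    have i: "inv_into P g p \<in> P" "g (inv_into P g p) = p" if "p \<in> P" for p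
      using that g'(3) by (auto simp: inv_into_into f_inv_into_f)
    have "K (inv_into P g p) = K p" if p: "p \<in> P" for p using rr i[OF p] by metis
    then show "translate P g (?e K) = ?e K" using i by (auto simp: translate_def fun_eq_iff)
  qed
  have "inj_on ?e (antitone_maps m)"
  proof (rule inj_onI)
    fix K K' assume K: "K \<in> antitone_maps m" "K' \<in> antitone_maps m" "?e K = ?e K'"
    have "K p = K' p" if "p \<in> P" for p using fun_cong[OF K(3), of p] that by simp
    then show "K = K'" using K(1,2) unfolding antitone_maps_def by (auto intro: PiE_ext)
  qed
  then have "bij_betw ?e {K \<in> antitone_maps m. \<forall>p\<in>P. K (g p) = K p} {f \<in> lattice_points P r m. translate P g f = f}"
    unfolding bij_betw_def lattice_points_eq using fix_iff by (auto simp: inj_on_def)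
  then show ?thesis by (rule bij_betw_same_card[symmetric])
qed

end

locale ranked_poset_aut = ranked_poset + parity_poset_aut
begin

text \<open>\<open>F\<close> grows at least as fast as the rank. Comparing with a minimal element
  below \<open>x\<close> gives the lower bound, and comparing with a maximal element above, where
  \<open>F\<close> is less than \<open>l\<close> and the rank is \<open>R\<close>, gives the upper
  one.\<close>

lemma levels_rank:
  assumes F: "F \<in> levels False l {}" and x: "x \<in> P"
  shows "\<rho> x \<le> F x" "F x + R < l + \<rho> x"
    "\<And>y. y \<in> P \<Longrightarrow> (x, y) \<in> r \<Longrightarrow> F x + \<rho> y \<le> F y + \<rho> x"
proof -
  have F2: "F u < F v" if "covers P r u v" for u v
    using F that unfolding levels_def covers_def by blast
  show "\<rho> x \<le> F x" by (rule rank_le_strict[OF x F2])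
  show b: "F x + \<rho> y \<le> F y + \<rho> x" if "(x, y) \<in> r" for y using rank_bound[OF that F2] .
  obtain t where t: "(x, t) \<in> r" "\<rho> t = R" using top_above[OF x] by blast
  have "F t < l" using F r_in_P[OF t(1)] by (auto simp: levels_def PiE_iff)
  then show "F x + R < l + \<rho> x" using b[OF t(1)] t(2) by simp
qed

text \<open>The number of levels fits both parities of \<open>R\<close>. The largest value 2 m + R
  stays below it, and conversely \<open>F x - \<rho> x\<close> is even and at most 2 m for odd
  \<open>R\<close>, at most 2 m + 1 for even \<open>R\<close>, so that its half never exceeds
  \<open>m\<close>.\<close>

lemma card_levels_antitone:
  "card (levels False (Suc (Suc (2 * (m + R div 2)))) {}) = card {K \<in> antitone_maps m. \<forall>p\<in>P. K (g p) = K p}"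
proof -
  let ?l = "Suc (Suc (2 * (m + R div 2)))"
  note g' = rank_autD[OF g_aut]
  have gP: "g x \<in> P" if "x \<in> P" for x using that g'(3) by blast
  have Rdiv: "R \<le> Suc (2 * (R div 2))" "2 * (R div 2) \<le> R" by simp_all
  have "bij_betw (\<lambda>K. \<lambda>x\<in>P. 2 * (m - K x) + \<rho> x) {K \<in> antitone_maps m. \<forall>p\<in>P. K (g p) = K p} (levels False ?l {})"
  proof (rule bij_betw_byWitness[where f' = "\<lambda>F. \<lambda>x\<in>P. m - (F x - \<rho> x) div 2"])
    show "\<forall>K\<in>{K \<in> antitone_maps m. \<forall>p\<in>P. K (g p) = K p}.
        (\<lambda>x\<in>P. m - ((\<lambda>x\<in>P. 2 * (m - K x) + \<rho> x) x - \<rho> x) div 2) = K"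
      by (auto simp: antitone_maps_def fun_eq_iff PiE_iff extensional_def)
    show "\<forall>F\<in>levels False ?l {}. (\<lambda>x\<in>P. 2 * (m - (\<lambda>x\<in>P. m - (F x - \<rho> x) div 2) x) + \<rho> x) = F"
    proof (intro ballI ext)
      fix F x assume F: "F \<in> levels False ?l {}"
      show "(\<lambda>x\<in>P. 2 * (m - (\<lambda>x\<in>P. m - (F x - \<rho> x) div 2) x) + \<rho> x) x = F x"
      proof (cases "x \<in> P")
        case True
        have "odd (F x) = odd (\<rho> x)" using F True by (auto simp: levels_def col_def)
        moreover note levels_rank(1,2)[OF F True]
        ultimately have "even (F x - \<rho> x)" "(F x - \<rho> x) div 2 \<le> m" using Rdiv by auto
        then show ?thesis using True levels_rank(1)[OF F True] by simp
      next
        case False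
        then show ?thesis using F by (auto simp: levels_def PiE_iff extensional_def)
      qed
    qed
    show "(\<lambda>K. \<lambda>x\<in>P. 2 * (m - K x) + \<rho> x) ` {K \<in> antitone_maps m. \<forall>p\<in>P. K (g p) = K p} \<subseteq> levels False ?l {}"
    proof
      fix F assume "F \<in> (\<lambda>K. \<lambda>x\<in>P. 2 * (m - K x) + \<rho> x) ` {K \<in> antitone_maps m. \<forall>p\<in>P. K (g p) = K p}"
      then obtain K where F: "F = (\<lambda>x\<in>P. 2 * (m - K x) + \<rho> x)" and K: "K \<in> antitone_maps m" "\<forall>p\<in>P. K (g p) = K p"
        by blast
      show "F \<in> levels False ?l {}"
        unfolding levels_def
      proof (intro CollectI conjI ballI impI)
        show "F \<in> P - {} \<rightarrow>\<^sub>E {..<?l}"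
        proof (rule PiE_I)
          fix x assume "x \<in> P - {}"
          then show "F x \<in> {..<?l}" using rank_le[of x] Rdiv by (auto simp: F)
        qed (auto simp: F)
        fix x assume x: "x \<in> P - {}"
        then show "odd (F x) = (col x \<noteq> False)" by (simp add: F col_def)
        show "F (g x) = F x" using x K(2) g'(5) gP by (simp add: F)
        fix y assume y: "y \<in> P - {}" "(x, y) \<in> r \<and> x \<noteq> y"
        have "K y \<le> K x" using K x y by (auto simp: antitone_maps_def)
        then show "F x < F y" using x y rank_strict_mono[of x y] by (simp add: F add_le_less_mono diff_le_mono2)
      qed
    qed
    show "(\<lambda>F. \<lambda>x\<in>P. m - (F x - \<rho> x) div 2) ` levels False ?l {} \<subseteq> {K \<in> antitone_maps m. \<forall>p\<in>P. K (g p) = K p}"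
    proof
      fix K assume "K \<in> (\<lambda>F. \<lambda>x\<in>P. m - (F x - \<rho> x) div 2) ` levels False ?l {}"
      then obtain F where K: "K = (\<lambda>x\<in>P. m - (F x - \<rho> x) div 2)" and F: "F \<in> levels False ?l {}" by blast
      have "K q \<le> K p" if "p \<in> P" "q \<in> P" "(p, q) \<in> r" for p q
      proof -
        have "F p - \<rho> p \<le> F q - \<rho> q"
          using levels_rank(3)[OF F that] levels_rank(1)[OF F that(1)] levels_rank(1)[OF F that(2)] by simp
        then show ?thesis using that by (simp add: K diff_le_mono2 div_le_mono)
      qed
      moreover have "K (g p) = K p" if "p \<in> P" for p
        using F that g'(5) gP by (auto simp: K levels_def)
      ultimately show "K \<in> {K \<in> antitone_maps m. \<forall>p\<in>P. K (g p) = K p}"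
        by (auto simp: antitone_maps_def K)
    qed
  qed
  then show ?thesis by (rule bij_betw_same_card[symmetric])
qed

lemma up_True_empty: "up True {} = {{}}"
proof -
  have "I = {}" if I: "I \<in> up True {}" for I
  proof (rule ccontr)
    assume "I \<noteq> {}"
    then obtain x where x: "x \<in> I" by blast
    have I': "downset I" "\<And>v. v \<in> I \<Longrightarrow> col v" using I by (auto simp: up_def ideals_def)
    have "x \<in> P" using x I'(1) by (auto simp: downset_def)
    then obtain y where y: "(y, x) \<in> r" "\<rho> y = 0" using bottom_below by blast
    then have "col y" using I' x by (auto simp: downset_def)
    then show False using y(2) by (simp add: col_def)
  qed
  then show ?thesis using up_refl[OF empty_ideal] by blast
qed

text \<open>The coefficient at \<open>j\<close> counts functions with 2 j + 2 levels and belongs to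
  the dilate \<open>j - R div 2\<close>. For \<open>j < R div 2\<close> there are at most
  \<open>R\<close> levels, too few for a chain of \<open>R + 1\<close> elements.\<close>

lemma W_eq_lattice:
  "W {} False (Suc 0) = fps_X ^ (R div 2) * ((1 - fps_X) * wgt P *
    Abs_fps (\<lambda>m. of_nat (card {f \<in> lattice_points P r m. translate P g f = f})))"
proof -
  let ?y = "Abs_fps (\<lambda>j. of_nat (card (levels False (Suc (Suc (2 * j))) {})) :: complex)"
  let ?a = "Abs_fps (\<lambda>m. of_nat (card {f \<in> lattice_points P r m. translate P g f = f}) :: complex)"
  have "?y = fps_X ^ (R div 2) * ?a"
  proof (rule fps_ext)
    fix j
    show "fps_nth ?y j = fps_nth (fps_X ^ (R div 2) * ?a) j"
    proof (cases "j < R div 2")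
      case True
      obtain x where x: "x \<in> P" using nonempty by blast
      have "levels False (Suc (Suc (2 * j))) {} = {}"
        using levels_rank(1,2)[OF _ x] True by fastforce
      then show ?thesis using True by (simp add: fps_X_power_mult_nth)
    next
      case False
      then obtain m where m: "j = m + R div 2" by (metis add.commute le_Suc_ex not_less)
      then show ?thesis
        using card_levels_antitone[of m] fixed_lattice_points[OF g_aut, of m]
        by (simp add: fps_X_power_mult_nth)
    qed
  qed
  then show ?thesis using W_eq_levels[OF up_True_empty nonempty] by (simp add: mult_ac)
qed

end

section \<open>The numerator and the exterior powers\<close>

text \<open>The weights of successive switches alternate between 1 and X, beginning with 1 for
  \<epsilon> = \<open>False\<close> and with X for \<epsilon> = \<open>True\<close>; this is the
  source of the rounding in the exponent.\<close>

lemma weight_words: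
  assumes "w \<in> words m"
  shows "weight \<epsilon> w = fps_X ^ ((card (starts N w) + (if \<epsilon> then 1 else 0)) div 2 + card (doms N w)) *
      (1 + fps_X) ^ (m - card (starts N w) - 2 * card (doms N w))"
    and "card (starts N w) + 2 * card (doms N w) \<le> m"
proof -
  have ins: "card (insert N (starts (Suc N) w)) = Suc (card (starts (Suc N) w))"
    "card (insert N (doms (Suc (Suc N)) w)) = Suc (card (doms (Suc (Suc N)) w))" for N w
    using starts_ge[of N "Suc N" w] doms_ge[of N "Suc (Suc N)" w] finite_starts finite_doms
    by (auto simp: card_insert_if)
  have "weight \<epsilon> w = fps_X ^ ((card (starts N w) + (if \<epsilon> then 1 else 0)) div 2 + card (doms N w)) *
      (1 + fps_X) ^ (m - card (starts N w) - 2 * card (doms N w)) \<and>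
      card (starts N w) + 2 * card (doms N w) \<le> m"
    using assms
  proof (induction m arbitrary: w N \<epsilon> rule: words.induct)
    case (3 n)
    then consider w' where "w = Switch # w'" "w' \<in> words (Suc n)"
      | w' where "w = Single # w'" "w' \<in> words (Suc n)" | w' where "w = Domino # w'" "w' \<in> words n"
      by auto
    then show ?case
    proof cases
      case 1
      then show ?thesis using "3.IH"(1)[of w' "\<not> \<epsilon>" "Suc N"] by (cases \<epsilon>) (auto simp: ins)
    next
      case 2
      then show ?thesis using "3.IH"(1)[of w' \<epsilon> "Suc N"] by (auto simp: Suc_diff_le)
    next
      case 3
      then show ?thesis using "3.IH"(3)[of w' \<epsilon> "Suc (Suc N)"] by (auto simp: ins)
    qed
  qed auto
  then show "weight \<epsilon> w = fps_X ^ ((card (starts N w) + (if \<epsilon> then 1 else 0)) div 2 + card (doms N w)) *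
      (1 + fps_X) ^ (m - card (starts N w) - 2 * card (doms N w))"
    "card (starts N w) + 2 * card (doms N w) \<le> m" by blast+
qed

context ranked_poset
begin

definition gamma_words :: "nat \<Rightarrow> tile list set" where
  "gamma_words i = {w \<in> words (card P - 1). R \<le> card (starts 1 w) \<and>
     (odd (card (starts 1 w)) \<longleftrightarrow> odd R) \<and> (card (starts 1 w) - R) div 2 + card (doms 1 w) = i}"

end

context ranked_poset_aut
begin

text \<open>With R + 2 e switches and d dominoes, the exponent of X is R div 2 + (e + d), and the
  number of singles is |P| - 1 - (R + 2 e) - 2 d = s - 2 (e + d). So i = e + d is the index in the
  expansion, and X^(R div 2) cancels against \<open>W_eq_lattice\<close>. All other words contribute
  zero by \<open>chain_switches\<close>.\<close>

lemma gamma_identity: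
  assumes s: "s = card P - R - 1"
  shows "(1 - fps_X) * wgt P * Abs_fps (\<lambda>m. of_nat (card {f \<in> lattice_points P r m. translate P g f = f})) =
    (\<Sum>i\<le>s div 2. of_int (\<Sum>w\<in>gamma_words i. beta (doms 1 w) (starts 1 w) False {}) *
       fps_X ^ i * (1 + fps_X) ^ (s - 2 * i))"
    (is "?lhs = ?rhs")
proof -
  let ?n = "card P - 1"
  let ?b = "\<lambda>w. of_int (beta (doms 1 w) (starts 1 w) False {}) :: complex fps"
  let ?i = "\<lambda>w. (card (starts 1 w) - R) div 2 + card (doms 1 w)"
  let ?V = "{w \<in> words ?n. R \<le> card (starts 1 w) \<and> (odd (card (starts 1 w)) \<longleftrightarrow> odd R)}"
  have P1: "1 \<le> card P" using nonempty finite_P by (simp add: Suc_leI card_gt_0_iff)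
  have b0: "?b w = 0" if w: "w \<in> words ?n" "\<not> (R \<le> card (starts 1 w) \<and> (odd (card (starts 1 w)) \<longleftrightarrow> odd R))" for w
  proof -
    have "starts 1 w \<subseteq> {..<card P}" using starts_less[OF w(1)] P1 by fastforce
    then have "chains (starts 1 w) T False {} = {}" for T
      using chain_switches finite_starts w(2) by blast
    then show ?thesis by (simp add: beta_def fixed_chains_def)
  qed
  have wt: "?i w \<le> s div 2" "weight False w = fps_X ^ (R div 2) * (fps_X ^ ?i w * (1 + fps_X) ^ (s - 2 * ?i w))"
    if w: "w \<in> ?V" for w
  proof -
    let ?c = "card (starts 1 w)" and ?d = "card (doms 1 w)"
    note ww = weight_words(1)[where w = w and m = ?n and N = 1 and \<epsilon> = False]
      weight_words(2)[where w = w and m = ?n and N = 1]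
    have "even (?c - R)" using w by auto
    then obtain e where "?c - R = 2 * e" by (rule evenE)
    moreover have "R \<le> ?c" using w by blast
    ultimately have e: "?c = R + 2 * e" by linarith
    have cd: "R + 2 * e + 2 * ?d \<le> ?n" using ww(2) w e by simp
    have i: "?i w = e + ?d" using e by simp
    show "?i w \<le> s div 2" unfolding i s using cd by simp
    have "?n - ?c - 2 * ?d = s - 2 * ?i w" unfolding i s e using cd by simp
    moreover have "?c div 2 + ?d = R div 2 + ?i w" unfolding i e by simp
    ultimately show "weight False w = fps_X ^ (R div 2) * (fps_X ^ ?i w * (1 + fps_X) ^ (s - 2 * ?i w))"
      using ww(1) w by (simp add: power_add mult.assoc)
  qed
  have "fps_X ^ (R div 2) * ?lhs = W {} False (Suc 0)" using W_eq_lattice by simp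
  also have "\<dots> = (\<Sum>w\<in>words ?n. weight False w * ?b w)" using P1 by (simp add: W_def)
  also have "\<dots> = (\<Sum>w\<in>?V. weight False w * ?b w)"
  proof (rule sum.mono_neutral_right)
    show "\<forall>w\<in>words ?n - ?V. weight False w * ?b w = 0"
    proof
      fix w assume "w \<in> words ?n - ?V"
      then have "?b w = 0" by (intro b0) auto
      then show "weight False w * ?b w = 0" by simp
    qed
  qed (auto simp: finite_words)
  also have "\<dots> = (\<Sum>i\<le>s div 2. \<Sum>w\<in>{w \<in> ?V. ?i w = i}. weight False w * ?b w)"
    by (rule sum.group[symmetric]) (use wt(1) finite_words in auto)
  also have "\<dots> = (\<Sum>i\<le>s div 2. \<Sum>w\<in>gamma_words i. fps_X ^ (R div 2) * (?b w * fps_X ^ i * (1 + fps_X) ^ (s - 2 * i)))"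
  proof (intro sum.cong refl)
    fix i w assume "w \<in> gamma_words i"
    then have "w \<in> ?V" "?i w = i" by (auto simp: gamma_words_def)
    then show "weight False w * ?b w = fps_X ^ (R div 2) * (?b w * fps_X ^ i * (1 + fps_X) ^ (s - 2 * i))"
      using wt(2)[of w] by (simp add: mult_ac)
  qed (auto simp: gamma_words_def)
  also have "\<dots> = fps_X ^ (R div 2) * ?rhs"
    by (simp add: sum_distrib_left sum_distrib_right mult_ac)
  finally show ?thesis by simp
qed

end

section \<open>Traces of exterior powers of permutation matrices\<close>

lemma bij_betw_pick:
  assumes "finite S"
  shows "bij_betw (pick S) {0..<card S} S"
proof -
  have inj: "inj_on (pick S) {0..<card S}"
    by (rule inj_onI) (metis atLeastLessThan_iff card_pick_le)
  have sub: "pick S ` {0..<card S} \<subseteq> S" using pick_in_set_le by auto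
  have "card (pick S ` {0..<card S}) = card S" using card_image[OF inj] by simp
  then show ?thesis using inj card_subset_eq[OF assms sub] by (simp add: bij_betw_def)
qed

text \<open>A permutation survives in the Leibniz formula only if \<open>b i = g (b (p i))\<close>
  throughout. This forces \<open>A\<close> to be contained in its image under \<open>g\<close>; then
  exactly one permutation qualifies.\<close>

lemma det_perm_matrix:
  fixes b :: "nat \<Rightarrow> 'a"
  assumes b: "bij_betw b {0..<k} A" and g: "inj_on g A"
  shows "det (mat k k (\<lambda>(i, j). if b i = g (b j) then 1 else 0)) =
    (if g ` A = A then of_int (sign (restrict_id g A)) else 0 :: complex)"
proof -
  let ?M = "mat k k (\<lambda>(i, j). if b i = g (b j) then 1 else 0) :: complex mat"
  have binj: "inj_on b {0..<k}" and bA: "b ` {0..<k} = A" using b by (auto simp: bij_betw_def)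
  have finA: "finite A" unfolding bA[symmetric] by simp
  have "det ?M = (\<Sum>p | p permutes {0..<k}. of_int (sign p) * (\<Prod>i = 0..<k. ?M $$ (i, p i)))"
    by (rule det_def') simp
  also have "\<dots> = (\<Sum>p | p permutes {0..<k}. if \<forall>i\<in>{0..<k}. b i = g (b (p i)) then of_int (sign p) else 0)"
  proof (intro sum.cong refl)
    fix p assume "p \<in> {p. p permutes {0..<k}}"
    then have p: "p i < k" if "i < k" for i using that permutes_in_image[of p "{0..<k}" i] by auto
    have "(\<Prod>i = 0..<k. ?M $$ (i, p i)) = (\<Prod>i = 0..<k. if b i = g (b (p i)) then 1 else 0)"
      using p by (intro prod.cong) auto
    also have "\<dots> = (if \<forall>i\<in>{0..<k}. b i = g (b (p i)) then 1 else 0)"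
      by (auto intro: prod_zero)
    finally show "of_int (sign p) * (\<Prod>i = 0..<k. ?M $$ (i, p i)) =
        (if \<forall>i\<in>{0..<k}. b i = g (b (p i)) then of_int (sign p) else 0)" by simp
  qed
  also have "\<dots> = (if g ` A = A then of_int (sign (restrict_id g A)) else 0)"
  proof (cases "g ` A = A")
    case False
    have no: "\<not> (\<forall>i\<in>{0..<k}. b i = g (b (p i)))" if p: "p permutes {0..<k}" for p
    proof
      assume all: "\<forall>i\<in>{0..<k}. b i = g (b (p i))"
      have "A \<subseteq> g ` A"
      proof
        fix a assume "a \<in> A"
        then obtain i where i: "i \<in> {0..<k}" "a = b i" using bA by blast
        then have "a = g (b (p i))" using all by blast
        then show "a \<in> g ` A" using permutes_in_image[OF p, of i] i bA by blast
      qed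
      then show False using False finA card_image[OF g] by (metis card_subset_eq finite_imageI)
    qed
    have "(\<Sum>p | p permutes {0..<k}. if \<forall>i\<in>{0..<k}. b i = g (b (p i)) then of_int (sign p) else 0 :: complex) = 0"
    proof (rule sum.neutral, rule ballI)
      fix p assume "p \<in> {p. p permutes {0..<k}}"
      then show "(if \<forall>i\<in>{0..<k}. b i = g (b (p i)) then of_int (sign p) else 0 :: complex) = 0"
        using no[of p] by (simp only: if_False mem_Collect_eq)
    qed
    then show ?thesis using False by simp
  next
    case True
    \<comment> \<open>\<open>q\<close> is \<open>g\<close> on \<open>A\<close> transported to the
      indices. The surviving permutation is its inverse, since \<open>p\<close> sends rows to
      columns whereas \<open>g\<close> sends columns to rows; the sign is the same.\<close>
    define q where "q = map_permutation A (inv_into {0..<k} b) (restrict_id g A)"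
    have rp: "restrict_id g A permutes A" by (rule restrict_id_permutation(1)[OF finA g True])
    have bi: "bij_betw (inv_into {0..<k} b) A {0..<k}" by (rule bij_betw_inv_into[OF b])
    have q: "q permutes {0..<k}" unfolding q_def by (rule map_permutation_permutes[OF bi rp])
    have sq: "sign q = sign (restrict_id g A)" unfolding q_def
      using bi rp finA by (intro sign_map_permutation) (auto simp: bij_betw_def)
    have bq: "b (q j) = g (b j)" if j: "j \<in> {0..<k}" for j
    proof -
      have bj: "b j \<in> A" using bA j by blast
      have "q j = q (inv_into {0..<k} b (b j))" using binj j by simp
      also have "\<dots> = inv_into {0..<k} b (restrict_id g A (b j))"
        unfolding q_def using bi bj by (intro map_permutation_apply) (auto simp: bij_betw_def)
      also have "\<dots> = inv_into {0..<k} b (g (b j))" using bj by simp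
      finally have "q j = inv_into {0..<k} b (g (b j))" .
      moreover have "g (b j) \<in> b ` {0..<k}" using bj True bA by blast
      ultimately show ?thesis by (simp only: f_inv_into_f)
    qed
    have "(\<forall>i\<in>{0..<k}. b i = g (b (p i))) \<longleftrightarrow> p = inv_into UNIV q" if p: "p permutes {0..<k}" for p
    proof
      assume all: "\<forall>i\<in>{0..<k}. b i = g (b (p i))"
      show "p = inv_into UNIV q"
      proof
        fix i
        have "q (p i) = i"
        proof (cases "i \<in> {0..<k}")
          case True
          then have pi: "p i \<in> {0..<k}" using permutes_in_image[OF p] by blast
          have "b i = b (q (p i))" using all True bq[OF pi] by simp
          then show ?thesis
            using binj True permutes_in_image[OF q, of "p i"] pi by (auto simp: inj_on_def)
        next
          case False
          then show ?thesis using permutes_not_in[OF p False] permutes_not_in[OF q False] by simp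
        qed
        then show "p i = inv_into UNIV q i" using permutes_inverses(2)[OF q, of "p i"] by simp
      qed
    next
      assume pq: "p = inv_into UNIV q"
      show "\<forall>i\<in>{0..<k}. b i = g (b (p i))"
      proof
        fix i assume i: "i \<in> {0..<k}"
        then have "p i \<in> {0..<k}" using permutes_in_image[OF p] by blast
        then show "b i = g (b (p i))" using bq[of "p i"] permutes_inverses(1)[OF q, of i] pq by simp
      qed
    qed
    then have "(\<Sum>p | p permutes {0..<k}. if \<forall>i\<in>{0..<k}. b i = g (b (p i)) then of_int (sign p) else 0 :: complex) =
        (\<Sum>p | p permutes {0..<k}. if p = inv_into UNIV q then of_int (sign p) else 0)"
      by (intro sum.cong) auto
    also have "\<dots> = of_int (sign (inv_into UNIV q))"
      using permutes_inv[OF q] by (simp add: finite_permutations)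
    also have "sign (inv_into UNIV q) = sign (restrict_id g A)"
      using sign_inverse[of q] permutes_imp_permutation[OF _ q] sq by simp
    finally show ?thesis using True by simp
  qed
  finally show ?thesis .
qed

text \<open>The trace is the sum of the principal minors of size \<open>k\<close>, and the minor at
  the index set of \<open>A\<close> is the determinant of the matrix by which \<open>g\<close>
  permutes \<open>A\<close>, or 0 if \<open>A\<close> is not invariant.\<close>

lemma trace_exterior_eta:
  assumes P: "finite P" and g: "bij_betw g P P"
  shows "mat_trace (exterior_power_mat k (eta P g)) =
    (\<Sum>A | A \<subseteq> P \<and> g ` A = A \<and> card A = k. of_int (sign (restrict_id g A)))"
proof -
  let ?n = "card P" and ?e = "from_nat_into P"
  let ?B = "{S. S \<subseteq> {..<?n} \<and> card S = k}"
  have e: "bij_betw ?e {..<?n} P" by (rule bij_betw_from_nat_into_finite[OF P])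
  have finB: "finite ?B" by simp
  have dims: "dim_row (eta P g) = ?n" "dim_col (eta P g) = ?n" by (auto simp: eta_def perm_rep_def)
  have ginj: "inj_on g A" if "A \<subseteq> P" for A using g that inj_on_subset by (auto simp: bij_betw_def)
  have det: "det (submatrix (eta P g) S S) =
      (if g ` (?e ` S) = ?e ` S then of_int (sign (restrict_id g (?e ` S))) else 0)" if S: "S \<in> ?B" for S
  proof -
    have fS: "finite S" and Sn: "S \<subseteq> {..<?n}" using S finite_subset by auto
    have c: "card {i. i < ?n \<and> i \<in> S} = k"
    proof -
      have "{i. i < ?n \<and> i \<in> S} = S" using Sn by blast
      then show ?thesis using S by simp
    qed
    have pk: "bij_betw (pick S) {0..<k} S" using bij_betw_pick[OF fS] S by simp
    then have pn: "pick S i < ?n" if "i < k" for i using Sn that by (auto simp: bij_betw_def)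
    have "submatrix (eta P g) S S = mat k k (\<lambda>(i, j). if ?e (pick S i) = g (?e (pick S j)) then 1 else 0)"
      unfolding submatrix_def dims c by (rule eq_matI) (use pn in \<open>auto simp: eta_def perm_rep_def\<close>)
    moreover have "bij_betw (?e \<circ> pick S) {0..<k} (?e ` S)"
      using pk bij_betw_subset[OF e Sn] by (intro bij_betw_trans) auto
    moreover have "?e ` S \<subseteq> P" using Sn e by (auto simp: bij_betw_def)
    ultimately show ?thesis
      using det_perm_matrix[of "?e \<circ> pick S" k "?e ` S" g] ginj by simp
  qed
  have "mat_trace (exterior_power_mat k (eta P g)) =
      (\<Sum>i<card ?B. det (submatrix (eta P g) (from_nat_into ?B i) (from_nat_into ?B i)))"
    unfolding exterior_power_mat_def mat_trace_def dims Let_def by simp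
  also have "\<dots> = (\<Sum>S\<in>?B. det (submatrix (eta P g) S S))"
    by (rule sum.reindex_bij_betw[OF bij_betw_from_nat_into_finite[OF finB]])
  also have "\<dots> = (\<Sum>S\<in>?B. if g ` (?e ` S) = ?e ` S then of_int (sign (restrict_id g (?e ` S))) else 0)"
    by (intro sum.cong refl det)
  also have "\<dots> = (\<Sum>A | A \<subseteq> P \<and> card A = k. if g ` A = A then of_int (sign (restrict_id g A)) else 0)"
  proof (rule sum.reindex_bij_betw)
    have einj: "inj_on ?e {..<?n}" and eP: "?e ` {..<?n} = P" using e by (auto simp: bij_betw_def)
    show "bij_betw ((`) ?e) ?B {A. A \<subseteq> P \<and> card A = k}"
    proof (rule bij_betw_imageI)
      show "inj_on ((`) ?e) ?B"
        using inj_on_image_eq_iff[OF einj] by (intro inj_onI) blast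
      show "(`) ?e ` ?B = {A. A \<subseteq> P \<and> card A = k}"
      proof
        show "(`) ?e ` ?B \<subseteq> {A. A \<subseteq> P \<and> card A = k}"
          using eP card_image[OF inj_on_subset[OF einj]] by auto
        show "{A. A \<subseteq> P \<and> card A = k} \<subseteq> (`) ?e ` ?B"
        proof safe
          fix A assume A: "A \<subseteq> P" "k = card A"
          then obtain S where S: "S \<subseteq> {..<?n}" "A = ?e ` S" using eP by (metis subset_imageE)
          then show "A \<in> (`) ?e ` {S. S \<subseteq> {..<?n} \<and> card S = card A}"
            using card_image[OF inj_on_subset[OF einj S(1)]] by auto
        qed
      qed
    qed
  qed
  also have "\<dots> = (\<Sum>A | A \<subseteq> P \<and> g ` A = A \<and> card A = k. of_int (sign (restrict_id g A)))"
    using P by (subst sum.inter_filter[symmetric]) (auto intro: sum.cong)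
  finally show ?thesis .
qed

lemma fps_const_sum: "fps_const (\<Sum>x\<in>A. f x) = (\<Sum>x\<in>A. fps_const (f x))"
proof (rule fps_ext)
  fix n show "fps_nth (fps_const (\<Sum>x\<in>A. f x)) n = fps_nth (\<Sum>x\<in>A. fps_const (f x)) n"
    by (cases "n = 0") (simp_all add: fps_sum_nth)
qed

lemma exterior_series:
  assumes P: "finite P" and g: "bij_betw g P P"
  shows "(\<Sum>i\<le>card P. fps_const ((-1) ^ i * mat_trace (exterior_power_mat i (eta P g))) * fps_X ^ i) =
    (\<Sum>A | A \<subseteq> P \<and> g ` A = A. of_int (signed_weight g A) * fps_X ^ card A)"
proof -
  let ?S = "{A. A \<subseteq> P \<and> g ` A = A}"
  have "(\<Sum>i\<le>card P. fps_const ((-1) ^ i * mat_trace (exterior_power_mat i (eta P g))) * fps_X ^ i) =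
      (\<Sum>i\<le>card P. \<Sum>A\<in>{A \<in> ?S. card A = i}. of_int (signed_weight g A) * fps_X ^ card A)"
  proof (intro sum.cong refl)
    fix i
    have "(-1) ^ i * mat_trace (exterior_power_mat i (eta P g)) =
        (\<Sum>A\<in>{A \<in> ?S. card A = i}. of_int (signed_weight g A))"
      unfolding trace_exterior_eta[OF assms] sum_distrib_left
      by (intro sum.cong) (auto simp: signed_weight_def)
    then have "fps_const ((-1) ^ i * mat_trace (exterior_power_mat i (eta P g))) =
        (\<Sum>A\<in>{A \<in> ?S. card A = i}. fps_const (of_int (signed_weight g A)))"
      by (simp only: fps_const_sum)
    then show "fps_const ((-1) ^ i * mat_trace (exterior_power_mat i (eta P g))) * fps_X ^ i =
        (\<Sum>A\<in>{A \<in> ?S. card A = i}. of_int (signed_weight g A) * fps_X ^ card A)"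
      by (simp add: sum_distrib_right fps_of_int)
  qed
  also have "\<dots> = (\<Sum>A\<in>?S. of_int (signed_weight g A) * fps_X ^ card A)"
    by (rule sum.group) (use P in \<open>auto intro: card_mono\<close>)
  finally show ?thesis .
qed

section \<open>Graded posets and the theorem\<close>

context finite_poset
begin

lemma cover_above:
  assumes "(y, x) \<in> r" "y \<noteq> x"
  obtains z where "covers P r z x" "(y, z) \<in> r"
proof -
  have "partial_order_on P (r\<inverse>)" using po by simp
  then interpret dual: finite_poset P "r\<inverse>"
    using finite_P by unfold_locales
  obtain z where "covers P (r\<inverse>) x z" "(z, y) \<in> r\<inverse>"
    using dual.cover_below[of x y] assms by auto
  then show ?thesis using that by (auto simp: covers_def)
qed

lemma saturated_comparable:
  assumes "saturated_chain P r d" "z \<in> set d" "w \<in> set d"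
  shows "(z, w) \<in> r \<or> (w, z) \<in> r"
proof -
  have "successively (\<lambda>x y. (x, y) \<in> r) d"
    using assms(1) unfolding saturated_chain_def by (auto simp: covers_def elim: successively_mono)
  then have s: "sorted_wrt (\<lambda>x y. (x, y) \<in> r) d"
    by (subst (asm) successively_iff_sorted_wrt_strong) (use r_trans in blast)+
  obtain i j where ij: "i < length d" "z = d ! i" "j < length d" "w = d ! j"
    using assms by (metis in_set_conv_nth)
  have "w \<in> P" using assms by (auto simp: saturated_chain_def)
  then show ?thesis
    using sorted_wrt_nth_less[OF s, of i j] sorted_wrt_nth_less[OF s, of j i] ij r_refl[of w]
    by (cases i j rule: linorder_cases) auto
qed

text \<open>A covering pair leaves no room between its elements: once \<open>z\<close> is above the
  first element and comparable with the next, it is above that one too. So a saturated chain can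
  only be refined at its ends.\<close>

lemma saturated_between:
  assumes "saturated_chain P r c" "z \<notin> set c" "z \<in> P" "(hd c, z) \<in> r"
    and "\<And>w. w \<in> set c \<Longrightarrow> (z, w) \<in> r \<or> (w, z) \<in> r"
  shows "(last c, z) \<in> r"
  using assms
proof (induction c rule: induct_list012)
  case (3 x y c)
  have xy: "covers P r x y" and s: "saturated_chain P r (y # c)"
    using "3.prems"(1) by (auto simp: saturated_chain_def)
  have "\<not> (z, y) \<in> r" using xy "3.prems" unfolding covers_def by auto
  then have "(y, z) \<in> r" using "3.prems"(5)[of y] by auto
  then show ?case using "3.IH"(2)[OF s] "3.prems" by auto
qed (auto simp: saturated_chain_def)

lemma maximal_saturatedI:
  assumes c: "saturated_chain P r c" and bot: "\<And>y. (y, hd c) \<in> r \<Longrightarrow> y = hd c"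
    and top: "\<And>y. (last c, y) \<in> r \<Longrightarrow> y = last c"
  shows "maximal_saturated_chain P r c"
  unfolding maximal_saturated_chain_def
proof (intro conjI notI)
  have ne: "c \<noteq> []" using c by (simp add: saturated_chain_def)
  assume "\<exists>d. saturated_chain P r d \<and> set c \<subset> set d"
  then obtain d z where d: "saturated_chain P r d" "set c \<subseteq> set d" "z \<in> set d" "z \<notin> set c" by blast
  have comp: "(z, w) \<in> r \<or> (w, z) \<in> r" if "w \<in> set c" for w
    using saturated_comparable[OF d(1,3)] that d(2) by blast
  have "hd c \<in> set c" "last c \<in> set c" using ne by auto
  then have "(hd c, z) \<in> r" using comp[of "hd c"] bot d(4) by metis
  moreover have "z \<in> P" using d by (auto simp: saturated_chain_def)
  ultimately have "(last c, z) \<in> r" using saturated_between[OF c d(4)] comp by blast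
  then show False using top d(4) \<open>last c \<in> set c\<close> by metis
qed (fact c)

lemma chain_up:
  assumes "x \<in> P"
  shows "\<exists>d. saturated_chain P r d \<and> hd d = x \<and> (\<forall>y. (last d, y) \<in> r \<longrightarrow> y = last d)"
  using assms
proof (induction "card {w. (x, w) \<in> r}" arbitrary: x rule: less_induct)
  case less
  show ?case
  proof (cases "\<forall>y. (x, y) \<in> r \<longrightarrow> y = x")
    case True
    then show ?thesis using less.prems by (intro exI[of _ "x # []"]) (auto simp: saturated_chain_def)
  next
    case False
    then obtain y where "(x, y) \<in> r" "x \<noteq> y" by blast
    then obtain z where z: "covers P r x z" using cover_below by blast
    then have xz: "(x, z) \<in> r" "x \<noteq> z" "z \<in> P" by (auto simp: covers_def)
    have "{w. (z, w) \<in> r} \<subset> {w. (x, w) \<in> r}"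
      using r_trans[OF xz(1)] r_antisym[OF xz(1)] xz(2) r_refl[OF less.prems] by blast
    moreover have "finite {w. (x, w) \<in> r}"
      by (rule finite_subset[OF _ finite_P]) (use r_in_P in auto)
    ultimately have "card {w. (z, w) \<in> r} < card {w. (x, w) \<in> r}" by (intro psubset_card_mono)
    then obtain d where "saturated_chain P r d" "hd d = z" "\<forall>y. (last d, y) \<in> r \<longrightarrow> y = last d"
      using less.hyps xz(3) by blast
    then show ?thesis using z less.prems
      by (intro exI[of _ "x # d"]) (auto simp: saturated_chain_def successively_Cons)
  qed
qed

lemma chain_down:
  assumes "x \<in> P"
  shows "\<exists>c. saturated_chain P r c \<and> last c = x \<and> (\<forall>y. (y, hd c) \<in> r \<longrightarrow> y = hd c)"
  using assms
proof (induction "card {w. (w, x) \<in> r}" arbitrary: x rule: less_induct)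
  case less
  show ?case
  proof (cases "\<forall>y. (y, x) \<in> r \<longrightarrow> y = x")
    case True
    then show ?thesis using less.prems by (intro exI[of _ "x # []"]) (auto simp: saturated_chain_def)
  next
    case False
    then obtain y where "(y, x) \<in> r" "y \<noteq> x" by blast
    then obtain z where z: "covers P r z x" using cover_above by blast
    then have zx: "(z, x) \<in> r" "z \<noteq> x" "z \<in> P" by (auto simp: covers_def)
    have "{w. (w, z) \<in> r} \<subset> {w. (w, x) \<in> r}"
      using r_trans[OF _ zx(1)] r_antisym[OF zx(1)] zx(2) r_refl[OF less.prems] by blast
    moreover have "finite {w. (w, x) \<in> r}"
      by (rule finite_subset[OF _ finite_P]) (use r_in_P in auto)
    ultimately have "card {w. (w, z) \<in> r} < card {w. (w, x) \<in> r}" by (intro psubset_card_mono)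
    then obtain c where "saturated_chain P r c" "last c = z" "\<forall>y. (y, hd c) \<in> r \<longrightarrow> y = hd c"
      using less.hyps zx(3) by blast
    then show ?thesis using z less.prems
      by (intro exI[of _ "c @ (x # [])"]) (auto simp: saturated_chain_def successively_append_iff)
  qed
qed

text \<open>All saturated chains from a minimal element up to \<open>x\<close> have equal length:
  continued by one fixed chain from \<open>x\<close> to a maximal element they become maximal
  saturated chains. This length less one is the rank. In \<open>glue\<close> the element
  \<open>x\<close> is counted twice, hence the second \<open>Suc\<close>.\<close>

lemma graded_ranked:
  assumes gr: "graded P r" and ne: "P \<noteq> {}"
  obtains \<rho> where "ranked_poset P r \<rho> (poset_rank P r)"
proof -
  obtain k where k: "\<And>c. maximal_saturated_chain P r c \<Longrightarrow> length c = Suc k"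
    using gr unfolding graded_def by blast
  define down where "down x c \<longleftrightarrow> saturated_chain P r c \<and> last c = x \<and> (\<forall>y. (y, hd c) \<in> r \<longrightarrow> y = hd c)" for x c
  define up where "up x d \<longleftrightarrow> saturated_chain P r d \<and> hd d = x \<and> (\<forall>y. (last d, y) \<in> r \<longrightarrow> y = last d)" for x d
  have glue: "length c + length d = Suc (Suc k)" if c: "down x c" and d: "up x d" for x c d
  proof -
    note c = c[unfolded down_def] and d = d[unfolded up_def]
    obtain d' where d': "d = x # d'" using d by (cases d) (auto simp: saturated_chain_def)
    have cne: "c \<noteq> []" using c by (simp add: saturated_chain_def)
    have "saturated_chain P r (c @ d')"
      using c d d' unfolding saturated_chain_def by (auto simp: successively_append_iff successively_Cons)
    moreover have "last (c @ d') = last d" using c d' cne by auto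
    moreover have "hd (c @ d') = hd c" using cne by simp
    ultimately have "maximal_saturated_chain P r (c @ d')" using c d by (intro maximal_saturatedI) auto
    then show ?thesis using k[of "c @ d'"] by (simp add: d')
  qed
  define \<rho> where "\<rho> x = length (SOME c. down x c) - 1" for x
  have down_ex: "down x (SOME c. down x c)" if "x \<in> P" for x
    using chain_down[OF that] unfolding down_def[symmetric] by (rule someI_ex)
  have len: "length c = Suc (\<rho> x)" if "down x c" for x c
  proof -
    have xP: "x \<in> P" using that by (auto simp: down_def saturated_chain_def)
    obtain d where d: "up x d" using chain_up[OF xP] unfolding up_def[symmetric] by blast
    have "length (SOME c. down x c) = length c"
      using glue[OF that d] glue[OF down_ex[OF xP] d] by simp
    moreover have "length c \<noteq> 0" using that by (auto simp: down_def saturated_chain_def)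
    ultimately show ?thesis by (simp add: \<rho>_def)
  qed
  have max_ex: "\<exists>c. maximal_saturated_chain P r c"
  proof -
    obtain x where "x \<in> P" using ne by blast
    then obtain d where d: "up x d" using chain_up unfolding up_def[symmetric] by blast
    have "last d \<in> P" using d by (auto simp: up_def saturated_chain_def)
    then obtain c where "down (last d) c" using chain_down unfolding down_def[symmetric] by blast
    then show ?thesis using d unfolding down_def up_def by (intro exI[of _ c] maximal_saturatedI) auto
  qed
  have R: "poset_rank P r = k"
    unfolding poset_rank_def using max_ex k by (intro the_equality) fastforce+
  have "ranked_poset P r \<rho> k"
  proof unfold_locales
    fix x y assume xy: "covers P r x y"
    then have P: "x \<in> P" "y \<in> P" by (auto simp: covers_def)
    obtain c where c: "down x c" using chain_down[OF P(1)] unfolding down_def[symmetric] by blast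
    then have "down y (c @ (y # []))"
      using xy P unfolding down_def saturated_chain_def by (auto simp: successively_append_iff)
    then show "\<rho> y = Suc (\<rho> x)" using len[OF c] len[of y "c @ (y # [])"] by simp
  next
    fix x assume "x \<in> P" "\<And>y. (y, x) \<in> r \<Longrightarrow> y = x"
    then have "down x (x # [])" by (auto simp: down_def saturated_chain_def)
    then show "\<rho> x = 0" using len by fastforce
  next
    fix x assume x: "x \<in> P" "\<And>y. (x, y) \<in> r \<Longrightarrow> y = x"
    then have "up x (x # [])" by (auto simp: up_def saturated_chain_def)
    then show "\<rho> x = k" using glue[OF down_ex[OF x(1)]] len[OF down_ex[OF x(1)]] by fastforce
  qed (fact ne)
  then show ?thesis using that R by simp
qed

end

context ranked_poset
begin

text \<open>The rank after an automorphism is strictly increasing along covers, so it bounds the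
  rank from above. Applying this to \<open>g\<close> and to its inverse gives equality.\<close>

lemma rank_autI:
  assumes g: "bij_betw g P P" and r: "\<And>x y. x \<in> P \<Longrightarrow> y \<in> P \<Longrightarrow> (g x, g y) \<in> r \<longleftrightarrow> (x, y) \<in> r"
  shows "rank_aut g"
proof -
  have le: "\<rho> x \<le> \<rho> (f x)" if f: "bij_betw f P P" "\<And>x y. x \<in> P \<Longrightarrow> y \<in> P \<Longrightarrow> (f x, f y) \<in> r \<longleftrightarrow> (x, y) \<in> r"
    and x: "x \<in> P" for f x
  proof (rule rank_le_strict[OF x])
    fix u v assume uv: "covers P r u v"
    then have P: "u \<in> P" "v \<in> P" and "(u, v) \<in> r" "u \<noteq> v" by (auto simp: covers_def)
    then have "(f u, f v) \<in> r" "f u \<noteq> f v" using f by (auto simp: bij_betw_def inj_on_def)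
    then show "\<rho> (f u) < \<rho> (f v)" by (rule rank_strict_mono)
  qed
  let ?h = "inv_into P g"
  have h: "bij_betw ?h P P" by (rule bij_betw_inv_into[OF g])
  have gh: "?h x \<in> P" "g (?h x) = x" "?h (g x) = x" "g x \<in> P" if "x \<in> P" for x
    using that g by (auto simp: bij_betw_def inv_into_into f_inv_into_f)
  have hr: "(?h x, ?h y) \<in> r \<longleftrightarrow> (x, y) \<in> r" if "x \<in> P" "y \<in> P" for x y
    using r[OF gh(1)[OF that(1)] gh(1)[OF that(2)]] gh(2) that by simp
  have "\<rho> (g x) = \<rho> x" if x: "x \<in> P" for x
    using le[OF g r x] le[OF h hr gh(4)[OF x]] gh(3)[OF x] by simp
  then show ?thesis using g r by (simp add: rank_aut_def)
qed

end

section \<open>The automorphism group, uniqueness of the expansion, and evaluation at group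
  elements\<close>

lemma group_poset_aut:
  assumes r: "r \<subseteq> P \<times> P"
  shows "group (poset_aut P r)"
proof -
  let ?A = "{f \<in> Bij P. \<forall>x\<in>P. \<forall>y\<in>P. (f x, f y) \<in> r \<longleftrightarrow> (x, y) \<in> r}"
  interpret B: group "BijGroup P" by (rule group_BijGroup)
  have "subgroup ?A (BijGroup P)"
  proof (rule B.subgroupI)
    show "?A \<subseteq> carrier (BijGroup P)" by (auto simp: BijGroup_def)
    have "(\<lambda>x\<in>P. x) \<in> ?A" by (auto simp: id_Bij)
    then show "?A \<noteq> {}" by blast
  next
    fix f assume f: "f \<in> ?A"
    then have fB: "f \<in> Bij P" by simp
    have i: "inv_into P f x \<in> P" "f (inv_into P f x) = x" if "x \<in> P" for x
      using fB that by (auto simp: Bij_def bij_betw_def inv_into_into f_inv_into_f)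
    have "(inv_into P f x, inv_into P f y) \<in> r \<longleftrightarrow> (x, y) \<in> r" if "x \<in> P" "y \<in> P" for x y
    proof -
      have "(f (inv_into P f x), f (inv_into P f y)) \<in> r \<longleftrightarrow> (inv_into P f x, inv_into P f y) \<in> r"
        using f i(1)[OF that(1)] i(1)[OF that(2)] by blast
      then show ?thesis using i(2) that by simp
    qed
    then show "inv\<^bsub>BijGroup P\<^esub> f \<in> ?A"
      unfolding inv_BijGroup[OF fB] using restrict_inv_into_Bij[OF fB] by simp
  next
    fix f h assume fh: "f \<in> ?A" "h \<in> ?A"
    then have "f x \<in> P" "h x \<in> P" if "x \<in> P" for x using that Bij_imp_funcset by blast+
    then show "f \<otimes>\<^bsub>BijGroup P\<^esub> h \<in> ?A"
      using fh by (auto simp: BijGroup_def compose_Bij compose_eq)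
  qed
  then show ?thesis unfolding poset_aut_def by (rule subgroup.subgroup_is_group[OF _ group_BijGroup])
qed

text \<open>The i-th basis polynomial begins with X^i with coefficient 1, so comparing coefficients
  is a unitriangular system. The coefficient ring is general because it is applied to class
  functions.\<close>

lemma gamma_expansion_unique:
  fixes a b :: "nat \<Rightarrow> 'b::comm_ring_1"
  assumes "(\<Sum>i\<le>k. fps_const (a i) * fps_X ^ i * (1 + fps_X) ^ (s - 2 * i)) =
      (\<Sum>i\<le>k. fps_const (b i) * fps_X ^ i * (1 + fps_X) ^ (s - 2 * i))"
  shows "i \<le> k \<Longrightarrow> a i = b i"
proof (induction i rule: less_induct)
  case (less i)
  have one: "fps_nth ((1 + fps_X :: 'b fps) ^ m) 0 = 1" for m by (simp add: fps_nth_power_0)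
  have nth: "fps_nth (\<Sum>j\<le>k. fps_const (c j) * fps_X ^ j * (1 + fps_X) ^ (s - 2 * j)) i =
      (\<Sum>j<i. c j * fps_nth ((1 + fps_X) ^ (s - 2 * j)) (i - j)) + c i" for c :: "nat \<Rightarrow> 'b"
  proof -
    have t: "fps_nth (fps_const (c j) * fps_X ^ j * (1 + fps_X) ^ (s - 2 * j)) i =
        (if i < j then 0 else c j * fps_nth ((1 + fps_X) ^ (s - 2 * j)) (i - j))" for j
      by (simp add: mult.assoc fps_X_power_mult_nth)
    have "fps_nth (\<Sum>j\<le>k. fps_const (c j) * fps_X ^ j * (1 + fps_X) ^ (s - 2 * j)) i =
        (\<Sum>j\<le>k. if i < j then 0 else c j * fps_nth ((1 + fps_X) ^ (s - 2 * j)) (i - j))"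
      unfolding fps_sum_nth t ..
    also have "\<dots> = (\<Sum>j\<le>i. c j * fps_nth ((1 + fps_X) ^ (s - 2 * j)) (i - j))"
      using less.prems by (intro sum.mono_neutral_cong_right) auto
    also have "\<dots> = (\<Sum>j<i. c j * fps_nth ((1 + fps_X) ^ (s - 2 * j)) (i - j)) + c i"
      by (simp add: lessThan_Suc_atMost[symmetric] one)
    finally show ?thesis .
  qed
  have "(\<Sum>j<i. a j * fps_nth ((1 + fps_X) ^ (s - 2 * j)) (i - j)) =
      (\<Sum>j<i. b j * fps_nth ((1 + fps_X) ^ (s - 2 * j)) (i - j))"
    using less by (intro sum.cong) auto
  then show ?case using arg_cong[OF assms, of "\<lambda>f. fps_nth f i"] unfolding nth by simp
qed

text \<open>Evaluation at \<open>g\<close> is a ring homomorphism, since functions on the group are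
  multiplied pointwise; it reduces identities over class functions to identities of complex
  series.\<close>

definition fps_at :: "'g \<Rightarrow> ('g \<Rightarrow> complex) fps \<Rightarrow> complex fps" where
  "fps_at g F = Abs_fps (\<lambda>n. fps_nth F n g)"

lemma fps_at_eqI:
  assumes "\<And>g. fps_at g F = fps_at g H" shows "F = H"
proof (rule fps_ext, rule ext)
  fix n g show "fps_nth F n g = fps_nth H n g"
    using arg_cong[OF assms[of g], of "\<lambda>f. fps_nth f n"] by (simp add: fps_at_def)
qed

lemma fps_at_mult: "fps_at g (F * H) = fps_at g F * fps_at g H"
  by (rule fps_ext) (simp add: fps_at_def fps_mult_nth sum_fun_apply)

lemma fps_at_add: "fps_at g (F + H) = fps_at g F + fps_at g H"
  and fps_at_diff: "fps_at g (F - H) = fps_at g F - fps_at g H"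
  by (rule fps_ext, simp add: fps_at_def)+

lemma fps_at_const: "fps_at g (fps_const c) = fps_const (c g)"
  by (rule fps_ext) (simp add: fps_at_def)

lemma fps_at_one: "fps_at g 1 = 1"
  by (rule fps_ext) (simp add: fps_at_def)

lemma fps_at_X: "fps_at g fps_X = fps_X"
  by (rule fps_ext) (simp add: fps_at_def fps_X_def)

lemma fps_at_power: "fps_at g (F ^ k) = fps_at g F ^ k"
  by (induction k) (simp_all add: fps_at_one fps_at_mult)

lemma fps_at_sum: "fps_at g (\<Sum>i\<in>A. F i) = (\<Sum>i\<in>A. fps_at g (F i))"
  by (rule fps_ext) (simp add: fps_at_def fps_sum_nth sum_fun_apply)

lemmas fps_at_simps = fps_at_mult fps_at_add fps_at_diff fps_at_const fps_at_one fps_at_X fps_at_power fps_at_sum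

lemma trace_perm_rep:
  assumes "finite X"
  shows "mat_trace (perm_rep X act g) = of_nat (card {x \<in> X. act g x = x})"
proof -
  have "mat_trace (perm_rep X act g) =
      (\<Sum>i<card X. if from_nat_into X i = act g (from_nat_into X i) then 1 else 0)"
    by (simp add: mat_trace_def perm_rep_def)
  also have "\<dots> = (\<Sum>x\<in>X. if x = act g x then 1 else 0)"
    by (rule sum.reindex_bij_betw[OF bij_betw_from_nat_into_finite[OF assms]])
  also have "\<dots> = of_nat (card {x \<in> X. act g x = x})"
  proof -
    have "X \<inter> {x. x = act g x} = {x \<in> X. act g x = x}" by auto
    then show ?thesis using assms by (simp add: sum.If_cases)
  qed
  finally show ?thesis .
qed

lemma fps_at_equivariant_h_star:
  assumes "finite P" "\<And>m. finite (lattice_points P r m)" "g \<in> G" "bij_betw g P P"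
  shows "fps_at g (equivariant_h_star P r G) =
    Abs_fps (\<lambda>m. of_nat (card {f \<in> lattice_points P r m. translate P g f = f})) * (1 - fps_X) *
    (\<Sum>A | A \<subseteq> P \<and> g ` A = A. of_int (signed_weight g A) * fps_X ^ card A)"
proof -
  have "fps_at g (Abs_fps (lattice_character P r G)) =
      Abs_fps (\<lambda>m. of_nat (card {f \<in> lattice_points P r m. translate P g f = f}))"
    using assms(3) trace_perm_rep[OF assms(2)]
    by (intro fps_ext) (simp add: fps_at_def lattice_character_def character_of_def)
  moreover have pw: "((-1) ^ i :: ('a \<Rightarrow> 'a) \<Rightarrow> complex) g = (-1) ^ i" for i
    by (induction i) auto
  have "fps_at g (\<Sum>i\<le>card P. fps_const ((-1) ^ i * exterior_character P r G i) * fps_X ^ i) =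
      (\<Sum>i\<le>card P. fps_const ((-1) ^ i * mat_trace (exterior_power_mat i (eta P g))) * fps_X ^ i)"
    unfolding fps_at_simps
    using assms(3) pw by (simp add: exterior_character_def character_of_def)
  ultimately show ?thesis
    unfolding equivariant_h_star_def fps_at_mult exterior_series[OF assms(1,4)]
    by (simp add: fps_at_simps)
qed

lemma fps_at_equivariant_h_star_outside:
  assumes "g \<notin> G" shows "fps_at g (equivariant_h_star P r G) = 0"
proof -
  have "fps_at g (Abs_fps (lattice_character P r G)) = 0"
    using assms by (intro fps_ext) (simp add: fps_at_def lattice_character_def character_of_def)
  then show ?thesis unfolding equivariant_h_star_def fps_at_mult by simp
qed

text \<open>One family of characters with the right values suffices: uniqueness makes every virtual
  family equal to it. Outside \<open>G\<close> both sides vanish because characters are extended by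
  zero.\<close>

lemma gamma_effectiveI:
  assumes G: "group (group_on P r G)"
    and char: "\<And>i. \<gamma> i \<in> characters (group_on P r G)"
    and at: "\<And>g. g \<in> G \<Longrightarrow> fps_at g (equivariant_h_star P r G) =
      (\<Sum>i\<le>s div 2. fps_const (\<gamma> i g) * fps_X ^ i * (1 + fps_X) ^ (s - 2 * i))"
  shows "(\<exists>\<gamma>. gamma_expansion (group_on P r G) s (equivariant_h_star P r G) \<gamma>) \<and>
    (\<forall>\<gamma>. gamma_expansion (group_on P r G) s (equivariant_h_star P r G) \<gamma> \<longrightarrow>
      (\<forall>i\<le>s div 2. effective (group_on P r G) (\<gamma> i) \<and> \<gamma> i \<in> characters (group_on P r G)))"
proof -
  let ?\<Gamma> = "group_on P r G" and ?h = "equivariant_h_star P r G"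
  have eff: "effective ?\<Gamma> (\<gamma> i)" for i using char effective_iff_character[OF G] by blast
  have zero: "\<gamma> i g = 0" if "g \<notin> G" for i g
    using char[of i] that by (auto simp: characters_def character_of_def)
  have h: "?h = (\<Sum>i\<le>s div 2. fps_const (\<gamma> i) * fps_X ^ i * (1 + fps_X) ^ (s - 2 * i))"
  proof (rule fps_at_eqI)
    fix g
    show "fps_at g ?h = fps_at g (\<Sum>i\<le>s div 2. fps_const (\<gamma> i) * fps_X ^ i * (1 + fps_X) ^ (s - 2 * i))"
      using at[of g] fps_at_equivariant_h_star_outside[of g G P r] zero[of g]
      by (cases "g \<in> G") (simp_all add: fps_at_simps)
  qed
  then have "gamma_expansion ?\<Gamma> s ?h \<gamma>"
    unfolding gamma_expansion_def using eff effective_imp_virtual by blast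
  moreover have "\<gamma>' i = \<gamma> i" if "gamma_expansion ?\<Gamma> s ?h \<gamma>'" "i \<le> s div 2" for \<gamma>' i
    using gamma_expansion_unique[where k = "s div 2" and a = \<gamma>' and s = s and b = \<gamma> and i = i] that h unfolding gamma_expansion_def by simp
  ultimately show ?thesis using eff char by metis
qed

theorem theorem4p5:
  fixes P :: "'a set" and r :: "'a rel" and G :: "('a \<Rightarrow> 'a) set" and s :: nat
  assumes "finite P" and "partial_order_on P r" and "graded P r"
    and "subgroup G (poset_aut P r)"
    and "s = card P - poset_rank P r - 1"
  shows "(\<exists>\<gamma>. gamma_expansion (group_on P r G) s (equivariant_h_star P r G) \<gamma>) \<and>
    (\<forall>\<gamma>. gamma_expansion (group_on P r G) s (equivariant_h_star P r G) \<gamma> \<longrightarrow>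
      (\<forall>i\<le>s div 2. effective (group_on P r G) (\<gamma> i) \<and>
                     \<gamma> i \<in> characters (group_on P r G)))"
proof -
  let ?\<Gamma> = "group_on P r G"
  interpret finite_poset P r using assms by unfold_locales
  have "r \<subseteq> P \<times> P" by (rule partial_order_onD(4)[OF po])
  then have "group (poset_aut P r)" by (rule group_poset_aut)
  then have G: "group ?\<Gamma>" by (rule subgroup.subgroup_is_group[OF assms(4)])
  have sub: "G \<subseteq> carrier (poset_aut P r)" by (rule subgroup.subset[OF assms(4)])
  have gB: "g \<in> Bij P" and gr: "\<And>x y. x \<in> P \<Longrightarrow> y \<in> P \<Longrightarrow> (g x, g y) \<in> r \<longleftrightarrow> (x, y) \<in> r"
    if "g \<in> G" for g
    using sub that by (auto simp: poset_aut_def)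
  have gbij: "bij_betw g P P" if "g \<in> G" for g using gB[OF that] by (simp add: Bij_def)
  show ?thesis
  proof (cases "P = {}")
    case True
    \<comment> \<open>The rank of the empty poset is unspecified, but truncated subtraction from
      \<open>card P = 0\<close> gives 0 in any case. Every dilate then has one lattice point and the
      series is the constant 1, the trivial character.\<close>
    have s0: "s = 0" using assms(5) True by simp
    have LP: "lattice_points P r m = {\<lambda>_. undefined}" for m
    proof -
      have "order_polytope P r = {\<lambda>_. undefined}" unfolding order_polytope_def True by auto
      then show ?thesis unfolding lattice_points_def True by (simp add: restrict_def)
    qed
    show ?thesis
    proof (rule gamma_effectiveI[OF G, where \<gamma> = "\<lambda>_. on_carrier ?\<Gamma> (\<lambda>_. 1)"])
      have "index_rep ?\<Gamma> {()} (\<lambda>_ _ _. 1)" by (simp add: index_rep_def)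
      from index_rep_character[OF G this]
      show "on_carrier ?\<Gamma> (\<lambda>_. 1) \<in> characters ?\<Gamma>" by simp
      fix g assume g: "g \<in> G"
      have geo: "Abs_fps (\<lambda>m. 1) * (1 - fps_X) = (1 :: complex fps)"
      proof (rule fps_ext)
        fix n show "fps_nth (Abs_fps (\<lambda>m. 1) * (1 - fps_X)) n = fps_nth (1 :: complex fps) n"
          by (cases n) (simp_all add: right_diff_distrib)
      qed
      have "{f \<in> lattice_points P r m. translate P g f = f} = {\<lambda>_. undefined}" for m
        unfolding LP by (auto simp: translate_def restrict_def True)
      moreover have "{A. A \<subseteq> P \<and> g ` A = A} = {{}}" using True by auto
      ultimately show "fps_at g (equivariant_h_star P r G) =
          (\<Sum>i\<le>s div 2. fps_const (on_carrier ?\<Gamma> (\<lambda>_. 1) g) * fps_X ^ i * (1 + fps_X) ^ (s - 2 * i))"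
        using fps_at_equivariant_h_star[OF finite_P _ g gbij[OF g], of r] g geo LP s0
        by (simp add: on_carrier_def)
    qed
  next
    case False
    obtain \<rho> where "ranked_poset P r \<rho> (poset_rank P r)"
      using graded_ranked[OF assms(3) False] by blast
    then interpret ranked_poset P r \<rho> "poset_rank P r" .
    have aut: "rank_aut g" if "g \<in> G" for g by (rule rank_autI[OF gbij[OF that] gr[OF that]])
    define b where "b w = on_carrier ?\<Gamma> (\<lambda>g. \<Sum>T\<in>Pow (doms 1 w). (-1) ^ card (doms 1 w - T) *
        of_nat (card (fixed_chains g (starts 1 w) T False {})))" for w
    define \<gamma> where "\<gamma> i = (\<Sum>w\<in>gamma_words i. b w)" for i
    show ?thesis
    proof (rule gamma_effectiveI[OF G, where \<gamma> = \<gamma>])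
      fix i
      have P1: "1 \<le> card P" using False finite_P by (simp add: Suc_leI card_gt_0_iff)
      have "b w \<in> characters ?\<Gamma>" if w: "w \<in> gamma_words i" for w
        unfolding b_def
      proof (rule chain_character[OF G])
        show "rank_aut g" if "g \<in> carrier ?\<Gamma>" for g using aut that by simp
        show "(g \<otimes>\<^bsub>?\<Gamma>\<^esub> h) x = g (h x)" if "g \<in> carrier ?\<Gamma>" "h \<in> carrier ?\<Gamma>" "x \<in> P" for g h x
          using that gB[of g] gB[of h] by (simp add: poset_aut_def BijGroup_def compose_def)
        show "\<one>\<^bsub>?\<Gamma>\<^esub> x = x" if "x \<in> P" for x
          using that by (simp add: poset_aut_def BijGroup_def)
        show "doms 1 w \<subseteq> {..card P}"
          using doms_less[of w "card P - 1" _ 1] w P1 by (fastforce simp: gamma_words_def)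
      qed (simp_all add: finite_doms finite_starts doms_starts_disjoint)
      then show "\<gamma> i \<in> characters ?\<Gamma>" unfolding \<gamma>_def by (intro sum_characters[OF G])
    next
      fix g assume g: "g \<in> G"
      interpret ranked_poset_aut P r \<rho> "poset_rank P r" g
        using aut[OF g] by unfold_locales
      have bg: "b w g = of_int (beta (doms 1 w) (starts 1 w) False {})" for w
        using g by (simp add: b_def on_carrier_def beta_def)
      have "fps_at g (equivariant_h_star P r G) = (1 - fps_X) * wgt P *
          Abs_fps (\<lambda>m. of_nat (card {f \<in> lattice_points P r m. translate P g f = f}))"
        using fps_at_equivariant_h_star[OF finite_P finite_lattice_points g gbij[OF g]]
        by (simp add: wgt_def invsubs_def mult_ac)
      also have "\<dots> = (\<Sum>i\<le>s div 2. of_int (\<Sum>w\<in>gamma_words i. beta (doms 1 w) (starts 1 w) False {}) *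
          fps_X ^ i * (1 + fps_X) ^ (s - 2 * i))"
        by (rule gamma_identity[OF assms(5)])
      also have "\<dots> = (\<Sum>i\<le>s div 2. fps_const (\<gamma> i g) * fps_X ^ i * (1 + fps_X) ^ (s - 2 * i))"
      proof (intro sum.cong refl arg_cong2[where f = "(*)"])
        fix i
        have "\<gamma> i g = of_int (\<Sum>w\<in>gamma_words i. beta (doms 1 w) (starts 1 w) False {})"
          unfolding \<gamma>_def sum_fun_apply bg by simp
        then show "of_int (\<Sum>w\<in>gamma_words i. beta (doms 1 w) (starts 1 w) False {}) = fps_const (\<gamma> i g)"
          by (simp only: fps_of_int)
      qed
      finally show "fps_at g (equivariant_h_star P r G) =
          (\<Sum>i\<le>s div 2. fps_const (\<gamma> i g) * fps_X ^ i * (1 + fps_X) ^ (s - 2 * i))" .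
    qed
  qed
qed

end
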